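(* $\bar F_\Delta=E'_\Delta$. Consequently $(G,G^*/\bar F_\Delta,e/\bar F_\Delta)$, with the action $g(a/\bar F_\Delta)=(ga)/\bar F_\Delta$ and the logic topology, is the universal $\Delta$-definable $G$-ambit.
   Context: Let $M$ be a first-order structure in a language $\mathcal L$, $\mathfrak C\succ M$ a monster model, and $G$ a group $\emptyset$-definable in $M$ by a formula $G(x)$; $G^*=G(\mathfrak C)$. Let $\Delta$ be a set of $\mathcal L$-formulas without parameters, each of the form $\psi(y\cdot x\cdot z;\bar t)$, such that $G(y\cdot x\cdot z)\in\Delta$. A $\Delta$-formula over $A$ is a formula over $\mathrm{dcl}(A)$ equivalent to a Boolean combination of instances of formulas from $\Delta$ with parameters from $\mathrm{dcl}(A)$; $\mathrm{tp}_\Delta(a/A)$ is the set of $\Delta$-formulas over $A$ true of $a$. $S_{G,\Delta}(M)$ is the Stone space of complete $\Delta$-types over $M$ containing $G(x)$, with $G$-action $g\,\mathrm{tp}_\Delta(a/M)=\mathrm{tp}_\Delta(ga/M)$. A $G$-ambit $(G,X,x_0)$ is an action of the discrete group $G$ on a compact Hausdorff space by homeomorphisms with a point of dense orbit; homomorphisms of ambits are continuous equivariant maps preserving the distinguished point. A map $f\colon G\to C$ to a compact Hausdorff space is $\Delta$-definable if preimages of any two disjoint closed sets can be separated by a subset of $G$ defined by a $\Delta$-formula over $M$; a flow is $\Delta$-definable if all orbit maps $g\mapsto gx$ are $\Delta$-definable; the universal $\Delta$-definable $G$-ambit is the (unique up to isomorphism) $\Delta$-definable $G$-ambit admitting a homomorphism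 onto every $\Delta$-definable $G$-ambit. Let $(G,\mathcal U,x_0)$ be it, $h$ the unique homomorphism of ambits $(G,S_{G,\Delta}(M),\mathrm{tp}_\Delta(e/M))\to(G,\mathcal U,x_0)$, and define $E'_\Delta$ on $G^*$ by $E'_\Delta(a,b)\iff h(\mathrm{tp}_\Delta(a/M))=h(\mathrm{tp}_\Delta(b/M))$. Define ${F_0}_\Delta(\alpha,\beta)$ on $G^*$ to hold iff there are $a,b,a_1,b_1\in G^*$ with $\alpha=ab$, $\beta=a_1b_1$, $\mathrm{tp}_\Delta(a/M)=\mathrm{tp}_\Delta(a_1/M)$, $\mathrm{tp}_\Delta(b/M)=\mathrm{tp}_\Delta(b_1/M)$, and both $\mathrm{tp}_\Delta(a/M,b)$ and $\mathrm{tp}_\Delta(a_1/M,b_1)$ finitely satisfiable in $M$. Let $F_\Delta$ be the transitive closure of ${F_0}_\Delta$ and $\bar F_\Delta$ the finest equivalence relation on $G^*$ type-definable over $M$ containing $F_\Delta$. For a bounded $M$-invariant equivalence relation $E$ on $G^*$, the logic topology on $G^*/E$ declares a set closed iff its preimage in $G^*$ is type-definable. *)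

theory Defs
  imports "HOL-Analysis.T1_Spaces" "HOL-Algebra.Group_Action"
begin

unbundle cardinal_syntax

section \<open>First-order logic\<close>

text \<open>
  Bound variables are de Bruijn indices. \<open>Par c\<close> is a constant naming the element \<open>c\<close>, so
  formulas over \<open>A\<close> are the formulas all of whose \<open>Par\<close>s lie in \<open>A\<close>.
\<close>

datatype ('f, tm_params: 'c) tm =
    Var nat
  | Par 'c
  | Fun 'f "('f, 'c) tm list"

datatype ('f, 'r, params: 'c) fm =
    Eq "('f, 'c) tm" "('f, 'c) tm"
  | Rel 'r "('f, 'c) tm list"
  | Neg "('f, 'r, 'c) fm"
  | Conj "('f, 'r, 'c) fm" "('f, 'r, 'c) fm"
  | Ex "('f, 'r, 'c) fm"

text \<open>
  A language (symbols with arities) together with an interpretation on the whole type \<open>'c\<close>.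
  Substructures are represented by their universes.
\<close>

record ('f, 'r, 'c) fo_structure =
  fn_arity :: "'f \<Rightarrow> nat"
  rel_arity :: "'r \<Rightarrow> nat"
  fn_interp :: "'f \<Rightarrow> 'c list \<Rightarrow> 'c"
  rel_interp :: "'r \<Rightarrow> 'c list \<Rightarrow> bool"

fun wf_tm :: "('f, 'r, 'c) fo_structure \<Rightarrow> ('f, 'c) tm \<Rightarrow> bool" where
  "wf_tm C (Var i) \<longleftrightarrow> True"
| "wf_tm C (Par c) \<longleftrightarrow> True"
| "wf_tm C (Fun f ts) \<longleftrightarrow> length ts = fn_arity C f \<and> (\<forall>t\<in>set ts. wf_tm C t)"

primrec wf_fm :: "('f, 'r, 'c) fo_structure \<Rightarrow> ('f, 'r, 'c) fm \<Rightarrow> bool" where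
  "wf_fm C (Eq t u) \<longleftrightarrow> wf_tm C t \<and> wf_tm C u"
| "wf_fm C (Rel r ts) \<longleftrightarrow> length ts = rel_arity C r \<and> (\<forall>t\<in>set ts. wf_tm C t)"
| "wf_fm C (Neg \<phi>) \<longleftrightarrow> wf_fm C \<phi>"
| "wf_fm C (Conj \<phi> \<psi>) \<longleftrightarrow> wf_fm C \<phi> \<and> wf_fm C \<psi>"
| "wf_fm C (Ex \<phi>) \<longleftrightarrow> wf_fm C \<phi>"

fun fv_tm :: "('f, 'c) tm \<Rightarrow> nat set" where
  "fv_tm (Var i) = {i}"
| "fv_tm (Par c) = {}"
| "fv_tm (Fun f ts) = (\<Union>t\<in>set ts. fv_tm t)"

primrec fv :: "('f, 'r, 'c) fm \<Rightarrow> nat set" where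
  "fv (Eq t u) = fv_tm t \<union> fv_tm u"
| "fv (Rel r ts) = (\<Union>t\<in>set ts. fv_tm t)"
| "fv (Neg \<phi>) = fv \<phi>"
| "fv (Conj \<phi> \<psi>) = fv \<phi> \<union> fv \<psi>"
| "fv (Ex \<phi>) = {i. Suc i \<in> fv \<phi>}"

primrec eval_tm :: "('f, 'r, 'c) fo_structure \<Rightarrow> (nat \<Rightarrow> 'c) \<Rightarrow> ('f, 'c) tm \<Rightarrow> 'c" where
  "eval_tm C s (Var i) = s i"
| "eval_tm C s (Par c) = c"
| "eval_tm C s (Fun f ts) = fn_interp C f (map (eval_tm C s) ts)"

text \<open>\<open>sat C D s \<phi>\<close>: the substructure of \<open>C\<close> with universe \<open>D\<close> satisfies \<open>\<phi>\<close> under \<open>s\<close>.\<close>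

primrec sat :: "('f, 'r, 'c) fo_structure \<Rightarrow> 'c set \<Rightarrow> (nat \<Rightarrow> 'c) \<Rightarrow> ('f, 'r, 'c) fm \<Rightarrow> bool" where
  "sat C D s (Eq t u) \<longleftrightarrow> eval_tm C s t = eval_tm C s u"
| "sat C D s (Rel r ts) \<longleftrightarrow> rel_interp C r (map (eval_tm C s) ts)"
| "sat C D s (Neg \<phi>) \<longleftrightarrow> \<not> sat C D s \<phi>"
| "sat C D s (Conj \<phi> \<psi>) \<longleftrightarrow> sat C D s \<phi> \<and> sat C D s \<psi>"
| "sat C D s (Ex \<phi>) \<longleftrightarrow> (\<exists>d\<in>D. sat C D (case_nat d s) \<phi>)"

text \<open>
  A tuple \<open>a\<close> is a list; it interprets the variables \<open>0, \<dots>, length a - 1\<close>, and the notion is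
  only used for formulas with no other free variables.
\<close>

abbreviation holds_in :: "('f, 'r, 'c) fo_structure \<Rightarrow> 'c set \<Rightarrow> ('f, 'r, 'c) fm \<Rightarrow> 'c list \<Rightarrow> bool" where
  "holds_in C D \<phi> a \<equiv> sat C D ((!) a) \<phi>"

abbreviation holds :: "('f, 'r, 'c) fo_structure \<Rightarrow> ('f, 'r, 'c) fm \<Rightarrow> 'c list \<Rightarrow> bool" where
  "holds C \<equiv> holds_in C UNIV"

definition fms_over :: "('f, 'r, 'c) fo_structure \<Rightarrow> 'c set \<Rightarrow> ('f, 'r, 'c) fm set" where
  "fms_over C A = {\<phi>. wf_fm C \<phi> \<and> params \<phi> \<subseteq> A}"

definition elementary_substructure :: "('f, 'r, 'c) fo_structure \<Rightarrow> 'c set \<Rightarrow> bool" where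
  "elementary_substructure C M \<longleftrightarrow>
     M \<noteq> {} \<and>
     (\<forall>f xs. length xs = fn_arity C f \<and> set xs \<subseteq> M \<longrightarrow> fn_interp C f xs \<in> M) \<and>
     (\<forall>\<phi>\<in>fms_over C {}. \<forall>s. range s \<subseteq> M \<longrightarrow> sat C M s \<phi> = sat C UNIV s \<phi>)"

definition dcl :: "('f, 'r, 'c) fo_structure \<Rightarrow> 'c set \<Rightarrow> 'c set" where
  "dcl C A = {c. \<exists>\<phi>\<in>fms_over C A. fv \<phi> \<subseteq> {0} \<and> (\<forall>d. holds C \<phi> [d] \<longleftrightarrow> d = c)}"

definition automorphism :: "('f, 'r, 'c) fo_structure \<Rightarrow> ('c \<Rightarrow> 'c) \<Rightarrow> bool" where
  "automorphism C \<sigma> \<longleftrightarrow>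
     bij \<sigma> \<and>
     (\<forall>f xs. length xs = fn_arity C f \<longrightarrow> \<sigma> (fn_interp C f xs) = fn_interp C f (map \<sigma> xs)) \<and>
     (\<forall>r xs. length xs = rel_arity C r \<longrightarrow> rel_interp C r (map \<sigma> xs) = rel_interp C r xs)"

section \<open>Monster models\<close>

definition saturated :: "'k rel \<Rightarrow> ('f, 'r, 'c) fo_structure \<Rightarrow> bool" where
  "saturated \<kappa> C \<longleftrightarrow>
     (\<forall>A m p. |A| <o \<kappa> \<and> p \<subseteq> {\<phi> \<in> fms_over C A. fv \<phi> \<subseteq> {..<m}} \<and>
        (\<forall>q. finite q \<and> q \<subseteq> p \<longrightarrow> (\<exists>a. length a = m \<and> (\<forall>\<phi>\<in>q. holds C \<phi> a))) \<longrightarrow>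
        (\<exists>a. length a = m \<and> (\<forall>\<phi>\<in>p. holds C \<phi> a)))"

definition strongly_homogeneous :: "'k rel \<Rightarrow> ('f, 'r, 'c) fo_structure \<Rightarrow> bool" where
  "strongly_homogeneous \<kappa> C \<longleftrightarrow>
     (\<forall>A j. |A| <o \<kappa> \<and>
        (\<forall>\<phi>\<in>fms_over C {}. \<forall>s. range s \<subseteq> A \<longrightarrow> sat C UNIV (j \<circ> s) \<phi> = sat C UNIV s \<phi>) \<longrightarrow>
        (\<exists>\<sigma>. automorphism C \<sigma> \<and> (\<forall>a\<in>A. \<sigma> a = j a)))"

text \<open>
  \<open>C\<close> is a monster model containing \<open>M\<close>. ``Small'' means of cardinality less than \<open>\<kappa>\<close>. That \<open>\<kappa>\<close>
  is sufficiently large is made precise as \<open>\<kappa> > 2\<close> to the number of formulas over \<open>M\<close>, the latter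
  being \<open>|M| + |L| + \<aleph>\<^sub>0\<close>.
\<close>

definition monster_model :: "'k rel \<Rightarrow> ('f, 'r, 'c) fo_structure \<Rightarrow> 'c set \<Rightarrow> bool" where
  "monster_model \<kappa> C M \<longleftrightarrow>
     Card_order \<kappa> \<and> |Pow (fms_over C M)| <o \<kappa> \<and>
     saturated \<kappa> C \<and> strongly_homogeneous \<kappa> C \<and> elementary_substructure C M"

text \<open>\<open>X\<close> is a set of \<open>m\<close>-tuples that is the intersection of sets definable over \<open>A\<close>.\<close>

definition type_definable_over ::
    "('f, 'r, 'c) fo_structure \<Rightarrow> nat \<Rightarrow> 'c set \<Rightarrow> 'c list set \<Rightarrow> bool" where
  "type_definable_over C m A X \<longleftrightarrow>
     (\<exists>p \<subseteq> {\<phi> \<in> fms_over C A. fv \<phi> \<subseteq> {..<m}}. X = {a. length a = m \<and> (\<forall>\<phi>\<in>p. holds C \<phi> a)})"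

definition type_definable :: "'k rel \<Rightarrow> ('f, 'r, 'c) fo_structure \<Rightarrow> nat \<Rightarrow> 'c list set \<Rightarrow> bool" where
  "type_definable \<kappa> C m X \<longleftrightarrow> (\<exists>A. |A| <o \<kappa> \<and> type_definable_over C m A X)"

section \<open>Definable groups\<close>

text \<open>
  A group consisting of \<open>dim\<close>-tuples; \<open>dom_fm\<close> is the formula \<open>G(x)\<close> and \<open>mult_fm\<close>, with free
  variables in three consecutive blocks of length \<open>dim\<close>, defines the graph of multiplication.
\<close>

record ('f, 'r, 'c) dgroup =
  dim :: nat
  dom_fm :: "('f, 'r, 'c) fm"
  mult_fm :: "('f, 'r, 'c) fm"

definition dcarrier :: "('f, 'r, 'c) fo_structure \<Rightarrow> ('f, 'r, 'c) dgroup \<Rightarrow> 'c set \<Rightarrow> 'c list set" where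
  "dcarrier C \<Gamma> D = {a. length a = dim \<Gamma> \<and> set a \<subseteq> D \<and> holds_in C D (dom_fm \<Gamma>) a}"

definition dmult ::
    "('f, 'r, 'c) fo_structure \<Rightarrow> ('f, 'r, 'c) dgroup \<Rightarrow> 'c set \<Rightarrow> 'c list \<Rightarrow> 'c list \<Rightarrow> 'c list" where
  "dmult C \<Gamma> D a b = (THE c. c \<in> dcarrier C \<Gamma> D \<and> holds_in C D (mult_fm \<Gamma>) (a @ b @ c))"

definition dunit :: "('f, 'r, 'c) fo_structure \<Rightarrow> ('f, 'r, 'c) dgroup \<Rightarrow> 'c set \<Rightarrow> 'c list" where
  "dunit C \<Gamma> D =
     (THE e. e \<in> dcarrier C \<Gamma> D \<and>
        (\<forall>a\<in>dcarrier C \<Gamma> D. dmult C \<Gamma> D e a = a \<and> dmult C \<Gamma> D a e = a))"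

definition pts :: "('f, 'r, 'c) fo_structure \<Rightarrow> ('f, 'r, 'c) dgroup \<Rightarrow> 'c set \<Rightarrow> 'c list monoid" where
  "pts C \<Gamma> D = \<lparr>carrier = dcarrier C \<Gamma> D, mult = dmult C \<Gamma> D, one = dunit C \<Gamma> D\<rparr>"

abbreviation Gstar :: "('f, 'r, 'c) fo_structure \<Rightarrow> ('f, 'r, 'c) dgroup \<Rightarrow> 'c list monoid" where
  "Gstar C \<Gamma> \<equiv> pts C \<Gamma> UNIV"

definition definable_group :: "('f, 'r, 'c) fo_structure \<Rightarrow> 'c set \<Rightarrow> ('f, 'r, 'c) dgroup \<Rightarrow> bool" where
  "definable_group C M \<Gamma> \<longleftrightarrow>
     dom_fm \<Gamma> \<in> fms_over C {} \<and> fv (dom_fm \<Gamma>) \<subseteq> {..<dim \<Gamma>} \<and>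
     mult_fm \<Gamma> \<in> fms_over C {} \<and> fv (mult_fm \<Gamma>) \<subseteq> {..<3 * dim \<Gamma>} \<and>
     (\<forall>a\<in>dcarrier C \<Gamma> M. \<forall>b\<in>dcarrier C \<Gamma> M.
        \<exists>!c. c \<in> dcarrier C \<Gamma> M \<and> holds_in C M (mult_fm \<Gamma>) (a @ b @ c)) \<and>
     group (pts C \<Gamma> M)"

section \<open>\<open>\<Delta>\<close>-formulas and \<open>\<Delta>\<close>-types\<close>

text \<open>
  \<open>\<delta>\<close> is the formula \<open>\<psi>(y\<cdot>x\<cdot>z; t)\<close>, where \<open>t\<close> has length \<open>k\<close>. The free variables of \<open>\<delta>\<close> are
  ordered \<open>x, y, z, t\<close>. As multiplication is a partial function on tuples, \<open>\<psi>(y\<cdot>x\<cdot>z; t)\<close> means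
  ``\<open>x, y, z\<close> are in \<open>G\<close> and their product \<open>w = y\<cdot>x\<cdot>z\<close> satisfies \<open>\<psi>(w; t)\<close>''.
\<close>

definition is_product_fm ::
    "('f, 'r, 'c) fo_structure \<Rightarrow> ('f, 'r, 'c) dgroup \<Rightarrow> nat \<Rightarrow>
     ('f, 'r, 'c) fm \<Rightarrow> ('f, 'r, 'c) fm \<Rightarrow> bool" where
  "is_product_fm C \<Gamma> k \<psi> \<delta> \<longleftrightarrow>
     \<psi> \<in> fms_over C {} \<and> fv \<psi> \<subseteq> {..<dim \<Gamma> + k} \<and>
     \<delta> \<in> fms_over C {} \<and> fv \<delta> \<subseteq> {..<3 * dim \<Gamma> + k} \<and>
     (\<forall>x y z t. length x = dim \<Gamma> \<and> length y = dim \<Gamma> \<and> length z = dim \<Gamma> \<and> length t = k \<longrightarrow>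
        (holds C \<delta> (x @ y @ z @ t) \<longleftrightarrow>
           x \<in> carrier (Gstar C \<Gamma>) \<and> y \<in> carrier (Gstar C \<Gamma>) \<and> z \<in> carrier (Gstar C \<Gamma>) \<and>
           holds C \<psi> ((y \<otimes>\<^bsub>Gstar C \<Gamma>\<^esub> x \<otimes>\<^bsub>Gstar C \<Gamma>\<^esub> z) @ t)))"

definition admissible_Delta ::
    "('f, 'r, 'c) fo_structure \<Rightarrow> ('f, 'r, 'c) dgroup \<Rightarrow> ('f, 'r, 'c) fm set \<Rightarrow> bool" where
  "admissible_Delta C \<Gamma> \<Delta> \<longleftrightarrow>
     (\<forall>\<delta>\<in>\<Delta>. \<exists>k \<psi>. is_product_fm C \<Gamma> k \<psi> \<delta>) \<and>
     (\<exists>\<delta>\<in>\<Delta>. is_product_fm C \<Gamma> 0 (dom_fm \<Gamma>) \<delta>)"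

text \<open>Substitution of the parameters \<open>ps\<close> for the free variables \<open>n, n + 1, \<dots>\<close>.\<close>

fun inst_tm :: "nat \<Rightarrow> 'c list \<Rightarrow> ('f, 'c) tm \<Rightarrow> ('f, 'c) tm" where
  "inst_tm n ps (Var i) = (if i < n then Var i else Par (ps ! (i - n)))"
| "inst_tm n ps (Par c) = Par c"
| "inst_tm n ps (Fun f ts) = Fun f (map (inst_tm n ps) ts)"

primrec inst :: "nat \<Rightarrow> 'c list \<Rightarrow> ('f, 'r, 'c) fm \<Rightarrow> ('f, 'r, 'c) fm" where
  "inst n ps (Eq t u) = Eq (inst_tm n ps t) (inst_tm n ps u)"
| "inst n ps (Rel r ts) = Rel r (map (inst_tm n ps) ts)"
| "inst n ps (Neg \<phi>) = Neg (inst n ps \<phi>)"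
| "inst n ps (Conj \<phi> \<psi>) = Conj (inst n ps \<phi>) (inst n ps \<psi>)"
| "inst n ps (Ex \<phi>) = Ex (inst (Suc n) ps \<phi>)"

definition Delta_instances ::
    "('f, 'r, 'c) fo_structure \<Rightarrow> ('f, 'r, 'c) dgroup \<Rightarrow> ('f, 'r, 'c) fm set \<Rightarrow> 'c set \<Rightarrow>
     ('f, 'r, 'c) fm set" where
  "Delta_instances C \<Gamma> \<Delta> A =
     {inst (dim \<Gamma>) ps \<delta> | \<delta> ps. \<delta> \<in> \<Delta> \<and> fv \<delta> \<subseteq> {..<dim \<Gamma> + length ps} \<and> set ps \<subseteq> dcl C A}"

inductive_set boolean_combinations :: "('f, 'r, 'c) fm set \<Rightarrow> ('f, 'r, 'c) fm set"
  for B where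
  base: "\<phi> \<in> B \<Longrightarrow> \<phi> \<in> boolean_combinations B"
| neg: "\<phi> \<in> boolean_combinations B \<Longrightarrow> Neg \<phi> \<in> boolean_combinations B"
| conj: "\<phi> \<in> boolean_combinations B \<Longrightarrow> \<psi> \<in> boolean_combinations B \<Longrightarrow>
         Conj \<phi> \<psi> \<in> boolean_combinations B"

definition Delta_fms ::
    "('f, 'r, 'c) fo_structure \<Rightarrow> ('f, 'r, 'c) dgroup \<Rightarrow> ('f, 'r, 'c) fm set \<Rightarrow> 'c set \<Rightarrow>
     ('f, 'r, 'c) fm set" where
  "Delta_fms C \<Gamma> \<Delta> A =
     {\<phi> \<in> fms_over C (dcl C A). fv \<phi> \<subseteq> {..<dim \<Gamma>} \<and>
        (\<exists>\<chi>\<in>boolean_combinations (Delta_instances C \<Gamma> \<Delta> A).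
           \<forall>a. length a = dim \<Gamma> \<longrightarrow> holds C \<phi> a = holds C \<chi> a)}"

definition tpD ::
    "('f, 'r, 'c) fo_structure \<Rightarrow> ('f, 'r, 'c) dgroup \<Rightarrow> ('f, 'r, 'c) fm set \<Rightarrow> 'c list \<Rightarrow> 'c set \<Rightarrow>
     ('f, 'r, 'c) fm set" where
  "tpD C \<Gamma> \<Delta> a A = {\<phi> \<in> Delta_fms C \<Gamma> \<Delta> A. holds C \<phi> a}"

definition finitely_satisfiable_in ::
    "('f, 'r, 'c) fo_structure \<Rightarrow> nat \<Rightarrow> ('f, 'r, 'c) fm set \<Rightarrow> 'c set \<Rightarrow> bool" where
  "finitely_satisfiable_in C m p D \<longleftrightarrow>
     (\<forall>q. finite q \<and> q \<subseteq> p \<longrightarrow> (\<exists>a. length a = m \<and> set a \<subseteq> D \<and> (\<forall>\<phi>\<in>q. holds C \<phi> a)))"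

definition complete_Delta_types ::
    "('f, 'r, 'c) fo_structure \<Rightarrow> 'c set \<Rightarrow> ('f, 'r, 'c) dgroup \<Rightarrow> ('f, 'r, 'c) fm set \<Rightarrow>
     ('f, 'r, 'c) fm set set" where
  "complete_Delta_types C M \<Gamma> \<Delta> =
     {p. p \<subseteq> Delta_fms C \<Gamma> \<Delta> M \<and> finitely_satisfiable_in C (dim \<Gamma>) p UNIV \<and>
         (\<forall>\<phi>\<in>Delta_fms C \<Gamma> \<Delta> M. \<phi> \<in> p \<or> Neg \<phi> \<in> p) \<and> dom_fm \<Gamma> \<in> p}"

definition stone_space ::
    "('f, 'r, 'c) fo_structure \<Rightarrow> 'c set \<Rightarrow> ('f, 'r, 'c) dgroup \<Rightarrow> ('f, 'r, 'c) fm set \<Rightarrow>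
     ('f, 'r, 'c) fm set topology" where
  "stone_space C M \<Gamma> \<Delta> =
     topology_generated_by
       ((\<lambda>\<phi>. {p \<in> complete_Delta_types C M \<Gamma> \<Delta>. \<phi> \<in> p}) ` Delta_fms C \<Gamma> \<Delta> M)"

definition stone_action ::
    "('f, 'r, 'c) fo_structure \<Rightarrow> 'c set \<Rightarrow> ('f, 'r, 'c) dgroup \<Rightarrow> ('f, 'r, 'c) fm set \<Rightarrow>
     'c list \<Rightarrow> ('f, 'r, 'c) fm set \<Rightarrow> ('f, 'r, 'c) fm set" where
  "stone_action C M \<Gamma> \<Delta> g =
     (\<lambda>p\<in>complete_Delta_types C M \<Gamma> \<Delta>.
        THE q. \<exists>a\<in>carrier (Gstar C \<Gamma>). p = tpD C \<Gamma> \<Delta> a M \<and> q = tpD C \<Gamma> \<Delta> (g \<otimes>\<^bsub>Gstar C \<Gamma>\<^esub> a) M)"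

section \<open>Flows and ambits\<close>

text \<open>A flow is a pair \<open>X, \<alpha>\<close>, an ambit a triple \<open>X, \<alpha>, x0\<close>.\<close>

definition flow :: "('g, 'b) monoid_scheme \<Rightarrow> 'x topology \<Rightarrow> ('g \<Rightarrow> 'x \<Rightarrow> 'x) \<Rightarrow> bool" where
  "flow H X \<alpha> \<longleftrightarrow>
     compact_space X \<and> Hausdorff_space X \<and> group_action H (topspace X) \<alpha> \<and>
     (\<forall>g\<in>carrier H. homeomorphic_map X X (\<alpha> g))"

definition ambit :: "('g, 'b) monoid_scheme \<Rightarrow> 'x topology \<Rightarrow> ('g \<Rightarrow> 'x \<Rightarrow> 'x) \<Rightarrow> 'x \<Rightarrow> bool" where
  "ambit H X \<alpha> x0 \<longleftrightarrow>
     flow H X \<alpha> \<and> x0 \<in> topspace X \<and> X closure_of (orbit H \<alpha> x0) = topspace X"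

definition ambit_hom ::
    "('g, 'b) monoid_scheme \<Rightarrow> 'x topology \<Rightarrow> ('g \<Rightarrow> 'x \<Rightarrow> 'x) \<Rightarrow> 'x \<Rightarrow>
     'y topology \<Rightarrow> ('g \<Rightarrow> 'y \<Rightarrow> 'y) \<Rightarrow> 'y \<Rightarrow> ('x \<Rightarrow> 'y) \<Rightarrow> bool" where
  "ambit_hom H X \<alpha> x0 Y \<beta> y0 h \<longleftrightarrow>
     continuous_map X Y h \<and>
     (\<forall>g\<in>carrier H. \<forall>x\<in>topspace X. h (\<alpha> g x) = \<beta> g (h x)) \<and> h x0 = y0"

definition Delta_definable_map ::
    "('f, 'r, 'c) fo_structure \<Rightarrow> 'c set \<Rightarrow> ('f, 'r, 'c) dgroup \<Rightarrow> ('f, 'r, 'c) fm set \<Rightarrow>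
     'x topology \<Rightarrow> ('c list \<Rightarrow> 'x) \<Rightarrow> bool" where
  "Delta_definable_map C M \<Gamma> \<Delta> X f \<longleftrightarrow>
     f \<in> carrier (pts C \<Gamma> M) \<rightarrow> topspace X \<and>
     (\<forall>K L. closedin X K \<and> closedin X L \<and> disjnt K L \<longrightarrow>
        (\<exists>\<phi>\<in>Delta_fms C \<Gamma> \<Delta> M. \<forall>g\<in>carrier (pts C \<Gamma> M).
           (f g \<in> K \<longrightarrow> holds C \<phi> g) \<and> (f g \<in> L \<longrightarrow> \<not> holds C \<phi> g)))"

definition Delta_definable_flow ::
    "('f, 'r, 'c) fo_structure \<Rightarrow> 'c set \<Rightarrow> ('f, 'r, 'c) dgroup \<Rightarrow> ('f, 'r, 'c) fm set \<Rightarrow>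
     'x topology \<Rightarrow> ('c list \<Rightarrow> 'x \<Rightarrow> 'x) \<Rightarrow> bool" where
  "Delta_definable_flow C M \<Gamma> \<Delta> X \<alpha> \<longleftrightarrow>
     flow (pts C \<Gamma> M) X \<alpha> \<and>
     (\<forall>x\<in>topspace X. Delta_definable_map C M \<Gamma> \<Delta> X (\<lambda>g. \<alpha> g x))"

definition Delta_definable_ambit ::
    "('f, 'r, 'c) fo_structure \<Rightarrow> 'c set \<Rightarrow> ('f, 'r, 'c) dgroup \<Rightarrow> ('f, 'r, 'c) fm set \<Rightarrow>
     'x topology \<Rightarrow> ('c list \<Rightarrow> 'x \<Rightarrow> 'x) \<Rightarrow> 'x \<Rightarrow> bool" where
  "Delta_definable_ambit C M \<Gamma> \<Delta> X \<alpha> x0 \<longleftrightarrow>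
     ambit (pts C \<Gamma> M) X \<alpha> x0 \<and> Delta_definable_flow C M \<Gamma> \<Delta> X \<alpha>"

text \<open>
  A definition in HOL cannot quantify over types, so the type \<open>'y\<close> of the points of the ambits
  against which universality is tested is an argument. For \<open>'y = 'c list set\<close> this is no restriction,
  since every \<open>\<Delta>\<close>-definable ambit \<open>Y\<close> has an isomorphic copy whose points are subsets of \<open>G\<^sup>*\<close>: it is
  a quotient of the ambit of complete \<open>\<Delta>\<close>-types, hence, as a set, of \<open>G\<^sup>*\<close>, and the fibres of
  \<open>G\<^sup>* \<rightarrow> Y\<close> serve as points.
\<close>

definition universal_Delta_ambit ::
    "'y itself \<Rightarrow> ('f, 'r, 'c) fo_structure \<Rightarrow> 'c set \<Rightarrow> ('f, 'r, 'c) dgroup \<Rightarrow>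
     ('f, 'r, 'c) fm set \<Rightarrow> 'x topology \<Rightarrow> ('c list \<Rightarrow> 'x \<Rightarrow> 'x) \<Rightarrow> 'x \<Rightarrow> bool" where
  "universal_Delta_ambit (_ :: 'y itself) C M \<Gamma> \<Delta> X \<alpha> x0 \<longleftrightarrow>
     Delta_definable_ambit C M \<Gamma> \<Delta> X \<alpha> x0 \<and>
     (\<forall>(Y :: 'y topology) \<beta> y0. Delta_definable_ambit C M \<Gamma> \<Delta> Y \<beta> y0 \<longrightarrow>
        (\<exists>h. ambit_hom (pts C \<Gamma> M) X \<alpha> x0 Y \<beta> y0 h \<and> h ` topspace X = topspace Y))"

section \<open>The relations \<open>E'\<^sub>\<Delta>\<close>, \<open>F\<^sub>0\<^sub>\<Delta>\<close>, \<open>F\<^sub>\<Delta>\<close> and the closure of \<open>F\<^sub>\<Delta>\<close>\<close>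

definition E'_Delta ::
    "('f, 'r, 'c) fo_structure \<Rightarrow> 'c set \<Rightarrow> ('f, 'r, 'c) dgroup \<Rightarrow> ('f, 'r, 'c) fm set \<Rightarrow>
     (('f, 'r, 'c) fm set \<Rightarrow> 'u) \<Rightarrow> 'c list rel" where
  "E'_Delta C M \<Gamma> \<Delta> h =
     {(a, b). a \<in> carrier (Gstar C \<Gamma>) \<and> b \<in> carrier (Gstar C \<Gamma>) \<and>
        h (tpD C \<Gamma> \<Delta> a M) = h (tpD C \<Gamma> \<Delta> b M)}"

definition F0_Delta ::
    "('f, 'r, 'c) fo_structure \<Rightarrow> 'c set \<Rightarrow> ('f, 'r, 'c) dgroup \<Rightarrow> ('f, 'r, 'c) fm set \<Rightarrow>
     'c list rel" where
  "F0_Delta C M \<Gamma> \<Delta> =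
     {(a \<otimes>\<^bsub>Gstar C \<Gamma>\<^esub> b, a1 \<otimes>\<^bsub>Gstar C \<Gamma>\<^esub> b1) | a b a1 b1.
        {a, b, a1, b1} \<subseteq> carrier (Gstar C \<Gamma>) \<and>
        tpD C \<Gamma> \<Delta> a M = tpD C \<Gamma> \<Delta> a1 M \<and> tpD C \<Gamma> \<Delta> b M = tpD C \<Gamma> \<Delta> b1 M \<and>
        finitely_satisfiable_in C (dim \<Gamma>) (tpD C \<Gamma> \<Delta> a (M \<union> set b)) M \<and>
        finitely_satisfiable_in C (dim \<Gamma>) (tpD C \<Gamma> \<Delta> a1 (M \<union> set b1)) M}"

definition F_Delta ::
    "('f, 'r, 'c) fo_structure \<Rightarrow> 'c set \<Rightarrow> ('f, 'r, 'c) dgroup \<Rightarrow> ('f, 'r, 'c) fm set \<Rightarrow>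
     'c list rel" where
  "F_Delta C M \<Gamma> \<Delta> = (F0_Delta C M \<Gamma> \<Delta>)\<^sup>+"

text \<open>
  Type-definability over \<open>M\<close> and the property of being an equivalence relation are preserved by
  intersections, so the finest such relation is the intersection of all of them.
\<close>

definition Fbar_Delta ::
    "('f, 'r, 'c) fo_structure \<Rightarrow> 'c set \<Rightarrow> ('f, 'r, 'c) dgroup \<Rightarrow> ('f, 'r, 'c) fm set \<Rightarrow>
     'c list rel" where
  "Fbar_Delta C M \<Gamma> \<Delta> =
     \<Inter>{E. equiv (carrier (Gstar C \<Gamma>)) E \<and>
         type_definable_over C (2 * dim \<Gamma>) M ((\<lambda>(a, b). a @ b) ` E) \<and> F_Delta C M \<Gamma> \<Delta> \<subseteq> E}"

definition M_invariant :: "('f, 'r, 'c) fo_structure \<Rightarrow> 'c set \<Rightarrow> 'c list rel \<Rightarrow> bool" where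
  "M_invariant C M E \<longleftrightarrow>
     (\<forall>\<sigma>. automorphism C \<sigma> \<and> (\<forall>m\<in>M. \<sigma> m = m) \<longrightarrow> (\<forall>(a, b)\<in>E. (map \<sigma> a, map \<sigma> b) \<in> E))"

definition logic_topology ::
    "'k rel \<Rightarrow> ('f, 'r, 'c) fo_structure \<Rightarrow> ('f, 'r, 'c) dgroup \<Rightarrow> 'c list rel \<Rightarrow>
     'c list set topology" where
  "logic_topology \<kappa> C \<Gamma> E =
     topology (\<lambda>U. U \<subseteq> carrier (Gstar C \<Gamma>) // E \<and>
       type_definable \<kappa> C (dim \<Gamma>)
         {a \<in> carrier (Gstar C \<Gamma>). E `` {a} \<in> (carrier (Gstar C \<Gamma>) // E) - U})"

text \<open>The action \<open>g (a/E) = (g a)/E\<close>, in the form used for functions lifted to quotients.\<close>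

definition quotient_action ::
    "('f, 'r, 'c) fo_structure \<Rightarrow> ('f, 'r, 'c) dgroup \<Rightarrow> 'c list rel \<Rightarrow>
     'c list \<Rightarrow> 'c list set \<Rightarrow> 'c list set" where
  "quotient_action C \<Gamma> E g =
     (\<lambda>X\<in>carrier (Gstar C \<Gamma>) // E. \<Union>a\<in>X. E `` {g \<otimes>\<^bsub>Gstar C \<Gamma>\<^esub> a})"

end

(*
  Give G* the topology whose basic open sets are defined by Delta-formulas over M; it is compact
  by saturation. An equivalence relation that is coarser than equality of Delta-types is
  type-definable over M iff it is closed, so the closure of F is the least closed equivalence
  relation containing F_0, and the logic topology on the quotient is the quotient topology, which
  is compact Hausdorff. The quotient flow is definable: if {g in G(M) : gb in K} and
  {g in G(M) : gb in L} are not separated by a Delta-formula, then a Delta-type in both closures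
  has realizations a, a1 that are coheirs over b with ab in K and a1b in L, so F_0 relates ab to
  a1b and K meets L. Conversely, for a continuous equivariant map f from G* to a Delta-definable
  flow and a coheir a over b, f(ab) is the limit of g f(b) for g tending to a; by definability of
  the orbit map of f(b) it depends only on the Delta-types of a and b, whence F_0 lies in the
  kernel of f. The orbit map of every Delta-definable ambit extends to such an f.
*)
theory Submission
  imports Defs "HOL-Analysis.Urysohn"
begin

section \<open>Substitution of terms for variables and parameters\<close>

text \<open>The variable z in \<psi>(y x z; t) makes coheirs usable: if B is a \<Delta>-set over M,
  then {x : x b \<in> B} is a \<Delta>-set over M and b, so a product a b can be tested on the
  products g b with g in G(M). F_0 compares two pairs for a reason: the closures of two subsets of
  G(M) may share a type p although no single realization of p is a limit of both over M and b, so
  one realization is taken for each subset. That the relations considered are coarser than equality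
  of types costs nothing, as F_0 itself contains that equality. The topology is put on G* rather
  than on the space of types, which keeps types, their realizations and products of realizations in
  one space. G(M) alone is assumed to be a group; the laws on G* have to be obtained from
  elementarity.\<close>

primrec shift_tm :: "('f, 'c) tm \<Rightarrow> ('f, 'c) tm" where
  "shift_tm (Var i) = Var (Suc i)"
| "shift_tm (Par c) = Par c"
| "shift_tm (Fun f ts) = Fun f (map shift_tm ts)"

primrec subst_tm ::
    "(nat \<Rightarrow> ('f, 'c) tm) \<Rightarrow> ('c \<Rightarrow> ('f, 'c) tm) \<Rightarrow> ('f, 'c) tm \<Rightarrow> ('f, 'c) tm" where
  "subst_tm \<rho> \<pi> (Var i) = \<rho> i"
| "subst_tm \<rho> \<pi> (Par c) = \<pi> c"
| "subst_tm \<rho> \<pi> (Fun f ts) = Fun f (map (subst_tm \<rho> \<pi>) ts)"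

text \<open>Variables and parameters are replaced at once, so that a parameter can become a variable
  and a variable a parameter. Under a quantifier both substitutions are shifted and the bound
  variable 0 is kept.\<close>

primrec subst ::
    "(nat \<Rightarrow> ('f, 'c) tm) \<Rightarrow> ('c \<Rightarrow> ('f, 'c) tm) \<Rightarrow> ('f, 'r, 'c) fm \<Rightarrow> ('f, 'r, 'c) fm" where
  "subst \<rho> \<pi> (Eq t u) = Eq (subst_tm \<rho> \<pi> t) (subst_tm \<rho> \<pi> u)"
| "subst \<rho> \<pi> (Rel r ts) = Rel r (map (subst_tm \<rho> \<pi>) ts)"
| "subst \<rho> \<pi> (Neg \<phi>) = Neg (subst \<rho> \<pi> \<phi>)"
| "subst \<rho> \<pi> (Conj \<phi> \<psi>) = Conj (subst \<rho> \<pi> \<phi>) (subst \<rho> \<pi> \<psi>)"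
| "subst \<rho> \<pi> (Ex \<phi>) = Ex (subst (case_nat (Var 0) (shift_tm \<circ> \<rho>)) (shift_tm \<circ> \<pi>) \<phi>)"

lemma eval_shift_tm [simp]: "eval_tm C (case_nat d s) (shift_tm t) = eval_tm C s t"
  by (induction t) (auto cong: map_cong)

lemma eval_subst_tm:
  "\<forall>c\<in>tm_params t. eval_tm C s (\<pi> c) = c \<Longrightarrow>
   eval_tm C s (subst_tm \<rho> \<pi> t) = eval_tm C (\<lambda>i. eval_tm C s (\<rho> i)) t"
proof (induction t)
  case (Fun f ts)
  then have "map (eval_tm C s \<circ> subst_tm \<rho> \<pi>) ts = map (eval_tm C (\<lambda>i. eval_tm C s (\<rho> i))) ts"
    by (intro map_cong) auto
  then show ?case by (simp del: map_eq_conv)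
qed auto

text \<open>The hypothesis says that the term replacing a parameter still denotes that parameter
  under \<open>s\<close>. The universe \<open>D\<close> is arbitrary because the lemma serves both M
  and the monster model.\<close>

lemma sat_subst:
  "\<forall>c\<in>params \<phi>. eval_tm C s (\<pi> c) = c \<Longrightarrow>
   sat C D s (subst \<rho> \<pi> \<phi>) = sat C D (\<lambda>i. eval_tm C s (\<rho> i)) \<phi>"
proof (induction \<phi> arbitrary: \<rho> \<pi> s)
  case (Rel r ts)
  then have "map (eval_tm C s \<circ> subst_tm \<rho> \<pi>) ts = map (eval_tm C (\<lambda>i. eval_tm C s (\<rho> i))) ts"
    by (intro map_cong) (auto simp: eval_subst_tm)
  then show ?case by (simp del: map_eq_conv)
next
  case (Ex \<phi>)
  have "(\<lambda>i. eval_tm C (case_nat d s) (case_nat (Var 0) (shift_tm \<circ> \<rho>) i))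
      = case_nat d (\<lambda>i. eval_tm C s (\<rho> i))" for d
    by (auto split: nat.split)
  with Ex show ?case by simp
qed (auto simp: eval_subst_tm)

lemma eval_tm_cong: "\<forall>i\<in>fv_tm t. s i = s' i \<Longrightarrow> eval_tm C s t = eval_tm C s' t"
proof (induction t)
  case (Fun f ts)
  then have "map (eval_tm C s) ts = map (eval_tm C s') ts"
    by (intro map_cong) auto
  then show ?case by (simp del: map_eq_conv)
qed auto

lemma sat_cong: "\<forall>i\<in>fv \<phi>. s i = s' i \<Longrightarrow> sat C D s \<phi> = sat C D s' \<phi>"
proof (induction \<phi> arbitrary: s s')
  case (Eq t u)
  then show ?case by (simp add: eval_tm_cong[of t s s'] eval_tm_cong[of u s s'])
next
  case (Rel r ts)
  then have "map (eval_tm C s) ts = map (eval_tm C s') ts"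
    by (intro map_cong) (auto intro!: eval_tm_cong)
  then show ?case by (simp del: map_eq_conv)
next
  case (Ex \<phi>)
  have "sat C D (case_nat d s) \<phi> = sat C D (case_nat d s') \<phi>" for d
    using Ex.prems by (intro Ex.IH) (auto split: nat.split)
  then show ?case by simp
next
  case (Conj \<phi> \<psi>)
  then show ?case by (metis UnCI fv.simps(4) sat.simps(4))
qed auto

section \<open>Syntactic side conditions of substitution\<close>

lemma wf_shift_tm [simp]: "wf_tm C (shift_tm t) = wf_tm C t"
  by (induction t) auto

lemma fv_shift_tm [simp]: "fv_tm (shift_tm t) = Suc ` fv_tm t"
  by (induction t) auto

lemma params_shift_tm [simp]: "tm_params (shift_tm t) = tm_params t"
  by (induction t) auto

lemma wf_subst_tm:
  "\<lbrakk>wf_tm C t; \<forall>i. wf_tm C (\<rho> i); \<forall>c. wf_tm C (\<pi> c)\<rbrakk> \<Longrightarrow> wf_tm C (subst_tm \<rho> \<pi> t)"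
  by (induction t) auto

lemma wf_subst:
  "\<lbrakk>wf_fm C \<phi>; \<forall>i. wf_tm C (\<rho> i); \<forall>c. wf_tm C (\<pi> c)\<rbrakk> \<Longrightarrow> wf_fm C (subst \<rho> \<pi> \<phi>)"
  by (induction \<phi> arbitrary: \<rho> \<pi>) (auto simp: wf_subst_tm split: nat.split)

lemma fv_subst_tm:
  "fv_tm (subst_tm \<rho> \<pi> t) \<subseteq> (\<Union>i\<in>fv_tm t. fv_tm (\<rho> i)) \<union> (\<Union>c\<in>tm_params t. fv_tm (\<pi> c))"
  by (induction t) fastforce+

lemma fv_subst:
  "fv (subst \<rho> \<pi> \<phi>) \<subseteq> (\<Union>i\<in>fv \<phi>. fv_tm (\<rho> i)) \<union> (\<Union>c\<in>params \<phi>. fv_tm (\<pi> c))"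
proof (induction \<phi> arbitrary: \<rho> \<pi>)
  case (Eq t u)
  then show ?case using fv_subst_tm[of \<rho> \<pi> t] fv_subst_tm[of \<rho> \<pi> u] by auto
next
  case (Rel r ts)
  then show ?case using fv_subst_tm[of \<rho> \<pi>] by fastforce
next
  case (Conj \<phi> \<psi>)
  then show ?case by fastforce
next
  case (Ex \<phi>)
  show ?case
  proof
    fix j assume "j \<in> fv (subst \<rho> \<pi> (Ex \<phi>))"
    then have "Suc j \<in> fv (subst (case_nat (Var 0) (shift_tm \<circ> \<rho>)) (shift_tm \<circ> \<pi>) \<phi>)" by simp
    from subsetD[OF Ex.IH this]
    show "j \<in> (\<Union>i\<in>fv (Ex \<phi>). fv_tm (\<rho> i)) \<union> (\<Union>c\<in>params (Ex \<phi>). fv_tm (\<pi> c))"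
    proof (elim UnE UN_E)
      fix i assume "i \<in> fv \<phi>" "Suc j \<in> fv_tm (case i of 0 \<Rightarrow> Var 0 | Suc k \<Rightarrow> (shift_tm \<circ> \<rho>) k)"
      then show ?thesis by (cases i) auto
    qed auto
  qed
qed auto

lemma params_subst_tm:
  "tm_params (subst_tm \<rho> \<pi> t) \<subseteq>
     (\<Union>i\<in>fv_tm t. tm_params (\<rho> i)) \<union> (\<Union>c\<in>tm_params t. tm_params (\<pi> c))"
  by (induction t) fastforce+

lemma params_subst:
  "params (subst \<rho> \<pi> \<phi>) \<subseteq>
     (\<Union>i\<in>fv \<phi>. tm_params (\<rho> i)) \<union> (\<Union>c\<in>params \<phi>. tm_params (\<pi> c))"
proof (induction \<phi> arbitrary: \<rho> \<pi>)
  case (Eq t u)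
  then show ?case using params_subst_tm[of \<rho> \<pi> t] params_subst_tm[of \<rho> \<pi> u] by auto
next
  case (Rel r ts)
  then show ?case using params_subst_tm[of \<rho> \<pi>] by fastforce
next
  case (Conj \<phi> \<psi>)
  then show ?case by fastforce
next
  case (Ex \<phi>)
  show ?case
  proof
    fix j assume "j \<in> params (subst \<rho> \<pi> (Ex \<phi>))"
    then have "j \<in> params (subst (case_nat (Var 0) (shift_tm \<circ> \<rho>)) (shift_tm \<circ> \<pi>) \<phi>)" by simp
    from subsetD[OF Ex.IH this]
    show "j \<in> (\<Union>i\<in>fv (Ex \<phi>). tm_params (\<rho> i)) \<union> (\<Union>c\<in>params (Ex \<phi>). tm_params (\<pi> c))"
    proof (elim UnE UN_E)
      fix i assume "i \<in> fv \<phi>" "j \<in> tm_params (case i of 0 \<Rightarrow> Var 0 | Suc k \<Rightarrow> (shift_tm \<circ> \<rho>) k)"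
      then show ?thesis by (cases i) auto
    qed auto
  qed
qed auto

lemma finite_tm_params [simp]: "finite (tm_params t)"
  by (induction t) auto

lemma finite_params [simp]: "finite (params \<phi>)"
  by (induction \<phi>) auto

section \<open>Instances of formulas at parameters\<close>

lemma eval_inst_tm:
  "eval_tm C s (inst_tm n ps t) = eval_tm C (\<lambda>i. if i < n then s i else ps ! (i - n)) t"
proof (induction t)
  case (Fun f ts)
  then have "map (eval_tm C s \<circ> inst_tm n ps) ts =
      map (eval_tm C (\<lambda>i. if i < n then s i else ps ! (i - n))) ts"
    by (intro map_cong) auto
  then show ?case by (simp del: map_eq_conv)
qed auto

lemma sat_inst:
  "sat C D s (inst n ps \<phi>) = sat C D (\<lambda>i. if i < n then s i else ps ! (i - n)) \<phi>"
proof (induction \<phi> arbitrary: n s)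
  case (Rel r ts)
  have "map (eval_tm C s \<circ> inst_tm n ps) ts =
      map (eval_tm C (\<lambda>i. if i < n then s i else ps ! (i - n))) ts"
    by (intro map_cong) (auto simp: eval_inst_tm)
  then show ?case by (simp del: map_eq_conv)
next
  case (Ex \<phi>)
  have "(\<lambda>i. if i < Suc n then case_nat d s i else ps ! (i - Suc n))
      = case_nat d (\<lambda>i. if i < n then s i else ps ! (i - n))" for d
    by (auto split: nat.split)
  with Ex show ?case by simp
qed (auto simp: eval_inst_tm)

lemma wf_inst_tm: "wf_tm C t \<Longrightarrow> wf_tm C (inst_tm n ps t)"
  by (induction t) auto

lemma wf_inst: "wf_fm C \<phi> \<Longrightarrow> wf_fm C (inst n ps \<phi>)"
  by (induction \<phi> arbitrary: n) (auto simp: wf_inst_tm)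

lemma fv_inst_tm: "fv_tm (inst_tm n ps t) \<subseteq> fv_tm t \<inter> {..<n}"
proof (induction t)
  case (Fun f ts)
  then show ?case by fastforce
qed auto

lemma fv_inst: "fv (inst n ps \<phi>) \<subseteq> fv \<phi> \<inter> {..<n}"
proof (induction \<phi> arbitrary: n)
  case (Eq t u)
  then show ?case using fv_inst_tm[of n ps t] fv_inst_tm[of n ps u] by auto
next
  case (Rel r ts)
  then show ?case using fv_inst_tm[of n ps] by fastforce
qed fastforce+

lemma params_inst_tm:
  "fv_tm t \<subseteq> {..<n + length ps} \<Longrightarrow> tm_params (inst_tm n ps t) \<subseteq> tm_params t \<union> set ps"
proof (induction t)
  case (Fun f ts)
  then show ?case by fastforce
qed auto

lemma params_inst:
  "fv \<phi> \<subseteq> {..<n + length ps} \<Longrightarrow> params (inst n ps \<phi>) \<subseteq> params \<phi> \<union> set ps"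
proof (induction \<phi> arbitrary: n)
  case (Eq t u)
  then show ?case using params_inst_tm[of t n ps] params_inst_tm[of u n ps] by auto
next
  case (Rel r ts)
  then show ?case using params_inst_tm[of _ n ps] by fastforce
next
  case (Conj \<phi> \<psi>)
  then show ?case by fastforce
next
  case (Ex \<phi>)
  have "i < Suc n + length ps" if "i \<in> fv \<phi>" for i
    using that Ex.prems by (cases i) auto
  then show ?case using Ex.IH[of "Suc n"] by auto
qed auto

section \<open>Definable sets\<close>

text \<open>Working with sets of tuples instead of formulas turns syntactic bookkeeping into closure
  properties.\<close>

definition definable :: "('f, 'r, 'c) fo_structure \<Rightarrow> 'c set \<Rightarrow> nat \<Rightarrow> 'c list set \<Rightarrow> bool" where
  "definable C A m X \<longleftrightarrow>
     (\<exists>\<phi>\<in>fms_over C A. fv \<phi> \<subseteq> {..<m} \<and> X = {a. length a = m \<and> holds C \<phi> a})"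

lemma definableI:
  "\<lbrakk>\<phi> \<in> fms_over C A; fv \<phi> \<subseteq> {..<m}\<rbrakk> \<Longrightarrow> definable C A m {a. length a = m \<and> holds C \<phi> a}"
  unfolding definable_def by blast

lemma fms_over_mono: "A \<subseteq> B \<Longrightarrow> fms_over C A \<subseteq> fms_over C B"
  unfolding fms_over_def by auto

lemma definable_mono: "definable C A m X \<Longrightarrow> A \<subseteq> B \<Longrightarrow> definable C B m X"
  unfolding definable_def using fms_over_mono by blast

lemma definable_length: "definable C A m X \<Longrightarrow> a \<in> X \<Longrightarrow> length a = m"
  unfolding definable_def by auto

lemma definable_Int:
  assumes "definable C A m X" "definable C A m Y" shows "definable C A m (X \<inter> Y)"
proof -
  obtain \<phi> \<psi> where "\<phi> \<in> fms_over C A" "fv \<phi> \<subseteq> {..<m}" "X = {a. length a = m \<and> holds C \<phi> a}"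
    "\<psi> \<in> fms_over C A" "fv \<psi> \<subseteq> {..<m}" "Y = {a. length a = m \<and> holds C \<psi> a}"
    using assms unfolding definable_def by blast
  then show ?thesis
    unfolding definable_def by (intro bexI[of _ "Conj \<phi> \<psi>"]) (auto simp: fms_over_def)
qed

lemma definable_compl:
  assumes "definable C A m X" shows "definable C A m {a. length a = m \<and> a \<notin> X}"
proof -
  obtain \<phi> where "\<phi> \<in> fms_over C A" "fv \<phi> \<subseteq> {..<m}" "X = {a. length a = m \<and> holds C \<phi> a}"
    using assms unfolding definable_def by blast
  then show ?thesis
    unfolding definable_def by (intro bexI[of _ "Neg \<phi>"]) (auto simp: fms_over_def)
qed

lemma definable_eq:
  "\<lbrakk>wf_tm C t; wf_tm C u; fv_tm t \<union> fv_tm u \<subseteq> {..<m}; tm_params t \<union> tm_params u \<subseteq> A\<rbrakk> \<Longrightarrow>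
   definable C A m {a. length a = m \<and> eval_tm C ((!) a) t = eval_tm C ((!) a) u}"
  unfolding definable_def by (intro bexI[of _ "Eq t u"]) (auto simp: fms_over_def)

text \<open>Substitute the terms \<open>ts\<close> for the variables. With variables and constants
  as terms this covers permuting, repeating and dropping coordinates as well as fixing some of them
  at parameters.\<close>

lemma definable_preimage:
  assumes X: "definable C A k X" and len: "length ts = k"
    and ts: "\<forall>t\<in>set ts. wf_tm C t \<and> fv_tm t \<subseteq> {..<m} \<and> tm_params t \<subseteq> A"
  shows "definable C A m {a. length a = m \<and> map (eval_tm C ((!) a)) ts \<in> X}"
proof -
  obtain \<phi> where \<phi>: "\<phi> \<in> fms_over C A" "fv \<phi> \<subseteq> {..<k}" "X = {a. length a = k \<and> holds C \<phi> a}"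
    using X unfolding definable_def by blast
  \<comment> \<open>\<open>Var 0\<close> is a harmless default: only variables below
    \<open>k\<close> occur free, but \<open>wf_subst\<close> asks for a well-formed term at every
    index.\<close>
  define \<rho> where "\<rho> i = (if i < k then ts ! i else Var 0)" for i
  have sat: "holds C (subst \<rho> Par \<phi>) a = holds C \<phi> (map (eval_tm C ((!) a)) ts)" for a
  proof -
    have "holds C (subst \<rho> Par \<phi>) a = sat C UNIV (\<lambda>i. eval_tm C ((!) a) (\<rho> i)) \<phi>"
      by (rule sat_subst) simp
    also have "\<dots> = holds C \<phi> (map (eval_tm C ((!) a)) ts)"
      using \<phi>(2) len by (intro sat_cong) (auto simp: \<rho>_def)
    finally show ?thesis .
  qed
  have "wf_fm C (subst \<rho> Par \<phi>)"
    using \<phi>(1) len ts by (intro wf_subst) (auto simp: fms_over_def \<rho>_def)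
  moreover have "params (subst \<rho> Par \<phi>) \<subseteq> A"
    using params_subst[of \<rho> Par \<phi>] \<phi>(1,2) len ts nth_mem[of _ ts]
    by (fastforce simp: fms_over_def \<rho>_def)
  moreover have "fv (subst \<rho> Par \<phi>) \<subseteq> {..<m}"
    using fv_subst[of \<rho> Par \<phi>] \<phi>(1,2) len ts nth_mem[of _ ts]
    by (fastforce simp: fms_over_def \<rho>_def)
  ultimately show ?thesis
    unfolding definable_def
    by (intro bexI[of _ "subst \<rho> Par \<phi>"]) (auto simp: sat \<phi>(3) len fms_over_def)
qed

lemma nth_Cons_case_nat: "(!) (d # a) = case_nat d ((!) a)"
  by (auto simp: nth_Cons)

text \<open>\<open>Ex\<close> binds variable 0, which is the head of the tuple; hence projections
  remove coordinates at the front.\<close>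

lemma definable_ex1:
  assumes "definable C A (Suc m) X"
  shows "definable C A m {a. \<exists>d. d # a \<in> X}"
proof -
  obtain \<phi> where \<phi>: "\<phi> \<in> fms_over C A" "fv \<phi> \<subseteq> {..<Suc m}"
    "X = {a. length a = Suc m \<and> holds C \<phi> a}"
    using assms unfolding definable_def by blast
  have "{a. \<exists>d. d # a \<in> X} = {a. length a = m \<and> holds C (Ex \<phi>) a}"
    using \<phi>(3) by (auto simp: nth_Cons_case_nat)
  then show ?thesis
    using \<phi> unfolding definable_def by (intro bexI[of _ "Ex \<phi>"]) (auto simp: fms_over_def)
qed

lemma definable_ex:
  "definable C A (k + m) X \<Longrightarrow> definable C A m {a. \<exists>b. length b = k \<and> b @ a \<in> X}"
proof (induction k arbitrary: X)
  case (Suc k)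
  have "definable C A m {a. \<exists>b. length b = k \<and> b @ a \<in> {a. \<exists>d. d # a \<in> X}}"
    using Suc.prems by (intro Suc.IH definable_ex1) simp
  moreover have "(\<exists>b. length b = k \<and> b @ a \<in> {a. \<exists>d. d # a \<in> X}) \<longleftrightarrow>
      (\<exists>b. length b = Suc k \<and> b @ a \<in> X)" for a
    by (auto simp: length_Suc_conv) (metis append_Cons)+
  ultimately show ?case by simp
qed simp

definition vars :: "nat \<Rightarrow> nat \<Rightarrow> ('f, 'c) tm list" where
  "vars i n = map Var [i..<i + n]"

definition pars :: "'c list \<Rightarrow> ('f, 'c) tm list" where
  "pars = map Par"

lemma length_vars [simp]: "length (vars i n) = n" "length (pars cs) = length cs"
  by (auto simp: vars_def pars_def)

lemma eval_vars [simp]: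
  "i + n \<le> length a \<Longrightarrow> map (eval_tm C ((!) a)) (vars i n) = take n (drop i a)"
  by (auto simp: vars_def intro: nth_equalityI)

lemma eval_pars [simp]: "map (eval_tm C s) (pars cs) = cs"
  by (auto simp: pars_def intro: nth_equalityI)

lemma set_vars [simp]: "set (vars i n) = Var ` {i..<i + n}" "set (pars cs) = Par ` set cs"
  by (auto simp: vars_def pars_def)

text \<open>The parameter \<open>c\<close> becomes variable 0 and the other variables move up by
  one, so that prepending \<open>c\<close> to the tuple recovers the original formula.\<close>

definition abstract_par :: "'c \<Rightarrow> ('f, 'r, 'c) fm \<Rightarrow> ('f, 'r, 'c) fm" where
  "abstract_par c = subst (\<lambda>i. Var (Suc i)) (\<lambda>d. if d = c then Var 0 else Par d)"

lemma sat_abstract_par: "sat C D (case_nat c s) (abstract_par c \<phi>) = sat C D s \<phi>"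
  unfolding abstract_par_def by (subst sat_subst) auto

lemma abstract_par_over:
  "\<phi> \<in> fms_over C (insert c A) \<Longrightarrow> abstract_par c \<phi> \<in> fms_over C A"
proof -
  assume \<phi>: "\<phi> \<in> fms_over C (insert c A)"
  have "(\<Union>i\<in>fv \<phi>. tm_params (Var (Suc i))) \<union> (\<Union>d\<in>params \<phi>. tm_params (if d = c then Var 0 else Par d)) \<subseteq> A"
    using \<phi> by (auto simp: fms_over_def split: if_splits)
  with params_subst have "params (abstract_par c \<phi>) \<subseteq> A"
    unfolding abstract_par_def by (rule subset_trans)
  moreover have "wf_fm C (abstract_par c \<phi>)"
    using \<phi> unfolding abstract_par_def by (intro wf_subst) (auto simp: fms_over_def)
  ultimately show ?thesis by (simp add: fms_over_def)
qed

lemma fv_abstract_par: "fv \<phi> \<subseteq> {..<m} \<Longrightarrow> fv (abstract_par c \<phi>) \<subseteq> {..<Suc m}"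
  unfolding abstract_par_def
  using fv_subst[of "\<lambda>i. Var (Suc i)" "\<lambda>d. if d = c then Var 0 else Par d" \<phi>]
  by (auto split: if_splits)

lemma definable_insert_par:
  assumes "definable C (insert c A) m X"
  obtains X0 where "definable C A (Suc m) X0" "X = {a. c # a \<in> X0}"
proof -
  obtain \<phi> where \<phi>: "\<phi> \<in> fms_over C (insert c A)" "fv \<phi> \<subseteq> {..<m}"
    "X = {a. length a = m \<and> holds C \<phi> a}"
    using assms unfolding definable_def by blast
  have "X = {a. c # a \<in> {a. length a = Suc m \<and> holds C (abstract_par c \<phi>) a}}"
    using \<phi>(3) by (auto simp: nth_Cons_case_nat sat_abstract_par)
  then show ?thesis
    using \<phi> by (intro that[of "{a. length a = Suc m \<and> holds C (abstract_par c \<phi>) a}"])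
      (auto intro!: definableI abstract_par_over fv_abstract_par)
qed

lemma definable_finite_par:
  assumes "definable C A m X"
  obtains A0 where "finite A0" "A0 \<subseteq> A" "definable C A0 m X"
  using assms unfolding definable_def
  by (metis (mono_tags, lifting) finite_params fms_over_def mem_Collect_eq subset_refl)

lemma in_dcl_iff: "c \<in> dcl C A \<longleftrightarrow> definable C A 1 {[c]}"
proof -
  have "{[c]} = {a. length a = 1 \<and> holds C \<phi> a} \<longleftrightarrow> (\<forall>d. holds C \<phi> [d] \<longleftrightarrow> d = c)"
    for \<phi> :: "('b, 'c, 'a) fm"
    by (auto simp: length_Suc_conv set_eq_iff)
  moreover have "{..<1::nat} = {0}" by auto
  ultimately show ?thesis unfolding dcl_def definable_def by auto
qed

lemma subset_dcl: "A \<subseteq> dcl C A"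
proof
  fix c assume "c \<in> A"
  then show "c \<in> dcl C A"
    unfolding dcl_def
    by (intro CollectI bexI[of _ "Eq (Var 0) (Par c)"]) (auto simp: fms_over_def)
qed

text \<open>A parameter from \<open>dcl C A\<close> can be quantified away together with the formula
  over \<open>A\<close> that defines it.\<close>

lemma definable_dcl:
  assumes "definable C (dcl C A) m X" shows "definable C A m X"
proof -
  \<comment> \<open>Induction over the finitely many parameters that occur; \<open>m\<close> and
    \<open>X\<close> vary because turning a parameter into a coordinate raises the arity.\<close>
  have "definable C A m X" if "finite P" "P \<subseteq> dcl C A" "definable C (P \<union> A) m X" for P
    using that
  proof (induction P arbitrary: m X rule: finite_induct)
    case (insert c P)
    obtain X0 where X0: "definable C (P \<union> A) (Suc m) X0" "X = {a. c # a \<in> X0}"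
      using definable_insert_par insert.prems(2) by (metis Un_insert_left)
    have "definable C A 1 {[c]}"
      using insert.prems(1) by (simp add: in_dcl_iff)
    then have "definable C A (Suc m) {a. length a = Suc m \<and> map (eval_tm C ((!) a)) (vars 0 1) \<in> {[c]}}"
      by (intro definable_preimage) auto
    moreover have "definable C A (Suc m) X0"
      using insert X0(1) by simp
    ultimately have "definable C A m {a. \<exists>d. d # a \<in>
        {a. length a = Suc m \<and> map (eval_tm C ((!) a)) (vars 0 1) \<in> {[c]}} \<inter> X0}"
      by (intro definable_ex1 definable_Int)
    moreover have "{a. \<exists>d. d # a \<in>
        {a. length a = Suc m \<and> map (eval_tm C ((!) a)) (vars 0 1) \<in> {[c]}} \<inter> X0} = X"
      using X0(2) by (auto dest: definable_length[OF X0(1)])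
    ultimately show ?case by simp
  qed simp
  then show ?thesis
    using definable_finite_par[OF assms] definable_mono by (metis Un_upper1)
qed

section \<open>Elementary substructures\<close>

text \<open>\<open>elementary_substructure\<close> speaks of parameter-free formulas only. The
  parameters from M are abstracted one at a time and handed to the assignment instead.\<close>

lemma elementary_par:
  assumes "elementary_substructure C M" "\<phi> \<in> fms_over C M" "range s \<subseteq> M"
  shows "sat C M s \<phi> = sat C UNIV s \<phi>"
proof -
  have "sat C M s \<phi> = sat C UNIV s \<phi>"
    if "finite P" "P \<subseteq> M" "\<phi> \<in> fms_over C P" "range s \<subseteq> M" for P
    using that
  proof (induction P arbitrary: \<phi> s rule: finite_induct)
    case empty
    then show ?case using assms(1) unfolding elementary_substructure_def by blast
  next
    case (insert c P)
    have "sat C M (case_nat c s) (abstract_par c \<phi>) = sat C UNIV (case_nat c s) (abstract_par c \<phi>)"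
      using insert.prems by (intro insert.IH abstract_par_over) (auto split: nat.split simp: image_subset_iff)
    then show ?case by (simp add: sat_abstract_par)
  qed
  from this[of "params \<phi>"] assms(2,3) show ?thesis by (auto simp: fms_over_def)
qed

lemma elementary_holds:
  assumes "elementary_substructure C M" "\<phi> \<in> fms_over C M" "set a \<subseteq> M" "fv \<phi> \<subseteq> {..<length a}"
  shows "holds_in C M \<phi> a = holds C \<phi> a"
proof -
  obtain c where "c \<in> M" using assms(1) unfolding elementary_substructure_def by blast
  \<comment> \<open>\<open>(!) a\<close> is unspecified beyond the length of \<open>a\<close>,
    whereas elementarity needs an assignment with all values in M; the tail is filled with a point
    of M.\<close>
  define s where "s i = (if i < length a then a ! i else c)" for i
  have "sat C D ((!) a) \<phi> = sat C D s \<phi>" for D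
    using assms(4) by (intro sat_cong) (auto simp: s_def)
  moreover have "range s \<subseteq> M" using \<open>c \<in> M\<close> assms(3) by (auto simp: s_def)
  ultimately show ?thesis using elementary_par assms(1,2) by metis
qed

text \<open>The Tarski-Vaught property for tuples: project away the first coordinate, find the
  others in M by induction, then evaluate the existential quantifier inside M.\<close>

lemma elementary_witness:
  assumes M: "elementary_substructure C M"
  shows "\<lbrakk>definable C M m X; X \<noteq> {}\<rbrakk> \<Longrightarrow> \<exists>a\<in>X. set a \<subseteq> M"
proof (induction m arbitrary: X)
  case 0
  then show ?case using definable_length[OF 0(1)] by fastforce
next
  case (Suc m)
  obtain \<phi> where \<phi>: "\<phi> \<in> fms_over C M" "fv \<phi> \<subseteq> {..<Suc m}"
    "X = {a. length a = Suc m \<and> holds C \<phi> a}"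
    using Suc.prems unfolding definable_def by blast
  have "{a. \<exists>d. d # a \<in> X} \<noteq> {}"
    using Suc.prems(2) \<phi>(3) by (auto simp: length_Suc_conv)
  then obtain a where a: "set a \<subseteq> M" "\<exists>d. d # a \<in> X"
    using Suc.IH[OF definable_ex1[OF Suc.prems(1)]] by blast
  then have "holds C (Ex \<phi>) a" "length a = m"
    using \<phi>(3) by (auto simp: nth_Cons_case_nat)
  then have "holds_in C M (Ex \<phi>) a"
    using \<phi>(1,2) a(1) by (subst elementary_holds[OF M]) (auto simp: fms_over_def)
  then obtain d where d: "d \<in> M" "holds_in C M \<phi> (d # a)"
    by (auto simp: nth_Cons_case_nat)
  then have "holds C \<phi> (d # a)"
    using elementary_holds[OF M \<phi>(1), of "d # a"] a(1) \<phi>(2) \<open>length a = m\<close> by simp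
  then show ?case using a(1) d(1) \<open>length a = m\<close> \<phi>(3) by (intro bexI[of _ "d # a"]) auto
qed

text \<open>A singleton definable over M has its point in M.\<close>

lemma dcl_elementary: "elementary_substructure C M \<Longrightarrow> dcl C M = M"
  using elementary_witness[of C M 1 "{[c]}" for c] subset_dcl[of M C]
  by (fastforce simp: in_dcl_iff)

section \<open>Compactness\<close>

lemma type_definable_over_iff:
  "type_definable_over C m A X \<longleftrightarrow>
   (\<exists>\<D>. (\<forall>D\<in>\<D>. definable C A m D) \<and> X = {a. length a = m \<and> (\<forall>D\<in>\<D>. a \<in> D)})"
proof
  assume "type_definable_over C m A X"
  then obtain p where "p \<subseteq> {\<phi> \<in> fms_over C A. fv \<phi> \<subseteq> {..<m}}"
    "X = {a. length a = m \<and> (\<forall>\<phi>\<in>p. holds C \<phi> a)}"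
    unfolding type_definable_over_def by blast
  then show "\<exists>\<D>. (\<forall>D\<in>\<D>. definable C A m D) \<and> X = {a. length a = m \<and> (\<forall>D\<in>\<D>. a \<in> D)}"
    by (intro exI[of _ "(\<lambda>\<phi>. {a. length a = m \<and> holds C \<phi> a}) ` p"]) (auto intro: definableI)
next
  assume "\<exists>\<D>. (\<forall>D\<in>\<D>. definable C A m D) \<and> X = {a. length a = m \<and> (\<forall>D\<in>\<D>. a \<in> D)}"
  then obtain \<D> where \<D>: "\<forall>D\<in>\<D>. definable C A m D" "X = {a. length a = m \<and> (\<forall>D\<in>\<D>. a \<in> D)}"
    by blast
  \<comment> \<open>All formulas defining a member of the family are taken, which avoids choosing
    one for each set.\<close>
  define p where "p = {\<phi> \<in> fms_over C A. fv \<phi> \<subseteq> {..<m} \<and> {a. length a = m \<and> holds C \<phi> a} \<in> \<D>}"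
  have "a \<in> D" if "\<forall>\<phi>\<in>p. holds C \<phi> a" "length a = m" "D \<in> \<D>" for a D
  proof -
    obtain \<phi> where "\<phi> \<in> fms_over C A" "fv \<phi> \<subseteq> {..<m}" "D = {a. length a = m \<and> holds C \<phi> a}"
      using \<D>(1) \<open>D \<in> \<D>\<close> unfolding definable_def by blast
    then show ?thesis using that unfolding p_def by simp
  qed
  then have "X = {a. length a = m \<and> (\<forall>\<phi>\<in>p. holds C \<phi> a)}"
    unfolding \<D>(2) p_def by auto
  then show "type_definable_over C m A X"
    unfolding type_definable_over_def by (intro exI[of _ p]) (auto simp: p_def)
qed

text \<open>The form in which saturation is used: \<open>\<N>\<close> is a filter base, typically
  the basic neighbourhoods of a point, and \<open>\<D>\<close> presents a type-definable set meeting
  each of its members. A finite part of the joint type involves only finitely many members of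
  \<open>\<N>\<close>, and these contain a common one.\<close>

lemma saturated_Inter:
  assumes sat: "saturated \<kappa> C" and A: "|A| <o \<kappa>"
    and \<D>: "\<forall>D\<in>\<D>. definable C A m D"
    and \<N>: "\<forall>N\<in>\<N>. definable C A m N" "\<N> \<noteq> {}" "\<And>N N'. N \<in> \<N> \<Longrightarrow> N' \<in> \<N> \<Longrightarrow> N \<inter> N' \<in> \<N>"
    and meet: "\<And>N. N \<in> \<N> \<Longrightarrow> \<exists>a\<in>N. \<forall>D\<in>\<D>. a \<in> D"
  shows "\<exists>a. (\<forall>D\<in>\<D>. a \<in> D) \<and> (\<forall>N\<in>\<N>. a \<in> N)"
proof -
  define p where "p = {\<phi> \<in> fms_over C A. fv \<phi> \<subseteq> {..<m} \<and> {a. length a = m \<and> holds C \<phi> a} \<in> \<D> \<union> \<N>}"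
  have *: "\<exists>a. length a = m \<and> (\<forall>\<phi>\<in>q. holds C \<phi> a)" if "finite q \<and> q \<subseteq> p" for q
  proof -
    have "\<exists>N\<in>\<N>. \<forall>\<phi>\<in>q. {a. length a = m \<and> holds C \<phi> a} \<in> \<D> \<or> N \<subseteq> {a. length a = m \<and> holds C \<phi> a}"
      using conjunct1[OF that] conjunct2[OF that]
    proof (induction q rule: finite_induct)
      case empty
      then show ?case using \<N>(2) by auto
    next
      case (insert \<phi> q)
      then obtain N where N: "N \<in> \<N>" "\<forall>\<phi>\<in>q. {a. length a = m \<and> holds C \<phi> a} \<in> \<D> \<or>
          N \<subseteq> {a. length a = m \<and> holds C \<phi> a}" by auto
      let ?X = "{a. length a = m \<and> holds C \<phi> a}"
      have "?X \<in> \<D> \<or> ?X \<in> \<N>" using insert.prems by (auto simp: p_def)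
      then show ?case
      proof
        assume "?X \<in> \<N>"
        then have "N \<inter> ?X \<in> \<N>" using N(1) \<N>(3) by blast
        then show ?thesis using N(2) by (intro bexI[of _ "N \<inter> ?X"]) auto
      qed (use N in auto)
    qed
    then obtain N where N: "N \<in> \<N>" "\<forall>\<phi>\<in>q. {a. length a = m \<and> holds C \<phi> a} \<in> \<D> \<or>
          N \<subseteq> {a. length a = m \<and> holds C \<phi> a}" by blast
    obtain a where "a \<in> N" "\<forall>D\<in>\<D>. a \<in> D" using meet N(1) by blast
    moreover have "length a = m" using N(1) \<N>(1) \<open>a \<in> N\<close> definable_length by metis
    ultimately show ?thesis using N(2) by (intro exI[of _ a]) auto
  qed
  then obtain a where a: "length a = m" "\<forall>\<phi>\<in>p. holds C \<phi> a"
  proof -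
    have "p \<subseteq> {\<phi> \<in> fms_over C A. fv \<phi> \<subseteq> {..<m}}" by (auto simp: p_def)
    then have "\<exists>a. length a = m \<and> (\<forall>\<phi>\<in>p. holds C \<phi> a)"
      using sat A * unfolding saturated_def by simp
    then show ?thesis using that by blast
  qed
  have "a \<in> X" if "X \<in> \<D> \<union> \<N>" for X
  proof -
    have "definable C A m X" using that \<D> \<N>(1) by blast
    then obtain \<phi> where "\<phi> \<in> fms_over C A" "fv \<phi> \<subseteq> {..<m}" "X = {a. length a = m \<and> holds C \<phi> a}"
      unfolding definable_def by blast
    then show ?thesis using a that by (auto simp: p_def)
  qed
  then show ?thesis by blast
qed

text \<open>Injectivity of \<sigma> handles the equations and surjectivity the quantifiers.\<close>

lemma sat_automorphism:
  assumes \<sigma>: "automorphism C \<sigma>"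
  shows "\<lbrakk>wf_fm C \<phi>; \<forall>c\<in>params \<phi>. \<sigma> c = c\<rbrakk> \<Longrightarrow> sat C UNIV (\<lambda>i. \<sigma> (s i)) \<phi> = sat C UNIV s \<phi>"
proof -
  have eval: "\<lbrakk>wf_tm C t; \<forall>c\<in>tm_params t. \<sigma> c = c\<rbrakk> \<Longrightarrow> eval_tm C (\<lambda>i. \<sigma> (s i)) t = \<sigma> (eval_tm C s t)" for t s
  proof (induction t)
    case (Fun f ts)
    then have "map (eval_tm C (\<lambda>i. \<sigma> (s i))) ts = map \<sigma> (map (eval_tm C s) ts)" by auto
    then show ?case using \<sigma> Fun.prems unfolding automorphism_def by (metis eval_tm.simps(3) length_map wf_tm.simps(3))
  qed auto
  show "\<lbrakk>wf_fm C \<phi>; \<forall>c\<in>params \<phi>. \<sigma> c = c\<rbrakk> \<Longrightarrow> sat C UNIV (\<lambda>i. \<sigma> (s i)) \<phi> = sat C UNIV s \<phi>"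
  proof (induction \<phi> arbitrary: s)
    case (Eq t u)
    then show ?case using \<sigma> eval unfolding automorphism_def by (auto dest: bij_is_inj injD)
  next
    case (Rel r ts)
    then have "map (eval_tm C (\<lambda>i. \<sigma> (s i))) ts = map \<sigma> (map (eval_tm C s) ts)" using eval by auto
    then show ?case using \<sigma> Rel.prems unfolding automorphism_def by (metis length_map sat.simps(2) wf_fm.simps(2))
  next
    case (Ex \<phi>)
    have "sat C UNIV (case_nat (\<sigma> d) (\<lambda>i. \<sigma> (s i))) \<phi> = sat C UNIV (case_nat d s) \<phi>" for d
    proof -
      have "case_nat (\<sigma> d) (\<lambda>i. \<sigma> (s i)) = (\<lambda>i. \<sigma> (case_nat d s i))" by (auto split: nat.split)
      then show ?thesis using Ex by simp
    qed
    moreover have "surj \<sigma>" using \<sigma> unfolding automorphism_def by (simp add: bij_is_surj)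
    ultimately show ?case by simp (metis surjD)
  qed auto
qed

text \<open>Several group elements are coded as consecutive blocks of one tuple, so that conditions
  on each of them become sets of long tuples that can be intersected.\<close>

lemma definable_block:
  assumes "definable C A k X" "i + k \<le> m"
  shows "definable C A m {a. length a = m \<and> take k (drop i a) \<in> X}"
proof -
  have "definable C A m {a. length a = m \<and> map (eval_tm C ((!) a)) (vars i k) \<in> X}"
    using assms by (intro definable_preimage) auto
  moreover have "{a. length a = m \<and> map (eval_tm C ((!) a)) (vars i k) \<in> X} =
      {a. length a = m \<and> take k (drop i a) \<in> X}"
    using assms(2) by (auto simp del: map_eq_conv)
  ultimately show ?thesis by simp
qed

lemma definable_blocks3:
  assumes "definable C A (3 * k) X" "h + k \<le> m" "i + k \<le> m" "j + k \<le> m"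
  shows "definable C A m
    {a. length a = m \<and> take k (drop h a) @ take k (drop i a) @ take k (drop j a) \<in> X}"
proof -
  let ?ts = "vars h k @ vars i k @ vars j k"
  have "definable C A m {a. length a = m \<and> map (eval_tm C ((!) a)) ?ts \<in> X}"
    using assms by (intro definable_preimage[where k = "3 * k"]) auto
  moreover have "{a. length a = m \<and> map (eval_tm C ((!) a)) ?ts \<in> X} =
      {a. length a = m \<and> take k (drop h a) @ take k (drop i a) @ take k (drop j a) \<in> X}"
    using assms(2-) by (auto simp del: map_eq_conv)
  ultimately show ?thesis by simp
qed

lemma definable_nth_eq:
  assumes "i < m" "j < m" shows "definable C A m {a. length a = m \<and> a ! i = a ! j}"
  using definable_eq[of C "Var i" "Var j" m A] assms by simp

lemma definable_nth_neq:
  assumes "i < m" "j < m" shows "definable C A m {a. length a = m \<and> a ! i \<noteq> a ! j}"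
proof -
  have "definable C A m {a. length a = m \<and> a \<notin> {a. length a = m \<and> a ! i = a ! j}}"
    using assms by (intro definable_compl definable_nth_eq)
  then show ?thesis by (simp cong: conj_cong)
qed

section \<open>The group of points of the monster model\<close>

locale monster_group =
  fixes \<kappa> :: "'k rel"
    and C :: "('f, 'r, 'c) fo_structure"
    and M :: "'c set"
    and \<Gamma> :: "('f, 'r, 'c) dgroup"
    and \<Delta> :: "('f, 'r, 'c) fm set"
  assumes monster: "monster_model \<kappa> C M"
    and dgrp: "definable_group C M \<Gamma>"
    and adm: "admissible_Delta C \<Gamma> \<Delta>"
begin

abbreviation n where "n \<equiv> dim \<Gamma>"
abbreviation G where "G \<equiv> carrier (Gstar C \<Gamma>)"
abbreviation GM where "GM \<equiv> carrier (pts C \<Gamma> M)"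
abbreviation star (infixl "\<star>" 70) where "a \<star> b \<equiv> a \<otimes>\<^bsub>Gstar C \<Gamma>\<^esub> b"
abbreviation e where "e \<equiv> \<one>\<^bsub>Gstar C \<Gamma>\<^esub>"

text \<open>The graph of multiplication in the monster model. Until products in G* are known to
  exist and to be unique, the arguments refer to this relation instead of
  \<open>\<star>\<close>.\<close>

definition Mul where "Mul = {w. length w = 3 * n \<and> holds C (mult_fm \<Gamma>) w}"

lemma M_elem: "elementary_substructure C M"
  using monster unfolding monster_model_def by blast

lemma dcl_M [simp]: "dcl C M = M"
  by (rule dcl_elementary[OF M_elem])

lemma G_eq: "G = {a. length a = n \<and> holds C (dom_fm \<Gamma>) a}"
  by (auto simp: pts_def dcarrier_def)

lemma length_G: "a \<in> G \<Longrightarrow> length a = n"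
  by (simp add: G_eq)

lemma definable_G: "definable C A n G"
  using dgrp fms_over_mono[of "{}" A C] unfolding G_eq definable_group_def
  by (intro definableI) auto

lemma definable_Mul: "definable C A (3 * n) Mul"
  using dgrp fms_over_mono[of "{}" A C] unfolding Mul_def definable_group_def
  by (intro definableI) auto

lemma GM_eq: "GM = {a \<in> G. set a \<subseteq> M}"
proof -
  have "holds_in C M (dom_fm \<Gamma>) a = holds C (dom_fm \<Gamma>) a" if "length a = n" "set a \<subseteq> M" for a
    using dgrp that fms_over_mono[of "{}" M C] unfolding definable_group_def
    by (intro elementary_holds[OF M_elem]) auto
  then show ?thesis by (auto simp: pts_def dcarrier_def)
qed

lemma mult_fm_M:
  assumes "a \<in> GM" "b \<in> GM" "c \<in> GM"
  shows "holds_in C M (mult_fm \<Gamma>) (a @ b @ c) \<longleftrightarrow> a @ b @ c \<in> Mul"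
proof -
  have "length (a @ b @ c) = 3 * n" "set (a @ b @ c) \<subseteq> M"
    using assms by (auto simp: GM_eq length_G)
  moreover from this have "holds_in C M (mult_fm \<Gamma>) (a @ b @ c) = holds C (mult_fm \<Gamma>) (a @ b @ c)"
    using dgrp fms_over_mono[of "{}" M C] unfolding definable_group_def
    by (intro elementary_holds[OF M_elem]) auto
  ultimately show ?thesis by (auto simp: Mul_def)
qed

lemma ex1_mult_M:
  assumes "a \<in> GM" "b \<in> GM" shows "\<exists>!c. c \<in> GM \<and> a @ b @ c \<in> Mul"
proof -
  have "\<exists>!c. c \<in> GM \<and> holds_in C M (mult_fm \<Gamma>) (a @ b @ c)"
    using dgrp assms unfolding definable_group_def by (simp add: pts_def)
  then show ?thesis using mult_fm_M assms by metis
qed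

lemma mult_M_iff:
  assumes "a \<in> GM" "b \<in> GM" "c \<in> GM"
  shows "a @ b @ c \<in> Mul \<longleftrightarrow> a \<otimes>\<^bsub>pts C \<Gamma> M\<^esub> b = c"
proof -
  have "a \<otimes>\<^bsub>pts C \<Gamma> M\<^esub> b = (THE c. c \<in> GM \<and> holds_in C M (mult_fm \<Gamma>) (a @ b @ c))"
    by (simp add: pts_def dmult_def)
  also have "\<dots> = (THE c. c \<in> GM \<and> a @ b @ c \<in> Mul)"
    using mult_fm_M[OF assms(1,2)] by (intro arg_cong[of _ _ The]) auto
  finally have eq: "a \<otimes>\<^bsub>pts C \<Gamma> M\<^esub> b = (THE c. c \<in> GM \<and> a @ b @ c \<in> Mul)" .
  show ?thesis
    using the1_equality[OF ex1_mult_M[OF assms(1,2)]] theI'[OF ex1_mult_M[OF assms(1,2)]] assms(3)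
    unfolding eq by blast
qed

section \<open>Transfer of the group axioms from M to the monster model\<close>

lemma group_M: "group (pts C \<Gamma> M)"
  using dgrp unfolding definable_group_def by blast

text \<open>Contrapositive of \<open>elementary_witness\<close>: a law holds throughout G* once its
  counterexamples form an M-definable set without points in M.\<close>

lemma transfer:
  assumes "definable C M m X" "\<And>a. \<lbrakk>a \<in> X; set a \<subseteq> M\<rbrakk> \<Longrightarrow> False"
  shows "a \<notin> X"
  using elementary_witness[OF M_elem assms(1)] assms(2) by blast

lemma block_GM: "\<lbrakk>take n (drop i a) \<in> G; set a \<subseteq> M\<rbrakk> \<Longrightarrow> take n (drop i a) \<in> GM"
  using set_take_subset[of n "drop i a"] set_drop_subset[of i a] by (auto simp: GM_eq)

lemma ex_mult:
  assumes ab: "a \<in> G" "b \<in> G" shows "\<exists>c\<in>G. a @ b @ c \<in> Mul"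
proof -
  \<comment> \<open>The sought product is the first block because \<open>definable_ex\<close>
    projects away an initial block; hence the permuted blocks in \<open>Mul\<close>.\<close>
  define Y where "Y = {v. length v = 3 * n \<and> take n (drop 0 v) \<in> G} \<inter>
    {v. length v = 3 * n \<and> take n (drop n v) @ take n (drop (2 * n) v) @ take n (drop 0 v) \<in> Mul}"
  define P where "P = {w. \<exists>c. length c = n \<and> c @ w \<in> Y}"
  define X where "X = {w. length w = 2 * n \<and> take n (drop 0 w) \<in> G} \<inter>
    {w. length w = 2 * n \<and> take n (drop n w) \<in> G} \<inter> {w. length w = 2 * n \<and> w \<notin> P}"
  have "definable C M (3 * n) Y"
    unfolding Y_def
    by (intro definable_Int definable_block definable_blocks3 definable_G definable_Mul) auto
  then have "definable C M (2 * n) P"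
    unfolding P_def by (intro definable_ex) (simp add: eval_nat_numeral)
  then have X: "definable C M (2 * n) X"
    unfolding X_def by (intro definable_Int definable_block definable_compl definable_G) auto
  have P: "x @ y \<in> P \<longleftrightarrow> (\<exists>c\<in>G. x @ y @ c \<in> Mul)" if "length x = n" "length y = n" for x y
    using that by (auto simp: P_def Y_def G_eq)
  have "a @ b \<notin> X"
  proof (rule transfer[OF X])
    fix w assume w: "w \<in> X" "set w \<subseteq> M"
    define x y where "x = take n w" and "y = take n (drop n w)"
    have "w = x @ y"
      using w(1) by (auto simp: X_def x_def y_def)
    moreover have "x \<in> GM" "y \<in> GM"
      using w block_GM[of 0 w] block_GM[of n w] by (auto simp: X_def x_def y_def)
    then obtain c where "c \<in> GM" "x @ y @ c \<in> Mul" using ex1_mult_M by blast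
    ultimately have "w \<in> P"
      using P[of x y] \<open>x \<in> GM\<close> \<open>y \<in> GM\<close> by (auto simp: GM_eq length_G)
    then show False using w by (simp add: X_def)
  qed
  then show ?thesis
    using ab P[of a b] by (auto simp: X_def length_G)
qed

lemma mult_unique:
  assumes abcd: "a \<in> G" "b \<in> G" "c \<in> G" "d \<in> G" and Mul: "a @ b @ c \<in> Mul" "a @ b @ d \<in> Mul"
  shows "c = d"
proof (rule nth_equalityI)
  show "length c = length d" using abcd by (simp add: length_G)
  fix i assume "i < length c"
  then have i: "i < n" using abcd by (simp add: length_G)
  \<comment> \<open>Counterexamples that differ at the fixed coordinate \<open>i\<close>: a single
    inequation replaces a disjunction over all coordinates.\<close>
  define X where "X = {w. length w = 4 * n \<and> take n (drop 0 w) \<in> G} \<inter>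
    {w. length w = 4 * n \<and> take n (drop n w) \<in> G} \<inter>
    {w. length w = 4 * n \<and> take n (drop (2 * n) w) \<in> G} \<inter>
    {w. length w = 4 * n \<and> take n (drop (3 * n) w) \<in> G} \<inter>
    {w. length w = 4 * n \<and> take n (drop 0 w) @ take n (drop n w) @ take n (drop (2 * n) w) \<in> Mul} \<inter>
    {w. length w = 4 * n \<and> take n (drop 0 w) @ take n (drop n w) @ take n (drop (3 * n) w) \<in> Mul} \<inter>
    {w. length w = 4 * n \<and> w ! (2 * n + i) \<noteq> w ! (3 * n + i)}"
  have X: "definable C M (4 * n) X"
    unfolding X_def
    by (intro definable_Int definable_block definable_blocks3 definable_nth_neq
        definable_G definable_Mul) (use i in auto)
  have "a @ b @ c @ d \<notin> X"
  proof (rule transfer[OF X])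
    fix w assume w: "w \<in> X" "set w \<subseteq> M"
    define x y z v where "x = take n (drop 0 w)" "y = take n (drop n w)"
      "z = take n (drop (2 * n) w)" "v = take n (drop (3 * n) w)"
    note defs = this
    have "x \<in> GM" "y \<in> GM" "z \<in> GM" "v \<in> GM"
      unfolding defs by (rule block_GM[OF _ w(2)], use w(1) in \<open>unfold X_def, blast\<close>)+
    moreover have "x @ y @ z \<in> Mul" "x @ y @ v \<in> Mul"
      using w by (auto simp: X_def defs)
    ultimately have "z = v" using ex1_mult_M by blast
    moreover have "z ! i = w ! (2 * n + i)" "v ! i = w ! (3 * n + i)"
      using w i by (auto simp: X_def defs)
    ultimately show False using w by (simp add: X_def)
  qed
  then show "c ! i = d ! i"
    using abcd Mul i by (auto simp: X_def length_G nth_append)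
qed

lemma
  assumes ab: "a \<in> G" "b \<in> G"
  shows star_closed: "a \<star> b \<in> G"
    and star_iff: "c \<in> G \<Longrightarrow> a @ b @ c \<in> Mul \<longleftrightarrow> a \<star> b = c"
proof -
  have ex1: "\<exists>!c. c \<in> G \<and> a @ b @ c \<in> Mul"
    using ex_mult[OF ab] mult_unique[OF ab] by blast
  have "a \<star> b = (THE c. c \<in> G \<and> a @ b @ c \<in> Mul)"
    unfolding pts_def dmult_def using ab length_G[OF ab(1)] length_G[OF ab(2)]
    by (auto simp: Mul_def dcarrier_def intro!: arg_cong[of _ _ The] cong: conj_cong)
  then have "a \<star> b \<in> G \<and> a @ b @ (a \<star> b) \<in> Mul"
    using theI'[OF ex1] by simp
  then show "a \<star> b \<in> G" "c \<in> G \<Longrightarrow> a @ b @ c \<in> Mul \<longleftrightarrow> a \<star> b = c"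
    using ex1 by auto
qed

lemma mult_M: "\<lbrakk>a \<in> GM; b \<in> GM\<rbrakk> \<Longrightarrow> a \<otimes>\<^bsub>pts C \<Gamma> M\<^esub> b = a \<star> b"
  using ex1_mult_M[of a b] mult_M_iff[of a b] star_iff[of a b] by (metis (lifting) GM_eq mem_Collect_eq)

lemma star_assoc:
  assumes abc: "a \<in> G" "b \<in> G" "c \<in> G" shows "(a \<star> b) \<star> c = a \<star> (b \<star> c)"
proof -
  \<comment> \<open>The blocks stand for a, b, c, ab, bc and (ab)c. Listing the intermediate
    products as coordinates keeps the description free of quantifiers.\<close>
  define X where "X = {w. length w = 6 * n \<and> take n (drop 0 w) \<in> G} \<inter>
    {w. length w = 6 * n \<and> take n (drop n w) \<in> G} \<inter>
    {w. length w = 6 * n \<and> take n (drop (2 * n) w) \<in> G} \<inter>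
    {w. length w = 6 * n \<and> take n (drop (3 * n) w) \<in> G} \<inter>
    {w. length w = 6 * n \<and> take n (drop (4 * n) w) \<in> G} \<inter>
    {w. length w = 6 * n \<and> take n (drop (5 * n) w) \<in> G} \<inter>
    {w. length w = 6 * n \<and> take n (drop 0 w) @ take n (drop n w) @ take n (drop (3 * n) w) \<in> Mul} \<inter>
    {w. length w = 6 * n \<and> take n (drop n w) @ take n (drop (2 * n) w) @ take n (drop (4 * n) w) \<in> Mul} \<inter>
    {w. length w = 6 * n \<and> take n (drop (3 * n) w) @ take n (drop (2 * n) w) @ take n (drop (5 * n) w) \<in> Mul} \<inter>
    {w. length w = 6 * n \<and> w \<notin>
      {w. length w = 6 * n \<and> take n (drop 0 w) @ take n (drop (4 * n) w) @ take n (drop (5 * n) w) \<in> Mul}}"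
  have X: "definable C M (6 * n) X"
    unfolding X_def
    by (intro definable_Int definable_compl definable_block definable_blocks3
        definable_G definable_Mul) auto
  define u v w where "u = a \<star> b" "v = b \<star> c" "w = (a \<star> b) \<star> c"
  note uvw = this
  have G: "u \<in> G" "v \<in> G" "w \<in> G" unfolding uvw using abc by (auto intro!: star_closed)
  have "a @ b @ c @ u @ v @ w \<notin> X"
  proof (rule transfer[OF X])
    fix t assume t: "t \<in> X" "set t \<subseteq> M"
    define a b c u v w where "a = take n (drop 0 t)" "b = take n (drop n t)"
      "c = take n (drop (2 * n) t)" "u = take n (drop (3 * n) t)"
      "v = take n (drop (4 * n) t)" "w = take n (drop (5 * n) t)"
    note defs = this
    have G: "a \<in> GM" "b \<in> GM" "c \<in> GM" "u \<in> GM" "v \<in> GM" "w \<in> GM"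
      unfolding defs by (rule block_GM[OF _ t(2)], use t(1) in \<open>unfold X_def, blast\<close>)+
    have "a @ b @ u \<in> Mul" "b @ c @ v \<in> Mul" "u @ c @ w \<in> Mul" "a @ v @ w \<notin> Mul"
      using t by (auto simp: X_def defs)
    then show False
      using group_M G by (auto simp: mult_M_iff group.is_monoid monoid.m_assoc)
  qed
  moreover have "a @ b @ u \<in> Mul" "b @ c @ v \<in> Mul" "u @ c @ w \<in> Mul"
    using abc G by (auto simp: star_iff uvw)
  ultimately have "a @ v @ w \<in> Mul"
    using abc G by (auto simp: X_def length_G)
  then show ?thesis using abc G by (simp add: star_iff uvw)
qed

lemma unit_M: "dunit C \<Gamma> M \<in> GM"
  using group_M group.is_monoid monoid.one_closed[of "pts C \<Gamma> M"] by (force simp: pts_def)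

lemma unit_M_mult: "a \<in> GM \<Longrightarrow> dunit C \<Gamma> M \<otimes>\<^bsub>pts C \<Gamma> M\<^esub> a = a"
    "a \<in> GM \<Longrightarrow> a \<otimes>\<^bsub>pts C \<Gamma> M\<^esub> dunit C \<Gamma> M = a"
proof -
  assume "a \<in> GM"
  moreover have "dunit C \<Gamma> M = \<one>\<^bsub>pts C \<Gamma> M\<^esub>" by (simp add: pts_def)
  ultimately show "dunit C \<Gamma> M \<otimes>\<^bsub>pts C \<Gamma> M\<^esub> a = a" "a \<otimes>\<^bsub>pts C \<Gamma> M\<^esub> dunit C \<Gamma> M = a"
    using group_M by (simp_all add: group.is_monoid)
qed

text \<open>The unit of G(M) enters as a tuple of constants from M, so each of the two laws concerns
  a single variable and transfers.\<close>

lemma star_unit_M: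
  assumes "a \<in> G"
  shows "dunit C \<Gamma> M \<star> a = a" "a \<star> dunit C \<Gamma> M = a"
proof -
  let ?u = "dunit C \<Gamma> M"
  have u: "?u \<in> G" "set ?u \<subseteq> M" "length ?u = n" using unit_M by (auto simp: GM_eq length_G)
  have l: "a \<notin> {a. length a = n \<and> take n (drop 0 a) \<in> G} \<inter> {a. length a = n \<and> a \<notin>
      {a. length a = n \<and> map (eval_tm C ((!) a)) (pars ?u @ vars 0 n @ vars 0 n) \<in> Mul}}"
  proof (rule transfer[where m = n])
    fix x assume x: "x \<in> {a. length a = n \<and> take n (drop 0 a) \<in> G} \<inter> {a. length a = n \<and> a \<notin>
      {a. length a = n \<and> map (eval_tm C ((!) a)) (pars ?u @ vars 0 n @ vars 0 n) \<in> Mul}}"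
      "set x \<subseteq> M"
    then have "x \<in> GM" by (auto simp: GM_eq)
    then have "?u @ x @ x \<in> Mul" using unit_M_mult unit_M by (simp add: mult_M_iff)
    then show False using x by simp
  qed (intro definable_Int definable_compl definable_block definable_preimage[where k = "3 * n"] definable_G
      definable_Mul; use u in auto)
  have r: "a \<notin> {a. length a = n \<and> take n (drop 0 a) \<in> G} \<inter> {a. length a = n \<and> a \<notin>
      {a. length a = n \<and> map (eval_tm C ((!) a)) (vars 0 n @ pars ?u @ vars 0 n) \<in> Mul}}"
  proof (rule transfer[where m = n])
    fix x assume x: "x \<in> {a. length a = n \<and> take n (drop 0 a) \<in> G} \<inter> {a. length a = n \<and> a \<notin>
      {a. length a = n \<and> map (eval_tm C ((!) a)) (vars 0 n @ pars ?u @ vars 0 n) \<in> Mul}}"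
      "set x \<subseteq> M"
    then have "x \<in> GM" by (auto simp: GM_eq)
    then have "x @ ?u @ x \<in> Mul" using unit_M_mult unit_M by (simp add: mult_M_iff)
    then show False using x by simp
  qed (intro definable_Int definable_compl definable_block definable_preimage[where k = "3 * n"] definable_G
      definable_Mul; use u in auto)
  from l r have "?u @ a @ a \<in> Mul" "a @ ?u @ a \<in> Mul"
    using assms length_G[OF assms] by auto
  then show "?u \<star> a = a" "a \<star> ?u = a" using assms u(1) by (simp_all add: star_iff)
qed

text \<open>Uniqueness of a neutral element identifies the unit of G* with that of G(M); in
  particular its coordinates lie in M.\<close>

lemma e_eq: "e = dunit C \<Gamma> M"
proof -
  have "e = (THE u. u \<in> G \<and> (\<forall>a\<in>G. u \<star> a = a \<and> a \<star> u = a))"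
    by (simp add: pts_def dunit_def)
  also have "\<dots> = dunit C \<Gamma> M"
  proof (rule the_equality)
    show u: "dunit C \<Gamma> M \<in> G \<and> (\<forall>a\<in>G. dunit C \<Gamma> M \<star> a = a \<and> a \<star> dunit C \<Gamma> M = a)"
      using unit_M star_unit_M by (auto simp: GM_eq)
    show "v = dunit C \<Gamma> M" if "v \<in> G \<and> (\<forall>a\<in>G. v \<star> a = a \<and> a \<star> v = a)" for v
      using that u by metis
  qed
  finally show ?thesis .
qed

lemma one_M: "\<one>\<^bsub>pts C \<Gamma> M\<^esub> = e"
  by (simp add: e_eq) (simp add: pts_def)

lemma e_GM: "e \<in> GM"
  using unit_M by (simp add: e_eq)

lemma ex_left_inverse:
  assumes "a \<in> G" shows "\<exists>b\<in>G. b \<star> a = e"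
proof -
  have u: "e \<in> G" "set e \<subseteq> M" "length e = n" using e_GM by (auto simp: GM_eq length_G)
  define Y where "Y = {v. length v = 2 * n \<and> take n (drop 0 v) \<in> G} \<inter>
    {v. length v = 2 * n \<and> map (eval_tm C ((!) v)) (vars 0 n @ vars n n @ pars e) \<in> Mul}"
  define P where "P = {w. \<exists>b. length b = n \<and> b @ w \<in> Y}"
  define X where "X = {w. length w = n \<and> take n (drop 0 w) \<in> G} \<inter> {w. length w = n \<and> w \<notin> P}"
  have "definable C M (2 * n) Y"
    unfolding Y_def
    by (intro definable_Int definable_block definable_preimage[where k = "3 * n"] definable_G definable_Mul)
      (use u in auto)
  then have "definable C M n P"
    unfolding P_def by (intro definable_ex) (simp add: eval_nat_numeral)
  then have X: "definable C M n X"
    unfolding X_def by (intro definable_Int definable_block definable_compl definable_G) auto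
  have P: "x \<in> P \<longleftrightarrow> (\<exists>b\<in>G. b \<star> x = e)" if "x \<in> G" for x
  proof -
    have "b @ x \<in> Y \<longleftrightarrow> b \<in> G \<and> b \<star> x = e" if "length b = n" for b
      using that u star_iff[of b x e] length_G[OF \<open>x \<in> G\<close>] \<open>x \<in> G\<close> by (auto simp: Y_def)
    then show ?thesis unfolding P_def using length_G by blast
  qed
  have "a \<notin> X"
  proof (rule transfer[OF X])
    fix x assume x: "x \<in> X" "set x \<subseteq> M"
    then have "x \<in> GM" by (auto simp: X_def GM_eq)
    then obtain b where b: "b \<in> GM" "b \<otimes>\<^bsub>pts C \<Gamma> M\<^esub> x = e"
      using group.l_inv_ex[OF group_M] one_M by metis
    then have "b \<star> x = e" using mult_M \<open>x \<in> GM\<close> by simp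
    then have "x \<in> P" using P[of x] \<open>x \<in> GM\<close> b(1) by (auto simp: GM_eq)
    then show False using x by (simp add: X_def)
  qed
  then show ?thesis using assms P by (auto simp: X_def length_G)
qed

lemma group_Gstar: "group (Gstar C \<Gamma>)"
  by (rule groupI)
    (use star_closed star_assoc star_unit_M ex_left_inverse e_GM e_eq in \<open>auto simp: GM_eq\<close>)

sublocale Gs: group "Gstar C \<Gamma>"
  by (rule group_Gstar)

lemma GM_subset: "g \<in> GM \<Longrightarrow> g \<in> G"
  by (simp add: GM_eq)

lemma star_GM: "\<lbrakk>g \<in> GM; h \<in> GM\<rbrakk> \<Longrightarrow> g \<star> h \<in> GM"
  using monoid.m_closed[OF group.is_monoid[OF group_M]] mult_M by fastforce

lemma inv_GM: "g \<in> GM \<Longrightarrow> inv\<^bsub>Gstar C \<Gamma>\<^esub> g \<in> GM"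
  by (metis GM_subset Gs.inv_equality group.l_inv_ex[OF group_M] mult_M one_M)

text \<open>A coordinate of the product is defined from the factors: it is the last entry of a tuple
  in \<open>Z\<close>, whose first \<open>n\<close> entries are forced to be the product. This keeps
  the parameters of translated \<Delta>-formulas in the definable closure.\<close>

lemma star_dcl:
  assumes ab: "a \<in> G" "b \<in> G" "set a \<subseteq> dcl C A" "set b \<subseteq> dcl C A"
  shows "set (a \<star> b) \<subseteq> dcl C A"
proof
  fix c assume "c \<in> set (a \<star> b)"
  then obtain i where i: "i < n" "c = (a \<star> b) ! i"
    using ab by (metis in_set_conv_nth length_G star_closed)
  define Z where "Z = {v. length v = n + 1 \<and> take n (drop 0 v) \<in> G} \<inter>
    {v. length v = n + 1 \<and> map (eval_tm C ((!) v)) (pars a @ pars b @ vars 0 n) \<in> Mul} \<inter>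
    {v. length v = n + 1 \<and> v ! i = v ! n}"
  have "definable C (dcl C A) (n + 1) Z"
    unfolding Z_def
    by (intro definable_Int definable_block definable_preimage[where k = "3 * n"] definable_nth_eq
        definable_G definable_Mul) (use ab i in \<open>auto simp: length_G\<close>)
  then have "definable C (dcl C A) 1 {x. \<exists>w. length w = n \<and> w @ x \<in> Z}"
    by (rule definable_ex)
  moreover have "{x. \<exists>w. length w = n \<and> w @ x \<in> Z} = {[c]}"
  proof -
    have "w @ x \<in> Z \<longleftrightarrow> w = a \<star> b \<and> x = [c]" if "length w = n" for w x
    proof (cases "length x = 1")
      case True
      then obtain d where "x = [d]" by (auto simp: length_Suc_conv)
      then show ?thesis
        using that ab(1,2) i star_iff[of a b w] star_closed[OF ab(1,2)]
        by (auto simp: Z_def nth_append)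
    next
      case False
      then show ?thesis using that by (auto simp: Z_def)
    qed
    then show ?thesis using star_closed[OF ab(1,2)] length_G by auto
  qed
  ultimately show "c \<in> dcl C A" using in_dcl_iff definable_dcl by metis
qed

end

section \<open>\<open>\<Delta>\<close>-definable sets\<close>

lemma dcl_mono: "A \<subseteq> B \<Longrightarrow> dcl C A \<subseteq> dcl C B"
  using definable_mono by (fastforce simp: in_dcl_iff)

lemma holds_inst: "length a = m \<Longrightarrow> holds C (inst m ps \<phi>) a = holds C \<phi> (a @ ps)"
  unfolding sat_inst by (intro sat_cong) (simp add: nth_append)

lemma boolean_combinations_mono:
  assumes "B \<subseteq> B'" shows "boolean_combinations B \<subseteq> boolean_combinations B'"
proof
  fix \<xi> assume "\<xi> \<in> boolean_combinations B"
  then show "\<xi> \<in> boolean_combinations B'"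
    by induction (use assms in \<open>auto intro: boolean_combinations.intros\<close>)
qed

context monster_group
begin

abbreviation dfms where "dfms \<equiv> Delta_fms C \<Gamma> \<Delta>"

text \<open>The trace on G* is taken because a \<Delta>-formula, for instance a negated one, may
  also hold of tuples outside G*.\<close>

definition Delta_set :: "'c set \<Rightarrow> 'c list set \<Rightarrow> bool" where
  "Delta_set A X \<longleftrightarrow> (\<exists>\<phi>\<in>dfms A. X = {x \<in> G. holds C \<phi> x})"

lemma Delta_fms_mono: "A \<subseteq> B \<Longrightarrow> dfms A \<subseteq> dfms B"
proof -
  assume AB: "A \<subseteq> B"
  have "Delta_instances C \<Gamma> \<Delta> A \<subseteq> Delta_instances C \<Gamma> \<Delta> B"
    using dcl_mono[OF AB, of C] unfolding Delta_instances_def by blast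
  from boolean_combinations_mono[OF this] show ?thesis
    using fms_over_mono[OF dcl_mono[OF AB, of C], of C] unfolding Delta_fms_def by blast
qed

lemma Delta_over: "\<delta> \<in> \<Delta> \<Longrightarrow> \<delta> \<in> fms_over C {}"
  using adm unfolding admissible_Delta_def is_product_fm_def by blast

lemma boolean_combination_Delta_fms:
  assumes "\<xi> \<in> boolean_combinations (Delta_instances C \<Gamma> \<Delta> A)"
  shows "\<xi> \<in> dfms A"
proof -
  have "\<xi> \<in> fms_over C (dcl C A) \<and> fv \<xi> \<subseteq> {..<n}"
    using assms
  proof induction
    case (base \<phi>)
    then obtain \<delta> ps where \<delta>: "\<phi> = inst n ps \<delta>" "\<delta> \<in> \<Delta>" "fv \<delta> \<subseteq> {..<n + length ps}"
      "set ps \<subseteq> dcl C A" unfolding Delta_instances_def by blast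
    have "wf_fm C \<delta>" "params \<delta> = {}" using Delta_over[OF \<delta>(2)] by (auto simp: fms_over_def)
    then show ?case
      using wf_inst params_inst[OF \<delta>(3)] fv_inst[of n ps \<delta>] \<delta>(4) by (auto simp: fms_over_def \<delta>(1))
  qed (auto simp: fms_over_def)
  then show ?thesis using assms unfolding Delta_fms_def by blast
qed

lemma Delta_fms_over: "\<phi> \<in> dfms A \<Longrightarrow> \<phi> \<in> fms_over C (dcl C A) \<and> fv \<phi> \<subseteq> {..<n}"
  unfolding Delta_fms_def by blast

lemma Delta_fms_Neg: "\<phi> \<in> dfms A \<Longrightarrow> Neg \<phi> \<in> dfms A"
proof -
  assume \<phi>: "\<phi> \<in> dfms A"
  then obtain \<xi> where \<xi>: "\<xi> \<in> boolean_combinations (Delta_instances C \<Gamma> \<Delta> A)"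
    "\<forall>a. length a = n \<longrightarrow> holds C \<phi> a = holds C \<xi> a" unfolding Delta_fms_def by blast
  show ?thesis unfolding Delta_fms_def
    using Delta_fms_over[OF \<phi>] boolean_combinations.neg[OF \<xi>(1)] \<xi>(2)
    by (intro CollectI conjI bexI[of _ "Neg \<xi>"]) (auto simp: fms_over_def)
qed

lemma Delta_fms_Conj: "\<lbrakk>\<phi> \<in> dfms A; \<psi> \<in> dfms A\<rbrakk> \<Longrightarrow> Conj \<phi> \<psi> \<in> dfms A"
proof -
  assume \<phi>: "\<phi> \<in> dfms A" "\<psi> \<in> dfms A"
  then obtain \<xi> \<xi>' where \<xi>: "\<xi> \<in> boolean_combinations (Delta_instances C \<Gamma> \<Delta> A)"
    "\<forall>a. length a = n \<longrightarrow> holds C \<phi> a = holds C \<xi> a"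
    "\<xi>' \<in> boolean_combinations (Delta_instances C \<Gamma> \<Delta> A)"
    "\<forall>a. length a = n \<longrightarrow> holds C \<psi> a = holds C \<xi>' a"
    unfolding Delta_fms_def by blast
  show ?thesis unfolding Delta_fms_def
    using Delta_fms_over[OF \<phi>(1)] Delta_fms_over[OF \<phi>(2)] boolean_combinations.conj[OF \<xi>(1,3)] \<xi>(2,4)
    by (intro CollectI conjI bexI[of _ "Conj \<xi> \<xi>'"]) (auto simp: fms_over_def)
qed

lemma e_G: "e \<in> G" and set_e: "set e \<subseteq> M"
  using e_GM by (auto simp: GM_eq)

text \<open>\<Delta> contains G(y x z), and y = z = e turns it into G(x). The hypothesis puts the
  coordinates of e among the parameters.\<close>

lemma dom_fm_Delta:
  assumes "M \<subseteq> A" shows "dom_fm \<Gamma> \<in> dfms A"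
proof -
  obtain \<delta> where \<delta>: "\<delta> \<in> \<Delta>" "is_product_fm C \<Gamma> 0 (dom_fm \<Gamma>) \<delta>"
    using adm unfolding admissible_Delta_def by blast
  have "holds C (inst n (e @ e) \<delta>) a \<longleftrightarrow> a \<in> G" if a: "length a = n" for a
  proof -
    have "holds C \<delta> (a @ e @ e @ []) \<longleftrightarrow> a \<in> G \<and> holds C (dom_fm \<Gamma>) ((e \<star> a \<star> e) @ [])"
      using \<delta>(2) a e_G unfolding is_product_fm_def by (simp add: length_G)
    also have "\<dots> \<longleftrightarrow> a \<in> G"
      by (auto simp: G_eq cong: conj_cong)
    finally show ?thesis using a by (simp add: holds_inst)
  qed
  moreover have "inst n (e @ e) \<delta> \<in> Delta_instances C \<Gamma> \<Delta> A"
    using \<delta> length_G[OF e_G] set_e assms subset_dcl[of A C]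
    unfolding Delta_instances_def is_product_fm_def
    by (intro CollectI exI[of _ \<delta>] exI[of _ "e @ e"]) auto
  moreover have "dom_fm \<Gamma> \<in> fms_over C (dcl C A)" "fv (dom_fm \<Gamma>) \<subseteq> {..<n}"
    using dgrp fms_over_mono[of "{}" _ C] unfolding definable_group_def by auto
  ultimately show ?thesis
    unfolding Delta_fms_def
    by (intro CollectI conjI bexI[of _ "inst n (e @ e) \<delta>"])
      (auto simp: G_eq intro: boolean_combinations.base)
qed

text \<open>
  The reason for requiring the formulas of \<open>\<Delta>\<close> to have the form \<open>\<psi>(y\<cdot>x\<cdot>z; t)\<close>: translating
  \<open>x\<close> is absorbed by the parameters \<open>y\<close> and \<open>z\<close>.
\<close>

lemma Delta_fms_translate:
  assumes "M \<subseteq> A" and gh: "g \<in> G" "h \<in> G" "set g \<subseteq> dcl C A" "set h \<subseteq> dcl C A"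
    and "\<phi> \<in> dfms A"
  shows "\<exists>\<phi>'\<in>dfms A. \<forall>x\<in>G. holds C \<phi>' x = holds C \<phi> (g \<star> x \<star> h)"
proof -
  have base_case: "\<exists>\<xi>'\<in>Delta_instances C \<Gamma> \<Delta> A. \<forall>x\<in>G. holds C \<xi>' x = holds C \<xi> (g \<star> x \<star> h)"
    if "\<xi> \<in> Delta_instances C \<Gamma> \<Delta> A" for \<xi>
  proof -
    obtain \<delta> ps where \<delta>: "\<xi> = inst n ps \<delta>" "\<delta> \<in> \<Delta>" "fv \<delta> \<subseteq> {..<n + length ps}"
      "set ps \<subseteq> dcl C A" using \<open>\<xi> \<in> _\<close> unfolding Delta_instances_def by blast
    obtain k \<psi> where k: "is_product_fm C \<Gamma> k \<psi> \<delta>"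
      using adm \<delta>(2) unfolding admissible_Delta_def by blast
    obtain m where m: "m \<in> M" using M_elem unfolding elementary_substructure_def by blast
    \<comment> \<open>An instance has to supply values only for the free variables of \<delta>, so
      the length of \<open>ps\<close> need not match the blocks y, z, t; it is cut, or padded with a
      point of M.\<close>
    define qs where "qs = map (\<lambda>i. if i < length ps then ps ! i else m) [0..<2 * n + k]"
    define y z t where "y = take n qs" "z = take n (drop n qs)" "t = drop (2 * n) qs"
    note yzt = this
    have len: "length y = n" "length z = n" "length t = k"
      unfolding yzt by (auto simp: qs_def)
    have qs: "qs = y @ z @ t"
      unfolding yzt by (metis append_take_drop_id drop_drop mult_2)
    have set: "set qs \<subseteq> dcl C A"
      using \<delta>(4) m assms(1) subset_dcl[of A C] nth_mem[of _ ps] unfolding qs_def by force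
    then have sets: "set y \<subseteq> dcl C A" "set z \<subseteq> dcl C A" "set t \<subseteq> dcl C A"
      unfolding qs by auto
    have \<xi>: "holds C \<xi> x \<longleftrightarrow> y \<in> G \<and> z \<in> G \<and> holds C \<psi> ((y \<star> x \<star> z) @ t)" if x: "x \<in> G" for x
    proof -
      have "fv \<delta> \<subseteq> {..<3 * n + k}" using k unfolding is_product_fm_def by blast
      then have "holds C \<delta> (x @ ps) = holds C \<delta> (x @ qs)"
      proof (intro sat_cong ballI)
        fix i assume "i \<in> fv \<delta>"
        then have "i < 3 * n + k" "i < n + length ps"
          using \<delta>(3) \<open>fv \<delta> \<subseteq> {..<3 * n + k}\<close> by auto
        then show "(x @ ps) ! i = (x @ qs) ! i"
          by (auto simp: nth_append qs_def length_G[OF x])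
      qed
      also have "\<dots> \<longleftrightarrow> y \<in> G \<and> z \<in> G \<and> holds C \<psi> ((y \<star> x \<star> z) @ t)"
        using k len length_G[OF x] x unfolding qs is_product_fm_def by simp
      finally show ?thesis by (simp add: \<delta>(1) holds_inst length_G[OF x])
    qed
    show ?thesis
    proof (cases "y \<in> G \<and> z \<in> G")
      \<comment> \<open>If y or z is outside G*, the instance fails on all of G* and is its own
        translate.\<close>
      case False
      then show ?thesis using \<xi> gh \<open>\<xi> \<in> _\<close> by (intro bexI[of _ \<xi>]) auto
    next
      case True
      let ?\<xi> = "inst n ((y \<star> g) @ (h \<star> z) @ t) \<delta>"
      have yg: "y \<star> g \<in> G" "h \<star> z \<in> G" using True gh by auto
      have "?\<xi> \<in> Delta_instances C \<Gamma> \<Delta> A"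
        using k True gh len(3) sets star_dcl[of y g A] star_dcl[of h z A] \<delta>(2) length_G[OF yg(1)]
          length_G[OF yg(2)]
        unfolding Delta_instances_def is_product_fm_def
        by (intro CollectI exI[of _ \<delta>] exI[of _ "(y \<star> g) @ (h \<star> z) @ t"]) auto
      moreover have "holds C ?\<xi> x = holds C \<xi> (g \<star> x \<star> h)" if x: "x \<in> G" for x
      proof -
        have "holds C ?\<xi> x \<longleftrightarrow> holds C \<delta> (x @ (y \<star> g) @ (h \<star> z) @ t)"
          by (simp add: holds_inst length_G[OF x])
        also have "\<dots> \<longleftrightarrow> holds C \<psi> (((y \<star> g) \<star> x \<star> (h \<star> z)) @ t)"
          using k len(3) x yg length_G[OF x] length_G[OF yg(1)] length_G[OF yg(2)]
          unfolding is_product_fm_def by simp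
        also have "(y \<star> g) \<star> x \<star> (h \<star> z) = y \<star> (g \<star> x \<star> h) \<star> z"
          using True gh x by (simp add: Gs.m_assoc)
        finally show ?thesis using \<xi>[of "g \<star> x \<star> h"] True gh x by simp
      qed
      ultimately show ?thesis by blast
    qed
  qed
  have "\<exists>\<xi>'\<in>boolean_combinations (Delta_instances C \<Gamma> \<Delta> A).
      \<forall>x\<in>G. holds C \<xi>' x = holds C \<xi> (g \<star> x \<star> h)"
    if "\<xi> \<in> boolean_combinations (Delta_instances C \<Gamma> \<Delta> A)" for \<xi>
    using that
  proof induction
    case (base \<phi>)
    from base_case[OF base] show ?case by (auto intro: boolean_combinations.base)
  next
    case (neg \<phi>)
    then obtain \<xi>' where "\<xi>' \<in> boolean_combinations (Delta_instances C \<Gamma> \<Delta> A)"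
      "\<forall>x\<in>G. holds C \<xi>' x = holds C \<phi> (g \<star> x \<star> h)" by blast
    then show ?case
      by (intro bexI[of _ "Neg \<xi>'"]) (auto intro: boolean_combinations.neg)
  next
    case (conj \<phi> \<psi>)
    then obtain \<xi> \<xi>' where "\<xi> \<in> boolean_combinations (Delta_instances C \<Gamma> \<Delta> A)"
      "\<forall>x\<in>G. holds C \<xi> x = holds C \<phi> (g \<star> x \<star> h)"
      "\<xi>' \<in> boolean_combinations (Delta_instances C \<Gamma> \<Delta> A)"
      "\<forall>x\<in>G. holds C \<xi>' x = holds C \<psi> (g \<star> x \<star> h)" by blast
    then show ?case
      by (intro bexI[of _ "Conj \<xi> \<xi>'"]) (auto intro: boolean_combinations.conj)
  qed
  moreover obtain \<xi> where \<xi>: "\<xi> \<in> boolean_combinations (Delta_instances C \<Gamma> \<Delta> A)"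
    "\<forall>a. length a = n \<longrightarrow> holds C \<phi> a = holds C \<xi> a"
    using \<open>\<phi> \<in> dfms A\<close> unfolding Delta_fms_def by blast
  ultimately obtain \<xi>' where \<xi>': "\<xi>' \<in> boolean_combinations (Delta_instances C \<Gamma> \<Delta> A)"
    "\<forall>x\<in>G. holds C \<xi>' x = holds C \<xi> (g \<star> x \<star> h)" by blast
  have "holds C \<xi>' x = holds C \<phi> (g \<star> x \<star> h)" if "x \<in> G" for x
    using \<xi>'(2) \<xi>(2) that length_G[of "g \<star> x \<star> h"] gh by simp
  then show ?thesis using boolean_combination_Delta_fms[OF \<xi>'(1)] by blast
qed

section \<open>The Boolean algebra of \<Delta>-sets and its invariance under translations\<close>

lemma Delta_set_G: "M \<subseteq> A \<Longrightarrow> Delta_set A G"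
  unfolding Delta_set_def by (intro bexI[of _ "dom_fm \<Gamma>"] dom_fm_Delta) (auto simp: G_eq)

lemma Delta_set_Int:
  assumes "Delta_set A X" "Delta_set A Y" shows "Delta_set A (X \<inter> Y)"
proof -
  obtain \<phi> \<psi> where "\<phi> \<in> dfms A" "X = {x \<in> G. holds C \<phi> x}" "\<psi> \<in> dfms A" "Y = {x \<in> G. holds C \<psi> x}"
    using assms unfolding Delta_set_def by blast
  then show ?thesis
    unfolding Delta_set_def by (intro bexI[of _ "Conj \<phi> \<psi>"] Delta_fms_Conj) auto
qed

lemma Delta_set_compl:
  assumes "Delta_set A X" shows "Delta_set A (G - X)"
proof -
  obtain \<phi> where "\<phi> \<in> dfms A" "X = {x \<in> G. holds C \<phi> x}"
    using assms unfolding Delta_set_def by blast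
  then show ?thesis
    unfolding Delta_set_def by (intro bexI[of _ "Neg \<phi>"] Delta_fms_Neg) auto
qed

lemma Delta_set_subset: "Delta_set A X \<Longrightarrow> X \<subseteq> G"
  unfolding Delta_set_def by auto

lemma Delta_set_Un: "\<lbrakk>Delta_set A X; Delta_set A Y\<rbrakk> \<Longrightarrow> Delta_set A (X \<union> Y)"
proof -
  assume XY: "Delta_set A X" "Delta_set A Y"
  then have "Delta_set A (G - ((G - X) \<inter> (G - Y)))"
    by (intro Delta_set_compl Delta_set_Int)
  moreover have "G - ((G - X) \<inter> (G - Y)) = X \<union> Y"
    using XY[THEN Delta_set_subset] by auto
  ultimately show ?thesis by simp
qed

lemma Delta_set_empty: "M \<subseteq> A \<Longrightarrow> Delta_set A {}"
  using Delta_set_compl[OF Delta_set_G] by simp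

lemma Delta_set_definable: "Delta_set A X \<Longrightarrow> definable C (dcl C A) n X"
proof -
  assume "Delta_set A X"
  then obtain \<phi> where \<phi>: "\<phi> \<in> dfms A" "X = {x \<in> G. holds C \<phi> x}"
    unfolding Delta_set_def by blast
  have "X = G \<inter> {x. length x = n \<and> holds C \<phi> x}" using \<phi>(2) length_G by auto
  then show ?thesis
    using Delta_fms_over[OF \<phi>(1)] by (auto intro: definable_Int definable_G definableI)
qed

lemma Delta_set_mono: "\<lbrakk>Delta_set A X; A \<subseteq> B\<rbrakk> \<Longrightarrow> Delta_set B X"
  unfolding Delta_set_def using Delta_fms_mono by blast

lemma Delta_set_translate:
  assumes "M \<subseteq> A" "g \<in> G" "h \<in> G" "set g \<subseteq> dcl C A" "set h \<subseteq> dcl C A" "Delta_set A X"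
  shows "Delta_set A {x \<in> G. g \<star> x \<star> h \<in> X}"
proof -
  obtain \<phi> where \<phi>: "\<phi> \<in> dfms A" "X = {x \<in> G. holds C \<phi> x}"
    using assms(6) unfolding Delta_set_def by blast
  then obtain \<phi>' where "\<phi>' \<in> dfms A" "\<forall>x\<in>G. holds C \<phi>' x = holds C \<phi> (g \<star> x \<star> h)"
    using Delta_fms_translate[OF assms(1-5)] by blast
  then show ?thesis
    unfolding Delta_set_def using \<phi>(2) assms(2,3) by (intro bexI[of _ \<phi>']) auto
qed

lemma Delta_set_left:
  assumes "M \<subseteq> A" "g \<in> G" "set g \<subseteq> dcl C A" "Delta_set A X"
  shows "Delta_set A {x \<in> G. g \<star> x \<in> X}"
proof -
  have "Delta_set A {x \<in> G. g \<star> x \<star> e \<in> X}"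
    using assms set_e e_G subset_dcl[of A C] by (intro Delta_set_translate) auto
  also have "{x \<in> G. g \<star> x \<star> e \<in> X} = {x \<in> G. g \<star> x \<in> X}"
    using assms(2) by auto
  finally show ?thesis .
qed

lemma Delta_set_right:
  assumes "M \<subseteq> A" "h \<in> G" "set h \<subseteq> dcl C A" "Delta_set A X"
  shows "Delta_set A {x \<in> G. x \<star> h \<in> X}"
proof -
  have "Delta_set A {x \<in> G. e \<star> x \<star> h \<in> X}"
    using assms set_e e_G subset_dcl[of A C] by (intro Delta_set_translate) auto
  also have "{x \<in> G. e \<star> x \<star> h \<in> X} = {x \<in> G. x \<star> h \<in> X}"
    using assms(2) by auto
  finally show ?thesis .
qed

text \<open>This is density of G(M) for the topology generated by the \<Delta>-sets over M.\<close>

lemma Delta_set_meets_GM: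
  assumes "Delta_set M X" "X \<noteq> {}" shows "\<exists>g\<in>GM. g \<in> X"
  using elementary_witness[OF M_elem, of n X] Delta_set_definable[OF assms(1)] assms
    Delta_set_subset[OF assms(1)] by (auto simp: GM_eq)

section \<open>Equality of types and finite satisfiability in terms of \<Delta>-sets\<close>

definition eqD :: "'c list rel" where
  "eqD = {(a, b). a \<in> G \<and> b \<in> G \<and> tpD C \<Gamma> \<Delta> a M = tpD C \<Gamma> \<Delta> b M}"

lemma tpD_eq_iff:
  assumes "a \<in> G" "b \<in> G"
  shows "tpD C \<Gamma> \<Delta> a M = tpD C \<Gamma> \<Delta> b M \<longleftrightarrow> (\<forall>X. Delta_set M X \<longrightarrow> a \<in> X \<longleftrightarrow> b \<in> X)"
  using assms unfolding Delta_set_def tpD_def by blast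

lemma eqD_iff: "(a, b) \<in> eqD \<longleftrightarrow> a \<in> G \<and> b \<in> G \<and> (\<forall>X. Delta_set M X \<longrightarrow> a \<in> X \<longleftrightarrow> b \<in> X)"
  using tpD_eq_iff unfolding eqD_def by auto

text \<open>One implication is enough because complements of \<Delta>-sets are
  \<Delta>-sets.\<close>

lemma eqD_I: "\<lbrakk>a \<in> G; b \<in> G; \<And>X. \<lbrakk>Delta_set M X; a \<in> X\<rbrakk> \<Longrightarrow> b \<in> X\<rbrakk> \<Longrightarrow> (a, b) \<in> eqD"
  unfolding eqD_iff using Delta_set_compl by (metis Diff_iff)

lemma fin_sat_iff:
  assumes "M \<subseteq> A" "a \<in> G"
  shows "finitely_satisfiable_in C n (tpD C \<Gamma> \<Delta> a A) M \<longleftrightarrow>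
    (\<forall>X. Delta_set A X \<and> a \<in> X \<longrightarrow> (\<exists>g\<in>GM. g \<in> X))"
proof
  assume L: "finitely_satisfiable_in C n (tpD C \<Gamma> \<Delta> a A) M"
  show "\<forall>X. Delta_set A X \<and> a \<in> X \<longrightarrow> (\<exists>g\<in>GM. g \<in> X)"
  proof (intro allI impI)
    fix X assume X: "Delta_set A X \<and> a \<in> X"
    then obtain \<phi> where \<phi>: "\<phi> \<in> dfms A" "X = {x \<in> G. holds C \<phi> x}"
      unfolding Delta_set_def by blast
    \<comment> \<open>\<open>dom_fm \<Gamma>\<close> is added so that the witness lies in the group;
      \<phi> alone might be satisfied outside it.\<close>
    have "{\<phi>, dom_fm \<Gamma>} \<subseteq> tpD C \<Gamma> \<Delta> a A"
      using \<phi> X dom_fm_Delta[OF assms(1)] by (auto simp: tpD_def G_eq)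
    then obtain b where "length b = n" "set b \<subseteq> M" "\<forall>\<psi>\<in>{\<phi>, dom_fm \<Gamma>}. holds C \<psi> b"
      using L unfolding finitely_satisfiable_in_def by (meson finite.emptyI finite.insertI)
    then show "\<exists>g\<in>GM. g \<in> X" using \<phi>(2) by (auto simp: GM_eq G_eq)
  qed
next
  assume R: "\<forall>X. Delta_set A X \<and> a \<in> X \<longrightarrow> (\<exists>g\<in>GM. g \<in> X)"
  show "finitely_satisfiable_in C n (tpD C \<Gamma> \<Delta> a A) M"
    unfolding finitely_satisfiable_in_def
  proof (intro allI impI)
    fix q assume q: "finite q \<and> q \<subseteq> tpD C \<Gamma> \<Delta> a A"
    have "Delta_set A {x \<in> G. \<forall>\<phi>\<in>q. holds C \<phi> x}"
      using conjunct1[OF q] conjunct2[OF q]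
    proof (induction q rule: finite_induct)
      case empty
      then show ?case using Delta_set_G[OF assms(1)] by simp
    next
      case (insert \<phi> q)
      have "Delta_set A {x \<in> G. holds C \<phi> x}"
        using insert.prems unfolding Delta_set_def tpD_def by blast
      moreover have "{x \<in> G. \<forall>\<psi>\<in>insert \<phi> q. holds C \<psi> x} =
          {x \<in> G. holds C \<phi> x} \<inter> {x \<in> G. \<forall>\<phi>\<in>q. holds C \<phi> x}" by auto
      ultimately show ?case using insert Delta_set_Int by simp
    qed
    moreover have "a \<in> {x \<in> G. \<forall>\<phi>\<in>q. holds C \<phi> x}"
      using q assms(2) by (auto simp: tpD_def)
    ultimately obtain g where "g \<in> GM" "\<forall>\<phi>\<in>q. holds C \<phi> g" using R by blast
    then show "\<exists>a. length a = n \<and> set a \<subseteq> M \<and> (\<forall>\<phi>\<in>q. holds C \<phi> a)"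
      using length_G by (auto simp: GM_eq)
  qed
qed

section \<open>Smallness\<close>

lemma kappa: "Card_order \<kappa>" "|Pow (fms_over C M)| <o \<kappa>" "saturated \<kappa> C"
  using monster unfolding monster_model_def by auto

lemma fms_small: "|fms_over C M| <o \<kappa>"
  using card_of_Pow[of "fms_over C M"] kappa(2) by (rule ordLess_transitive)

text \<open>There are already infinitely many formulas over M, for example the equations of a
  variable with itself.\<close>

lemma infinite_kappa: "\<not> finite (Field \<kappa>)"
proof
  assume fin: "finite (Field \<kappa>)"
  have "|fms_over C M| \<le>o |Field \<kappa>|"
    using fms_small card_of_Field_ordIso[OF kappa(1)]
    by (meson ordIso_symmetric ordLess_imp_ordLeq ordLeq_ordIso_trans)
  then have "finite (fms_over C M)" using fin card_of_ordLeq_finite by blast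
  moreover have "range (\<lambda>i. Eq (Var i) (Var i)) \<subseteq> fms_over C M" by (auto simp: fms_over_def)
  moreover have "infinite (range (\<lambda>i. Eq (Var i) (Var i) :: ('f, 'r, 'c) fm))"
    by (intro range_inj_infinite injI) simp
  ultimately show False using finite_subset by blast
qed

lemma Un_small: "\<lbrakk>|A| <o \<kappa>; |B| <o \<kappa>\<rbrakk> \<Longrightarrow> |A \<union> B| <o \<kappa>"
  by (rule card_of_Un_ordLess_infinite_Field[OF infinite_kappa kappa(1)])

lemma M_small: "|M| <o \<kappa>"
proof -
  have "inj_on (\<lambda>c. Eq (Var 0) (Par c)) M" by (intro inj_onI) simp
  moreover have "(\<lambda>c. Eq (Var 0) (Par c)) ` M \<subseteq> fms_over C M" by (auto simp: fms_over_def)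
  ultimately have "|M| \<le>o |fms_over C M|" using card_of_ordLeq by blast
  then show ?thesis using fms_small by (rule ordLeq_ordLess_trans)
qed

text \<open>An element of \<open>dcl (M \<union> b)\<close> is determined by the \<open>M\<close>-definable relation it satisfies with \<open>b\<close>.\<close>

lemma dcl_small:
  assumes "finite P" shows "|dcl C (M \<union> P)| <o \<kappa>"
proof -
  obtain b where b: "set b = P" using assms finite_list by blast
  define F where "F \<phi> = (THE c. holds C \<phi> (c # b))" for \<phi>
  have "\<exists>\<phi>\<in>fms_over C M. c = F \<phi>" if c: "c \<in> dcl C (M \<union> P)" for c
  proof -
    obtain \<phi> where \<phi>: "\<phi> \<in> fms_over C (M \<union> P)" "fv \<phi> \<subseteq> {0}" "\<forall>d. holds C \<phi> [d] \<longleftrightarrow> d = c"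
      using c unfolding dcl_def by blast
    have "\<forall>d\<in>P. \<exists>i<length b. b ! i = d" using b in_set_conv_nth by metis
    then obtain ix where ix: "\<forall>d\<in>P. ix d < length b \<and> b ! ix d = d" by metis
    \<comment> \<open>Variable 0 is reserved for \<open>c\<close>, so the entry of \<open>b\<close>
      at position \<open>ix d\<close> is the variable \<open>Suc (ix d)\<close>; parameters in M
      stay.\<close>
    define \<pi> :: "'c \<Rightarrow> ('f, 'c) tm" where "\<pi> d = (if d \<in> M then Par d else Var (Suc (ix d)))" for d
    have "holds C (subst Var \<pi> \<phi>) (d # b) \<longleftrightarrow> d = c" for d
    proof -
      have "holds C (subst Var \<pi> \<phi>) (d # b) = sat C UNIV (\<lambda>i. eval_tm C ((!) (d # b)) (Var i)) \<phi>"
        using \<phi>(1) ix by (intro sat_subst) (auto simp: \<pi>_def fms_over_def)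
      also have "\<dots> = holds C \<phi> [d]"
        using \<phi>(2) by (intro sat_cong) auto
      finally show ?thesis using \<phi>(3) by simp
    qed
    moreover have "wf_fm C (subst Var \<pi> \<phi>)"
      using \<phi>(1) by (intro wf_subst) (auto simp: \<pi>_def fms_over_def)
    moreover have "params (subst Var \<pi> \<phi>) \<subseteq> M"
      using params_subst[of Var \<pi> \<phi>] by (auto simp: \<pi>_def split: if_splits)
    ultimately show ?thesis
      by (intro bexI[of _ "subst Var \<pi> \<phi>"]) (auto simp: F_def fms_over_def)
  qed
  then have "dcl C (M \<union> P) \<subseteq> F ` fms_over C M" by blast
  then have "|dcl C (M \<union> P)| \<le>o |fms_over C M|"
    using card_of_mono1 card_of_image ordLeq_transitive by blast
  then show ?thesis using fms_small by (rule ordLeq_ordLess_trans)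
qed

section \<open>The topology of \<open>\<Delta>\<close>-types on the group\<close>

text \<open>
  The complete \<open>\<Delta>\<close>-types are the points of the Kolmogorov quotient of this compact zero-dimensional
  topology, so continuous maps from it to Hausdorff spaces factor through them.
\<close>

definition T :: "'c list topology" where
  "T = topology (\<lambda>U. U \<subseteq> G \<and> (\<forall>x\<in>U. \<exists>B. Delta_set M B \<and> x \<in> B \<and> B \<subseteq> U))"

lemma openin_T: "openin T U \<longleftrightarrow> U \<subseteq> G \<and> (\<forall>x\<in>U. \<exists>B. Delta_set M B \<and> x \<in> B \<and> B \<subseteq> U)"
proof -
  have "istopology (\<lambda>U. U \<subseteq> G \<and> (\<forall>x\<in>U. \<exists>B. Delta_set M B \<and> x \<in> B \<and> B \<subseteq> U))"
    unfolding istopology_def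
  proof (intro conjI allI impI)
    fix S S' assume *: "S \<subseteq> G \<and> (\<forall>x\<in>S. \<exists>B. Delta_set M B \<and> x \<in> B \<and> B \<subseteq> S)"
      "S' \<subseteq> G \<and> (\<forall>x\<in>S'. \<exists>B. Delta_set M B \<and> x \<in> B \<and> B \<subseteq> S')"
    show "S \<inter> S' \<subseteq> G" using * by blast
    show "\<forall>x\<in>S \<inter> S'. \<exists>B. Delta_set M B \<and> x \<in> B \<and> B \<subseteq> S \<inter> S'"
    proof
      fix x assume "x \<in> S \<inter> S'"
      then obtain B B' where "Delta_set M B" "x \<in> B" "B \<subseteq> S" "Delta_set M B'" "x \<in> B'" "B' \<subseteq> S'"
        using * by blast
      then show "\<exists>B. Delta_set M B \<and> x \<in> B \<and> B \<subseteq> S \<inter> S'"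
        using Delta_set_Int by (intro exI[of _ "B \<inter> B'"]) auto
    qed
  next
    fix \<K> assume *: "\<forall>K\<in>\<K>. K \<subseteq> G \<and> (\<forall>x\<in>K. \<exists>B. Delta_set M B \<and> x \<in> B \<and> B \<subseteq> K)"
    then show "\<Union>\<K> \<subseteq> G" by blast
    show "\<forall>x\<in>\<Union>\<K>. \<exists>B. Delta_set M B \<and> x \<in> B \<and> B \<subseteq> \<Union>\<K>"
    proof
      fix x assume "x \<in> \<Union>\<K>"
      then obtain K where K: "K \<in> \<K>" "x \<in> K" by blast
      with * obtain B where "Delta_set M B" "x \<in> B" "B \<subseteq> K" by blast
      with K(1) show "\<exists>B. Delta_set M B \<and> x \<in> B \<and> B \<subseteq> \<Union>\<K>" by blast
    qed
  qed
  then show ?thesis unfolding T_def by (simp add: topology_inverse')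
qed

lemma openin_Delta_set: "Delta_set M B \<Longrightarrow> openin T B"
  unfolding openin_T using Delta_set_subset by blast

lemma topspace_T [simp]: "topspace T = G"
proof (rule antisym)
  show "topspace T \<subseteq> G" unfolding topspace_def openin_T by blast
  show "G \<subseteq> topspace T" using openin_subset[OF openin_Delta_set[OF Delta_set_G]] by blast
qed

lemma closedin_T_sep:
  assumes "closedin T K" "x \<in> G" "x \<notin> K"
  shows "\<exists>B. Delta_set M B \<and> x \<in> B \<and> B \<inter> K = {}"
proof -
  have "openin T (G - K)" using assms(1) by (simp add: closedin_def)
  then obtain B where "Delta_set M B" "x \<in> B" "B \<subseteq> G - K"
    using assms(2,3) unfolding openin_T by blast
  then show ?thesis by blast
qed

lemma closedin_TI:
  "\<lbrakk>K \<subseteq> G; \<And>x. \<lbrakk>x \<in> G; x \<notin> K\<rbrakk> \<Longrightarrow> \<exists>B. Delta_set M B \<and> x \<in> B \<and> B \<inter> K = {}\<rbrakk> \<Longrightarrow> closedin T K"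
  unfolding closedin_def openin_T using Delta_set_subset by fastforce

lemma continuous_into_T:
  assumes "f \<in> topspace X \<rightarrow> G" "\<And>B. Delta_set M B \<Longrightarrow> openin X {x \<in> topspace X. f x \<in> B}"
  shows "continuous_map X T f"
  unfolding continuous_map_def
proof (intro conjI allI impI)
  fix U assume U: "openin T U"
  have "{x \<in> topspace X. f x \<in> U} = \<Union>{{x \<in> topspace X. f x \<in> B} | B. Delta_set M B \<and> B \<subseteq> U}"
    using U[unfolded openin_T] by blast
  then show "openin X {x \<in> topspace X. f x \<in> U}" using assms(2) by auto
qed (use assms(1) in auto)

lemma compact_T: "compact_space T"
  unfolding compact_space_alt
proof (intro allI impI)
  fix \<U> assume \<U>: "(\<forall>U\<in>\<U>. openin T U) \<and> topspace T \<subseteq> \<Union>\<U>"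
  \<comment> \<open>The \<Delta>-sets with finitely covered complement are closed under
    intersection. Without a finite subcover the empty set is not among them, and saturation yields a
    point common to all; but the complement of a small neighbourhood of that point is one of
    them.\<close>
  define \<N> where "\<N> = {B. Delta_set M B \<and> (\<exists>\<F>. finite \<F> \<and> \<F> \<subseteq> \<U> \<and> G - B \<subseteq> \<Union>\<F>)}"
  show "\<exists>\<F>. finite \<F> \<and> \<F> \<subseteq> \<U> \<and> topspace T \<subseteq> \<Union>\<F>"
  proof (rule ccontr)
    assume no: "\<nexists>\<F>. finite \<F> \<and> \<F> \<subseteq> \<U> \<and> topspace T \<subseteq> \<Union>\<F>"
    have GN: "G \<in> \<N>" unfolding \<N>_def using Delta_set_G by auto
    have "\<exists>a. (\<forall>D\<in>{}. a \<in> D) \<and> (\<forall>N\<in>\<N>. a \<in> N)"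
    proof (rule saturated_Inter[OF kappa(3) M_small])
      show "\<forall>N\<in>\<N>. definable C M n N" unfolding \<N>_def using Delta_set_definable[of M] by auto
      show "N \<inter> N' \<in> \<N>" if N: "N \<in> \<N>" "N' \<in> \<N>" for N N'
      proof -
        obtain \<F> \<F>' where "finite \<F>" "\<F> \<subseteq> \<U>" "G - N \<subseteq> \<Union>\<F>" "finite \<F>'" "\<F>' \<subseteq> \<U>" "G - N' \<subseteq> \<Union>\<F>'"
          using N unfolding \<N>_def by blast
        then have "finite (\<F> \<union> \<F>')" "\<F> \<union> \<F>' \<subseteq> \<U>" "G - N \<inter> N' \<subseteq> \<Union>(\<F> \<union> \<F>')" by auto
        then have "\<exists>\<F>. finite \<F> \<and> \<F> \<subseteq> \<U> \<and> G - N \<inter> N' \<subseteq> \<Union>\<F>" by (intro exI conjI)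
        then show ?thesis using N Delta_set_Int unfolding \<N>_def by simp
      qed
      show "\<exists>a\<in>N. \<forall>D\<in>{}. a \<in> D" if N: "N \<in> \<N>" for N
      proof -
        have "N \<noteq> {}"
        proof
          assume "N = {}"
          then show False using N no unfolding \<N>_def by simp
        qed
        then show ?thesis by blast
      qed
    qed (use GN in auto)
    then obtain a where a: "\<forall>N\<in>\<N>. a \<in> N" by blast
    then have "a \<in> G" using GN by blast
    then obtain U where U: "U \<in> \<U>" "a \<in> U" using \<U> by auto
    then obtain B where B: "Delta_set M B" "a \<in> B" "B \<subseteq> U" using \<U> unfolding openin_T by blast
    have "G - B \<in> \<N>"
      unfolding \<N>_def using B U Delta_set_compl by (auto intro!: exI[of _ "{U}"])
    then show False using a B by blast
  qed
qed

text \<open>In a compact zero-dimensional space a clopen set separates disjoint closed sets. Here it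
  is a \<Delta>-set and thus comes with a formula, which is how definability of a map is obtained
  from topology.\<close>

lemma closed_separation:
  assumes K: "closedin T K" and L: "closedin T L" and "K \<inter> L = {}"
  shows "\<exists>B. Delta_set M B \<and> K \<subseteq> B \<and> B \<inter> L = {}"
proof -
  have K': "compactin T K" using K compact_T closedin_compact_space by blast
  define \<U> where "\<U> = {B. Delta_set M B \<and> B \<inter> L = {}}"
  have "K \<subseteq> \<Union>\<U>"
  proof
    fix x assume "x \<in> K"
    then have "x \<in> G" "x \<notin> L" using assms(3) closedin_subset[OF K] by auto
    from closedin_T_sep[OF L this] show "x \<in> \<Union>\<U>" unfolding \<U>_def by blast
  qed
  moreover have "\<forall>U\<in>\<U>. openin T U" unfolding \<U>_def using openin_Delta_set by blast
  ultimately obtain \<F> where \<F>: "finite \<F>" "\<F> \<subseteq> \<U>" "K \<subseteq> \<Union>\<F>"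
    using K' unfolding compactin_def by meson
  have "Delta_set M (\<Union>\<F>)" using \<F>(1,2)
    by (induction \<F> rule: finite_induct)
      (auto simp: \<U>_def intro: Delta_set_Un Delta_set_empty)
  moreover have "\<Union>\<F> \<inter> L = {}" using \<F>(2) unfolding \<U>_def by blast
  ultimately show ?thesis using \<F>(3) by blast
qed

text \<open>Elements of the same \<Delta>-type cannot be separated, so \<open>T\<close> may fail to
  be Hausdorff; normality is the separation property from which Hausdorff quotients are
  obtained.\<close>

lemma normal_T: "normal_space T"
  unfolding normal_space_def
proof (intro allI impI)
  fix K L assume "closedin T K \<and> closedin T L \<and> disjnt K L"
  then obtain B where "Delta_set M B" "K \<subseteq> B" "B \<inter> L = {}" "L \<subseteq> G"
    using closed_separation[of K L] closedin_subset[of T L] by (auto simp: disjnt_def)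
  then show "\<exists>U V. openin T U \<and> openin T V \<and> K \<subseteq> U \<and> L \<subseteq> V \<and> disjnt U V"
    by (intro exI[of _ B] exI[of _ "G - B"]) (auto simp: openin_Delta_set Delta_set_compl disjnt_def)
qed

lemma dense_GM: "T closure_of GM = G"
proof
  show "T closure_of GM \<subseteq> G" using closure_of_subset_topspace[of T GM] by simp
  show "G \<subseteq> T closure_of GM"
  proof
    fix x assume x: "x \<in> G"
    have "\<exists>y. y \<in> GM \<and> y \<in> U" if U: "x \<in> U \<and> openin T U" for U
    proof -
      obtain B where "Delta_set M B" "x \<in> B" "B \<subseteq> U" using U unfolding openin_T by blast
      then show ?thesis using Delta_set_meets_GM[of B] by blast
    qed
    then show "x \<in> T closure_of GM" using x unfolding in_closure_of by simp
  qed
qed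

lemma continuous_left:
  assumes "g \<in> GM" shows "continuous_map T T (\<lambda>x. g \<star> x)"
proof (rule continuous_into_T)
  have g: "g \<in> G" "set g \<subseteq> dcl C M" using assms by (auto simp: GM_eq)
  then show "(\<lambda>x. g \<star> x) \<in> topspace T \<rightarrow> G" by auto
  show "openin T {x \<in> topspace T. g \<star> x \<in> B}" if "Delta_set M B" for B
    using openin_Delta_set[OF Delta_set_left[OF _ g that]] by simp
qed

section \<open>Type-definable sets and closed sets\<close>

lemma closedin_type_definable:
  assumes "closedin T K" shows "type_definable_over C n M K"
proof -
  define \<D> where "\<D> = {B. Delta_set M B \<and> K \<subseteq> B}"
  have "x \<in> K" if "\<forall>B\<in>\<D>. x \<in> B" for x
  proof (rule ccontr)
    assume "x \<notin> K"
    have "G \<in> \<D>" unfolding \<D>_def using Delta_set_G closedin_subset[OF assms] by simp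
    then have "x \<in> G" using that by blast
    then obtain B where B: "Delta_set M B" "x \<in> B" "B \<inter> K = {}"
      using closedin_T_sep[OF assms] \<open>x \<notin> K\<close> by blast
    then have "G - B \<in> \<D>"
      unfolding \<D>_def using Delta_set_compl closedin_subset[OF assms] by auto
    then show False using that B by blast
  qed
  moreover have "length x = n" if "x \<in> K" for x
    using that closedin_subset[OF assms] length_G by auto
  ultimately have "K = {x. length x = n \<and> (\<forall>B\<in>\<D>. x \<in> B)}" unfolding \<D>_def by blast
  moreover have "\<forall>B\<in>\<D>. definable C M n B" unfolding \<D>_def using Delta_set_definable[of M] by simp
  ultimately show ?thesis unfolding type_definable_over_iff by blast
qed

text \<open>By saturation over the defining parameters together with M, a point of the closure of
  \<open>X\<close> shares its \<Delta>-type with a point of \<open>X\<close>; invariance then puts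
  the point itself into \<open>X\<close>. Thus arbitrary small parameter sets lead to nothing beyond
  M.\<close>

lemma type_definable_closedin:
  assumes X: "type_definable \<kappa> C n X" "X \<subseteq> G"
    and inv: "\<And>a b. \<lbrakk>a \<in> X; (a, b) \<in> eqD\<rbrakk> \<Longrightarrow> b \<in> X"
  shows "closedin T X"
proof (rule closedin_TI[OF X(2)], rule ccontr)
  fix x assume x: "x \<in> G" "x \<notin> X" and no: "\<nexists>B. Delta_set M B \<and> x \<in> B \<and> B \<inter> X = {}"
  obtain A \<D> where A: "|A| <o \<kappa>" and \<D>: "\<forall>D\<in>\<D>. definable C A n D"
    "X = {a. length a = n \<and> (\<forall>D\<in>\<D>. a \<in> D)}"
    using X(1) unfolding type_definable_def type_definable_over_iff by blast
  define \<N> where "\<N> = {B. Delta_set M B \<and> x \<in> B}"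
  have "\<exists>a. (\<forall>D\<in>\<D>. a \<in> D) \<and> (\<forall>N\<in>\<N>. a \<in> N)"
  proof (rule saturated_Inter[OF kappa(3) Un_small[OF A M_small]])
    show "\<forall>D\<in>\<D>. definable C (A \<union> M) n D" using \<D>(1) definable_mono by blast
    show "\<forall>N\<in>\<N>. definable C (A \<union> M) n N"
      unfolding \<N>_def using Delta_set_definable[of M] definable_mono[of C M n _ "A \<union> M"] by auto
    show "\<N> \<noteq> {}" unfolding \<N>_def using Delta_set_G x by blast
    show "N \<inter> N' \<in> \<N>" if "N \<in> \<N>" "N' \<in> \<N>" for N N'
      using that Delta_set_Int unfolding \<N>_def by blast
    show "\<exists>a\<in>N. \<forall>D\<in>\<D>. a \<in> D" if "N \<in> \<N>" for N
      using that no \<D>(2) unfolding \<N>_def by blast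
  qed
  then obtain a where a: "\<forall>D\<in>\<D>. a \<in> D" "\<forall>N\<in>\<N>. a \<in> N" by blast
  have "a \<in> G" using a(2) x Delta_set_G[of M] unfolding \<N>_def by blast
  then have "(x, a) \<in> eqD" using a(2) x unfolding \<N>_def by (intro eqD_I) auto
  moreover have "a \<in> X" using \<D>(2) a(1) \<open>a \<in> G\<close> length_G by blast
  ultimately show False using inv[of a x] x by (auto simp: eqD_iff)
qed

lemma type_definable_iff_closedin:
  assumes "X \<subseteq> G" "\<And>a b. \<lbrakk>a \<in> X; (a, b) \<in> eqD\<rbrakk> \<Longrightarrow> b \<in> X"
  shows "type_definable \<kappa> C n X \<longleftrightarrow> closedin T X"
  using type_definable_closedin assms closedin_type_definable M_small
  unfolding type_definable_def by blast

text \<open>The analogue for pairs. Invariance under equality of types in each coordinate comes from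
  \<open>eqD \<subseteq> E\<close> with symmetry and transitivity.\<close>

lemma type_definable_equiv_iff:
  assumes E: "equiv G E" "eqD \<subseteq> E"
  shows "type_definable_over C (2 * n) M ((\<lambda>(a, b). a @ b) ` E) \<longleftrightarrow> closedin (prod_topology T T) E"
proof
  have EG: "E \<subseteq> G \<times> G" using E(1) by (auto simp: equiv_def)
  define app :: "'c list \<times> 'c list \<Rightarrow> 'c list" where "app = (\<lambda>(a, b). a @ b)"
  have app: "a @ b \<in> app ` E \<longleftrightarrow> (a, b) \<in> E" if "a \<in> G" "b \<in> G" for a b
    using EG that by (force simp: app_def length_G)
  define box where "box B B' = {w. length w = 2 * n \<and> take n (drop 0 w) \<in> B} \<inter>
      {w :: 'c list. length w = 2 * n \<and> take n (drop n w) \<in> B'}" for B B'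
  have box: "definable C M (2 * n) (box B B')" if "Delta_set M B" "Delta_set M B'" for B B'
    unfolding box_def using that Delta_set_definable[of M]
    by (intro definable_Int definable_block) auto
  have box_iff: "a @ b \<in> box B B' \<longleftrightarrow> a \<in> B \<and> b \<in> B'" if "a \<in> G" "b \<in> G" for a b B B'
    using that by (auto simp: box_def length_G)
  {
    assume "type_definable_over C (2 * n) M ((\<lambda>(a, b). a @ b) ` E)"
    then obtain \<D> where \<D>: "\<forall>D\<in>\<D>. definable C M (2 * n) D"
      "app ` E = {w. length w = 2 * n \<and> (\<forall>D\<in>\<D>. w \<in> D)}"
      unfolding type_definable_over_iff app_def by blast
    have "\<exists>U V. openin T U \<and> openin T V \<and> a \<in> U \<and> b \<in> V \<and> U \<times> V \<subseteq> G \<times> G - E"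
      if ab: "(a, b) \<in> G \<times> G - E" for a b
    proof (rule ccontr)
      assume no: "\<nexists>U V. openin T U \<and> openin T V \<and> a \<in> U \<and> b \<in> V \<and> U \<times> V \<subseteq> G \<times> G - E"
      define \<N> where "\<N> = {box B B' | B B'. Delta_set M B \<and> Delta_set M B' \<and> a \<in> B \<and> b \<in> B'}"
      have "\<exists>w. (\<forall>D\<in>\<D>. w \<in> D) \<and> (\<forall>N\<in>\<N>. w \<in> N)"
      proof (rule saturated_Inter[OF kappa(3) M_small \<D>(1)])
        show "\<forall>N\<in>\<N>. definable C M (2 * n) N" unfolding \<N>_def using box by blast
        show "\<N> \<noteq> {}" unfolding \<N>_def using Delta_set_G[of M] ab by blast
        show "N \<inter> N' \<in> \<N>" if NN: "N \<in> \<N>" "N' \<in> \<N>" for N N'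
        proof -
          obtain A A' B B' where AB: "N = box A A'" "N' = box B B'" "Delta_set M A" "Delta_set M A'"
            "a \<in> A" "b \<in> A'" "Delta_set M B" "Delta_set M B'" "a \<in> B" "b \<in> B'"
            using NN unfolding \<N>_def by blast
          have "N \<inter> N' = box (A \<inter> B) (A' \<inter> B')" unfolding AB(1,2) box_def by blast
          moreover have "a \<in> A \<inter> B" "b \<in> A' \<inter> B'" using AB by simp_all
          ultimately show ?thesis
            using Delta_set_Int[OF AB(3,7)] Delta_set_Int[OF AB(4,8)] unfolding \<N>_def by blast
        qed
        show "\<exists>w\<in>N. \<forall>D\<in>\<D>. w \<in> D" if N: "N \<in> \<N>" for N
        proof -
          obtain B B' where B: "N = box B B'" "Delta_set M B" "Delta_set M B'" "a \<in> B" "b \<in> B'"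
            using N unfolding \<N>_def by blast
          have "\<not> B \<times> B' \<subseteq> G \<times> G - E"
            using no openin_Delta_set[OF B(2)] openin_Delta_set[OF B(3)] B(4,5) by blast
          then obtain x y where "x \<in> B" "y \<in> B'" "(x, y) \<in> E"
            using Delta_set_subset[OF B(2)] Delta_set_subset[OF B(3)] by blast
          then have "x @ y \<in> N" "x @ y \<in> app ` E"
            using EG B(1) box_iff[of x y B B'] by (auto simp: app)
          then show ?thesis using \<D>(2) by blast
        qed
      qed
      then obtain w where w: "\<forall>D\<in>\<D>. w \<in> D" "\<forall>N\<in>\<N>. w \<in> N" by blast
      have boxw: "w \<in> box B B'" if "Delta_set M B" "Delta_set M B'" "a \<in> B" "b \<in> B'" for B B'
        using w(2) that unfolding \<N>_def by blast
      then have "w \<in> box G G" using Delta_set_G[of M] ab by blast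
      then obtain x y where xy: "w = x @ y" "x \<in> G" "y \<in> G"
        by (auto simp: box_def intro: that[of "take n w" "take n (drop n w)"])
      have "(a, x) \<in> eqD" "(b, y) \<in> eqD"
        using boxw[of _ G] boxw[of G] box_iff[OF xy(2,3)] xy ab Delta_set_G[of M]
        by (auto intro!: eqD_I)
      moreover have "(x, y) \<in> E"
        using app[OF xy(2,3)] \<D>(2) w(1) xy by (auto simp: length_G)
      ultimately have "(a, b) \<in> E"
        using E by (meson equiv_def subsetD symD transD)
      then show False using ab by blast
    qed
    then have "openin (prod_topology T T) (G \<times> G - E)"
      unfolding openin_prod_topology_alt by blast
    then show "closedin (prod_topology T T) E" using EG by (simp add: closedin_def)
  }
  assume cl: "closedin (prod_topology T T) E"
  \<comment> \<open>\<open>box G G\<close> forces a tuple to split into two elements of the group;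
    the other sets remove the basic boxes disjoint from \<open>E\<close>.\<close>
  define \<D> where "\<D> = insert (box G G)
    {{w. length w = 2 * n \<and> w \<notin> box B B'} | B B'. Delta_set M B \<and> Delta_set M B' \<and> (B \<times> B') \<inter> E = {}}"
  have "\<forall>D\<in>\<D>. definable C M (2 * n) D"
    unfolding \<D>_def using box Delta_set_G[of M] definable_compl by blast
  moreover have "app ` E = {w. length w = 2 * n \<and> (\<forall>D\<in>\<D>. w \<in> D)}"
  proof (intro equalityI subsetI)
    fix w assume "w \<in> app ` E"
    then obtain a b where ab: "(a, b) \<in> E" "w = a @ b" "a \<in> G" "b \<in> G"
      using EG by (auto simp: app_def)
    then show "w \<in> {w. length w = 2 * n \<and> (\<forall>D\<in>\<D>. w \<in> D)}"
      using box_iff[OF ab(3,4)] by (auto simp: \<D>_def length_G)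
  next
    fix w assume w: "w \<in> {w. length w = 2 * n \<and> (\<forall>D\<in>\<D>. w \<in> D)}"
    then have "w \<in> box G G" by (simp add: \<D>_def)
    then obtain x y where xy: "w = x @ y" "x \<in> G" "y \<in> G"
      by (auto simp: box_def intro: that[of "take n w" "take n (drop n w)"])
    show "w \<in> app ` E"
    proof (rule ccontr)
      assume "w \<notin> app ` E"
      then have xyE: "(x, y) \<in> G \<times> G - E" using app[OF xy(2,3)] xy by simp
      have op: "openin (prod_topology T T) (G \<times> G - E)" using cl by (simp add: closedin_def)
      obtain U V where UV: "openin T U" "openin T V" "x \<in> U" "y \<in> V" "U \<times> V \<subseteq> G \<times> G - E"
        using op[unfolded openin_prod_topology_alt, rule_format, OF xyE] by (elim exE conjE)
      obtain B where B: "Delta_set M B" "x \<in> B" "B \<subseteq> U"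
        using UV(1,3) unfolding openin_T by blast
      obtain B' where B': "Delta_set M B'" "y \<in> B'" "B' \<subseteq> V"
        using UV(2,4) unfolding openin_T by blast
      have "B \<times> B' \<inter> E = {}" using UV(5) B(3) B'(3) by blast
      with B(1) B'(1) have "{w. length w = 2 * n \<and> w \<notin> box B B'} \<in> \<D>"
        unfolding \<D>_def by (intro insertI2 CollectI exI[of _ B] exI[of _ B'] conjI refl)
      from bspec[OF conjunct2[OF CollectD[OF w]] this] have "w \<notin> box B B'" by simp
      then show False using box_iff[OF xy(2,3), of B B'] B(2) B'(2) xy(1) by simp
    qed
  qed
  ultimately show "type_definable_over C (2 * n) M ((\<lambda>(a, b). a @ b) ` E)"
    unfolding type_definable_over_iff app_def by blast
qed

section \<open>The map from the group to the space of \<Delta>-types\<close>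

lemma tpD_in_stone: "a \<in> G \<Longrightarrow> tpD C \<Gamma> \<Delta> a M \<in> complete_Delta_types C M \<Gamma> \<Delta>"
  using dom_fm_Delta[of M] Delta_fms_Neg
  by (auto simp: complete_Delta_types_def tpD_def finitely_satisfiable_in_def G_eq)

lemma continuous_tpD: "continuous_map T (stone_space C M \<Gamma> \<Delta>) (\<lambda>a. tpD C \<Gamma> \<Delta> a M)"
proof -
  note tp = tpD_in_stone
  show ?thesis
    unfolding stone_space_def
  proof (rule continuous_on_generated_topo)
    fix U assume "U \<in> (\<lambda>\<phi>. {p \<in> complete_Delta_types C M \<Gamma> \<Delta>. \<phi> \<in> p}) ` dfms M"
    then obtain \<phi> where \<phi>: "\<phi> \<in> dfms M" "U = {p \<in> complete_Delta_types C M \<Gamma> \<Delta>. \<phi> \<in> p}"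
      by blast
    have "(\<lambda>a. tpD C \<Gamma> \<Delta> a M) -` U \<inter> topspace T = {x \<in> G. holds C \<phi> x}"
      using tp \<phi> by (auto simp: tpD_def)
    moreover have "Delta_set M {x \<in> G. holds C \<phi> x}" using \<phi>(1) unfolding Delta_set_def by blast
    ultimately show "openin T ((\<lambda>a. tpD C \<Gamma> \<Delta> a M) -` U \<inter> topspace T)"
      using openin_Delta_set by simp
  next
    show "(\<lambda>a. tpD C \<Gamma> \<Delta> a M) ` topspace T \<subseteq>
        \<Union>((\<lambda>\<phi>. {p \<in> complete_Delta_types C M \<Gamma> \<Delta>. \<phi> \<in> p}) ` dfms M)"
      using tp dom_fm_Delta[of M] by (fastforce simp: complete_Delta_types_def)
  qed
qed

lemma eqD_left:
  assumes "g \<in> GM" "(a, b) \<in> eqD" shows "(g \<star> a, g \<star> b) \<in> eqD"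
proof -
  have g: "g \<in> G" "set g \<subseteq> dcl C M" using assms by (auto simp: GM_eq)
  show ?thesis
  proof (rule eqD_I)
    fix X assume "Delta_set M X" "g \<star> a \<in> X"
    then show "g \<star> b \<in> X"
      using Delta_set_left[OF _ g, of X] assms(2) unfolding eqD_iff by blast
  qed (use assms g in \<open>auto simp: eqD_iff\<close>)
qed

text \<open>By \<open>eqD_left\<close> the definite description in \<open>stone_action\<close> does
  not depend on the realization.\<close>

lemma stone_action_tpD:
  assumes "g \<in> GM" "a \<in> G"
  shows "stone_action C M \<Gamma> \<Delta> g (tpD C \<Gamma> \<Delta> a M) = tpD C \<Gamma> \<Delta> (g \<star> a) M"
proof -
  have "(THE q. \<exists>b\<in>G. tpD C \<Gamma> \<Delta> a M = tpD C \<Gamma> \<Delta> b M \<and> q = tpD C \<Gamma> \<Delta> (g \<star> b) M) =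
      tpD C \<Gamma> \<Delta> (g \<star> a) M"
  proof (rule the_equality)
    fix q assume "\<exists>b\<in>G. tpD C \<Gamma> \<Delta> a M = tpD C \<Gamma> \<Delta> b M \<and> q = tpD C \<Gamma> \<Delta> (g \<star> b) M"
    then obtain b where "(a, b) \<in> eqD" "q = tpD C \<Gamma> \<Delta> (g \<star> b) M"
      using assms by (auto simp: eqD_def)
    then show "q = tpD C \<Gamma> \<Delta> (g \<star> a) M" using eqD_left[OF assms(1)] by (auto simp: eqD_def)
  qed (use assms in auto)
  then show ?thesis using tpD_in_stone[OF assms(2)] by (simp add: stone_action_def)
qed

section \<open>The relations \<open>F\<^sub>0\<^sub>\<Delta>\<close> and the closure of \<open>F\<^sub>\<Delta>\<close>\<close>

definition coheir :: "'c list \<Rightarrow> 'c list \<Rightarrow> bool" where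
  "coheir a b \<longleftrightarrow> (\<forall>X. Delta_set (M \<union> set b) X \<and> a \<in> X \<longrightarrow> (\<exists>g\<in>GM. g \<in> X))"

abbreviation F0 where "F0 \<equiv> F0_Delta C M \<Gamma> \<Delta>"
abbreviation Fbar where "Fbar \<equiv> Fbar_Delta C M \<Gamma> \<Delta>"

lemma F0_I:
  "\<lbrakk>(a, a1) \<in> eqD; (b, b1) \<in> eqD; coheir a b; coheir a1 b1\<rbrakk> \<Longrightarrow> (a \<star> b, a1 \<star> b1) \<in> F0"
  unfolding F0_Delta_def eqD_def coheir_def
  by (intro CollectI exI[of _ a] exI[of _ b] exI[of _ a1] exI[of _ b1]) (simp add: fin_sat_iff)

lemma F0_E:
  assumes "(x, y) \<in> F0"
  obtains a b a1 b1 where "x = a \<star> b" "y = a1 \<star> b1" "(a, a1) \<in> eqD" "(b, b1) \<in> eqD"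
    "coheir a b" "coheir a1 b1"
proof -
  obtain a b a1 b1 where *: "(x, y) = (a \<star> b, a1 \<star> b1)" "{a, b, a1, b1} \<subseteq> G"
    "tpD C \<Gamma> \<Delta> a M = tpD C \<Gamma> \<Delta> a1 M" "tpD C \<Gamma> \<Delta> b M = tpD C \<Gamma> \<Delta> b1 M"
    "finitely_satisfiable_in C n (tpD C \<Gamma> \<Delta> a (M \<union> set b)) M"
    "finitely_satisfiable_in C n (tpD C \<Gamma> \<Delta> a1 (M \<union> set b1)) M"
    using assms unfolding F0_Delta_def by blast
  show ?thesis
    by (rule that[of a b a1 b1]) (use * in \<open>simp_all add: eqD_def coheir_def fin_sat_iff\<close>)
qed

lemma F0_subset: "F0 \<subseteq> G \<times> G"
  by (auto elim!: F0_E simp: eqD_iff)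

lemma coheir_GM: "g \<in> GM \<Longrightarrow> coheir g b"
  unfolding coheir_def by blast

text \<open>Write the two elements as products with e on the left: e lies in M and is therefore a
  coheir over anything.\<close>

lemma eqD_subset_F0: "eqD \<subseteq> F0"
proof clarify
  fix b b1 assume b: "(b, b1) \<in> eqD"
  have "(e, e) \<in> eqD" using e_G by (simp add: eqD_iff)
  then have "(e \<star> b, e \<star> b1) \<in> F0" using b coheir_GM[OF e_GM] by (intro F0_I)
  then show "(b, b1) \<in> F0" using b by (simp add: eqD_iff)
qed

text \<open>Pull the \<Delta>-set back along left translation by \<open>g\<close>, find a witness
  \<open>h\<close> in G(M) there, and use the product of \<open>g\<close> and
  \<open>h\<close>.\<close>

lemma coheir_left:
  assumes g: "g \<in> GM" and "a \<in> G" and "coheir a b"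
  shows "coheir (g \<star> a) b"
  unfolding coheir_def
proof (intro allI impI)
  fix X assume X: "Delta_set (M \<union> set b) X \<and> g \<star> a \<in> X"
  have gG: "g \<in> G" "set g \<subseteq> dcl C (M \<union> set b)"
    using g subset_dcl[of "M \<union> set b" C] by (auto simp: GM_eq)
  have "Delta_set (M \<union> set b) {x \<in> G. g \<star> x \<in> X}"
    using X by (intro Delta_set_left gG) auto
  then obtain h where "h \<in> GM" "g \<star> h \<in> X"
    using assms X unfolding coheir_def by blast
  then show "\<exists>g\<in>GM. g \<in> X" using star_GM[OF g] by blast
qed

text \<open>By associativity \<open>g\<close> can be moved to the first factor, where translation
  preserves equality of types and coheirs.\<close>

lemma F0_left:
  assumes g: "g \<in> GM" and "(x, y) \<in> F0" shows "(g \<star> x, g \<star> y) \<in> F0"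
proof -
  obtain a b a1 b1 where *: "x = a \<star> b" "y = a1 \<star> b1" "(a, a1) \<in> eqD" "(b, b1) \<in> eqD"
    "coheir a b" "coheir a1 b1" using assms(2) by (rule F0_E)
  have G: "a \<in> G" "b \<in> G" "a1 \<in> G" "b1 \<in> G" "g \<in> G"
    using *(3,4) g by (auto simp: eqD_iff GM_eq)
  then have "((g \<star> a) \<star> b, (g \<star> a1) \<star> b1) \<in> F0"
    using * g by (intro F0_I eqD_left coheir_left)
  then show ?thesis using G by (simp add: *(1,2) Gs.m_assoc)
qed

text \<open>Compatibility with the action of G(M) is not built in; it is derived for the least
  member in \<open>Fbar_left\<close>.\<close>

definition congruences :: "'c list rel set" where
  "congruences = {E. equiv G E \<and> closedin (prod_topology T T) E \<and> F0 \<subseteq> E}"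

text \<open>By transitivity an equivalence relation contains F once it contains F_0. It then
  contains \<open>eqD\<close>, so type-definability over M can be replaced by closedness.\<close>

lemma Fbar_eq: "Fbar = \<Inter>congruences"
proof -
  have "equiv G E \<and> type_definable_over C (2 * n) M ((\<lambda>(a, b). a @ b) ` E) \<and> F_Delta C M \<Gamma> \<Delta> \<subseteq> E
      \<longleftrightarrow> equiv G E \<and> closedin (prod_topology T T) E \<and> F0 \<subseteq> E" for E
  proof (cases "equiv G E")
    case True
    then have "trans E" by (simp add: equiv_def)
    have F: "F_Delta C M \<Gamma> \<Delta> \<subseteq> E \<longleftrightarrow> F0 \<subseteq> E"
    proof
      assume "F_Delta C M \<Gamma> \<Delta> \<subseteq> E"
      then show "F0 \<subseteq> E" unfolding F_Delta_def by (auto dest: subsetD[OF _ r_into_trancl])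
    next
      assume "F0 \<subseteq> E"
      then have "F0\<^sup>+ \<subseteq> E\<^sup>+" by (intro subsetI) (rule trancl_mono)
      then show "F_Delta C M \<Gamma> \<Delta> \<subseteq> E" unfolding F_Delta_def using trancl_id[OF \<open>trans E\<close>] by simp
    qed
    show ?thesis
      using type_definable_equiv_iff[OF True] eqD_subset_F0 True unfolding F by blast
  qed simp
  then show ?thesis unfolding Fbar_Delta_def congruences_def by simp
qed

lemma Fbar_congruence: "Fbar \<in> congruences"
proof -
  have "G \<times> G \<in> congruences"
    using F0_subset closedin_topspace[of "prod_topology T T"]
    unfolding congruences_def by (auto simp: equiv_def refl_on_def sym_def trans_def)
  then have ne: "congruences \<noteq> {}" by blast
  have E: "refl_on G E" "sym E" "trans E" "E \<subseteq> G \<times> G" if "E \<in> congruences" for E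
    using that unfolding congruences_def by (auto simp: equiv_def)
  have "equiv G (\<Inter>congruences)"
  proof (rule equivI)
    show "\<Inter>congruences \<subseteq> G \<times> G" using ne E(4) by blast
    show "refl_on G (\<Inter>congruences)" using E(1) by (auto simp: refl_on_def)
    show "sym (\<Inter>congruences)" using E(2) by (intro symI InterI) (blast dest: symD)
    show "trans (\<Inter>congruences)" using E(3) by (intro transI InterI) (blast dest: transD)
  qed
  moreover have "closedin (prod_topology T T) (\<Inter>congruences)"
    using ne by (intro closedin_Inter) (auto simp: congruences_def)
  moreover have "F0 \<subseteq> \<Inter>congruences" unfolding congruences_def by blast
  ultimately show ?thesis unfolding Fbar_eq by (simp add: congruences_def)
qed

lemma Fbar_least: "E \<in> congruences \<Longrightarrow> Fbar \<subseteq> E"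
  unfolding Fbar_eq by blast

text \<open>The pullback of \<open>Fbar\<close> under left translation by \<open>g\<close> is again
  a closed equivalence relation containing F_0, hence contains the least one.\<close>

lemma Fbar_left:
  assumes g: "g \<in> GM" and "(x, y) \<in> Fbar" shows "(g \<star> x, g \<star> y) \<in> Fbar"
proof -
  define E where "E = {p \<in> G \<times> G. (g \<star> fst p, g \<star> snd p) \<in> Fbar}"
  have gG: "g \<in> G" using g by (simp add: GM_eq)
  have F: "equiv G Fbar" "closedin (prod_topology T T) Fbar" "F0 \<subseteq> Fbar"
    using Fbar_congruence by (auto simp: congruences_def)
  have "equiv G E"
  proof (rule equivI)
    show "refl_on G E" using F(1) gG by (auto simp: E_def equiv_def refl_on_def)
    show "sym E" using F(1) by (auto simp: E_def equiv_def intro!: symI dest: symD)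
    show "trans E" using F(1) by (auto simp: E_def equiv_def intro!: transI dest: transD)
  qed (auto simp: E_def)
  moreover have "closedin (prod_topology T T) E"
  proof -
    have "continuous_map (prod_topology T T) (prod_topology T T) (\<lambda>p. (g \<star> fst p, g \<star> snd p))"
      using continuous_map_compose[OF continuous_map_fst continuous_left[OF g]]
        continuous_map_compose[OF continuous_map_snd continuous_left[OF g]]
      by (intro continuous_map_pairedI) (simp_all add: o_def)
    from closedin_continuous_map_preimage[OF this F(2)] show ?thesis by (simp add: E_def)
  qed
  moreover have "F0 \<subseteq> E" using F0_left[OF g] F(3) F0_subset by (auto simp: E_def)
  ultimately have "E \<in> congruences" by (simp add: congruences_def)
  then show ?thesis using Fbar_least assms(2) by (force simp: E_def)
qed

section \<open>Quotients of the group by closed equivalence relations\<close>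

context
  fixes E :: "'c list rel"
  assumes E: "equiv G E" "eqD \<subseteq> E" "closedin (prod_topology T T) E"
begin

abbreviation L where "L \<equiv> logic_topology \<kappa> C \<Gamma> E"
abbreviation qa where "qa \<equiv> quotient_action C \<Gamma> E"

lemma class_eq_iff: "\<lbrakk>a \<in> G; b \<in> G\<rbrakk> \<Longrightarrow> E `` {a} = E `` {b} \<longleftrightarrow> (a, b) \<in> E"
  using eq_equiv_class_iff[OF E(1)] .

lemma class_in: "a \<in> G \<Longrightarrow> E `` {a} \<in> G // E"
  by (rule quotientI)

text \<open>The preimage of a set of classes is invariant under equality of types, so it is
  type-definable iff it is closed. This identifies the logic topology with the quotient topology and
  shows that the predicate given to \<open>topology\<close> really describes one.\<close>

lemma openin_L: "openin L U \<longleftrightarrow> U \<subseteq> G // E \<and> openin T {a \<in> G. E `` {a} \<in> U}"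
proof -
  have eq: "(U \<subseteq> G // E \<and> type_definable \<kappa> C n {a \<in> G. E `` {a} \<in> (G // E) - U}) \<longleftrightarrow>
      (U \<subseteq> G // E \<and> openin T {a \<in> G. E `` {a} \<in> U})" for U
  proof -
    have "type_definable \<kappa> C n {a \<in> G. E `` {a} \<in> (G // E) - U} \<longleftrightarrow>
        closedin T {a \<in> G. E `` {a} \<in> (G // E) - U}"
    proof (rule type_definable_iff_closedin)
      fix a b assume a: "a \<in> {a \<in> G. E `` {a} \<in> (G // E) - U}" "(a, b) \<in> eqD"
      then have "a \<in> G" "b \<in> G" "(a, b) \<in> E" using E(2) by (auto simp: eqD_iff)
      then have "E `` {a} = E `` {b}" "b \<in> G" using class_eq_iff[of a b] by blast+
      then show "b \<in> {a \<in> G. E `` {a} \<in> (G // E) - U}" using a by simp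
    qed auto
    also have "\<dots> \<longleftrightarrow> openin T (G - {a \<in> G. E `` {a} \<in> (G // E) - U})"
      by (auto simp: closedin_def)
    also have "G - {a \<in> G. E `` {a} \<in> (G // E) - U} = {a \<in> G. E `` {a} \<in> U}"
      using class_in by auto
    finally show ?thesis by simp
  qed
  have "istopology (\<lambda>U. U \<subseteq> G // E \<and> openin T {a \<in> G. E `` {a} \<in> U})"
    unfolding istopology_def
  proof (intro conjI allI impI)
    fix S S' assume *: "S \<subseteq> G // E \<and> openin T {a \<in> G. E `` {a} \<in> S}"
      "S' \<subseteq> G // E \<and> openin T {a \<in> G. E `` {a} \<in> S'}"
    then show "S \<inter> S' \<subseteq> G // E" by (intro le_infI1) simp
    have "{a \<in> G. E `` {a} \<in> S \<inter> S'} = {a \<in> G. E `` {a} \<in> S} \<inter> {a \<in> G. E `` {a} \<in> S'}" by auto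
    then show "openin T {a \<in> G. E `` {a} \<in> S \<inter> S'}" using * by (simp add: openin_Int)
  next
    fix \<K> assume *: "\<forall>K\<in>\<K>. K \<subseteq> G // E \<and> openin T {a \<in> G. E `` {a} \<in> K}"
    then show "\<Union>\<K> \<subseteq> G // E" by (intro Union_least) simp
    have "{a \<in> G. E `` {a} \<in> \<Union>\<K>} = \<Union>((\<lambda>K. {a \<in> G. E `` {a} \<in> K}) ` \<K>)" by auto
    then show "openin T {a \<in> G. E `` {a} \<in> \<Union>\<K>}" using * by auto
  qed
  then show ?thesis unfolding logic_topology_def eq by (simp add: topology_inverse')
qed

lemma topspace_L: "topspace L = G // E"
proof (rule antisym)
  show "topspace L \<subseteq> G // E" unfolding topspace_def openin_L by blast
  have "openin T {a \<in> G. E `` {a} \<in> G // E}"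
    using class_in openin_topspace[of T] by (simp cong: conj_cong)
  then have "openin L (G // E)" unfolding openin_L by simp
  then show "G // E \<subseteq> topspace L" by (rule openin_subset)
qed

lemma quotient_map_L: "quotient_map T L (\<lambda>a. E `` {a})"
  unfolding quotient_map_def topspace_L by (auto simp: openin_L quotient_def)

lemma continuous_class: "continuous_map T L (\<lambda>a. E `` {a})"
  using quotient_map_L by (rule quotient_imp_continuous_map)

lemma compact_L: "compact_space L"
  using image_compactin[OF compact_T[unfolded compact_space_def] continuous_class]
    quotient_imp_surjective_map[OF quotient_map_L]
  by (simp add: compact_space_def)

text \<open>The union of the classes meeting a closed set \<open>K\<close> is the second projection
  of \<open>E \<inter> K \<times> G\<close>, and projection along a compact factor is a closed
  map.\<close>

lemma closed_map_class: "closed_map T L (\<lambda>a. E `` {a})"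
  unfolding closed_map_def
proof (intro allI impI)
  fix K assume K: "closedin T K"
  have KG: "K \<subseteq> G" using closedin_subset[OF K] by simp
  have "closedin (prod_topology T T) (E \<inter> K \<times> G)"
    using K E(3) closedin_topspace[of T] by (intro closedin_Int) (auto simp: closedin_prod_Times_iff)
  then have "closedin T (snd ` (E \<inter> K \<times> G))"
    using Abstract_Topological_Spaces.closed_map_snd[OF compact_T] unfolding closed_map_def by blast
  moreover have "snd ` (E \<inter> K \<times> G) = {a \<in> topspace T. E `` {a} \<in> (\<lambda>a. E `` {a}) ` K}"
  proof (intro equalityI subsetI)
    fix b assume "b \<in> snd ` (E \<inter> K \<times> G)"
    then obtain a where "a \<in> K" "b \<in> G" "(a, b) \<in> E" by force
    then show "b \<in> {a \<in> topspace T. E `` {a} \<in> (\<lambda>a. E `` {a}) ` K}"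
      using class_eq_iff[of a b] KG by auto
  next
    fix b assume "b \<in> {a \<in> topspace T. E `` {a} \<in> (\<lambda>a. E `` {a}) ` K}"
    then obtain a where "b \<in> G" "a \<in> K" "E `` {b} = E `` {a}" by auto
    then have "(a, b) \<in> E \<inter> K \<times> G" using class_eq_iff[of a b] KG by auto
    then show "b \<in> snd ` (E \<inter> K \<times> G)" by force
  qed
  moreover have "(\<lambda>a. E `` {a}) ` K \<subseteq> topspace L" using KG class_in by (auto simp: topspace_L)
  ultimately show "closedin L ((\<lambda>a. E `` {a}) ` K)"
    using quotient_map_L unfolding quotient_map_closedin by simp
qed

text \<open>A closed continuous image of a normal space is Hausdorff once its points are closed; the
  preimage of a point is a section of the closed relation \<open>E\<close>.\<close>

lemma Hausdorff_L: "Hausdorff_space L"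
proof (rule Hausdorff_normal_space_closed_continuous_map_image[OF normal_T closed_map_class continuous_class])
  show "(\<lambda>a. E `` {a}) ` topspace T = topspace L"
    using quotient_map_L by (rule quotient_imp_surjective_map)
  show "t1_space L"
    unfolding t1_space_closedin_singleton
  proof
    fix X assume "X \<in> topspace L"
    then obtain a where a: "a \<in> G" "X = E `` {a}" by (auto simp: topspace_L elim: quotientE)
    have cont: "continuous_map T (prod_topology T T) (\<lambda>b. (a, b))"
      using a by (intro continuous_map_pairedI) auto
    have "{b \<in> topspace T. (a, b) \<in> E} = {b \<in> topspace T. E `` {b} \<in> {X}}"
      using class_eq_iff[OF a(1)] a by auto
    then have "closedin T {b \<in> topspace T. E `` {b} \<in> {X}}"
      using closedin_continuous_map_preimage[OF cont E(3)] by simp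
    moreover have "{X} \<subseteq> topspace L" using \<open>X \<in> topspace L\<close> by simp
    ultimately show "closedin L {X}"
      using quotient_map_L unfolding quotient_map_closedin by blast
  qed
qed

section \<open>The action of G(M) on the quotient\<close>

context
  assumes left: "\<And>g x y. \<lbrakk>g \<in> GM; (x, y) \<in> E\<rbrakk> \<Longrightarrow> (g \<star> x, g \<star> y) \<in> E"
begin

text \<open>\<open>quotient_action\<close> takes a union over the elements of a class; by
  \<open>left\<close> all sets in this union coincide.\<close>

lemma qa_class:
  assumes g: "g \<in> GM" and a: "a \<in> G" shows "qa g (E `` {a}) = E `` {g \<star> a}"
proof -
  have "E `` {g \<star> b} = E `` {g \<star> a}" if "b \<in> E `` {a}" for b
  proof -
    have "(a, b) \<in> E" using that by simp
    moreover have "b \<in> G" using calculation E(1) by (auto simp: equiv_def)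
    ultimately show ?thesis using left[OF g] class_eq_iff[of "g \<star> b" "g \<star> a"] a g E(1)
      by (auto simp: GM_eq equiv_def dest: symD)
  qed
  moreover have "a \<in> E `` {a}" using E(1) a by (simp add: equiv_def refl_on_def)
  ultimately have "(\<Union>b\<in>E `` {a}. E `` {g \<star> b}) = E `` {g \<star> a}" by blast
  then show ?thesis using class_in[OF a] by (simp add: quotient_action_def)
qed

lemma qa_closed: "\<lbrakk>g \<in> GM; X \<in> G // E\<rbrakk> \<Longrightarrow> qa g X \<in> G // E"
  by (auto elim!: quotientE simp: qa_class class_in GM_subset)

lemma qa_mult: "\<lbrakk>g \<in> GM; h \<in> GM; X \<in> G // E\<rbrakk> \<Longrightarrow> qa (g \<star> h) X = qa g (qa h X)"
  by (auto elim!: quotientE simp: qa_class star_GM GM_subset Gs.m_assoc)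

lemma qa_e: "X \<in> G // E \<Longrightarrow> qa e X = X"
  by (auto elim!: quotientE simp: qa_class e_GM)

lemma qa_inv:
  assumes "g \<in> GM" "X \<in> G // E"
  shows "qa (inv\<^bsub>Gstar C \<Gamma>\<^esub> g) (qa g X) = X" "qa g (qa (inv\<^bsub>Gstar C \<Gamma>\<^esub> g) X) = X"
  using qa_mult[of "inv\<^bsub>Gstar C \<Gamma>\<^esub> g" g X] qa_mult[of g "inv\<^bsub>Gstar C \<Gamma>\<^esub> g" X] assms
  by (simp_all add: inv_GM qa_e GM_subset)

lemma qa_Bij: "g \<in> GM \<Longrightarrow> qa g \<in> Bij (G // E)"
proof -
  assume g: "g \<in> GM"
  have "bij_betw (qa g) (G // E) (G // E)"
    by (rule bij_betwI[where g = "qa (inv\<^bsub>Gstar C \<Gamma>\<^esub> g)"])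
      (use g in \<open>auto simp: qa_closed inv_GM qa_inv\<close>)
  then show ?thesis by (simp add: Bij_def quotient_action_def)
qed

lemma group_action_qa: "group_action (pts C \<Gamma> M) (G // E) qa"
  unfolding group_action_def
proof (rule group_hom.intro[OF group_M group_BijGroup], unfold group_hom_axioms_def, rule homI)
  show "qa g \<in> carrier (BijGroup (G // E))" if "g \<in> GM" for g
    using qa_Bij[OF that] by (simp add: BijGroup_def)
  show "qa (g \<otimes>\<^bsub>pts C \<Gamma> M\<^esub> h) = qa g \<otimes>\<^bsub>BijGroup (G // E)\<^esub> qa h" if gh: "g \<in> GM" "h \<in> GM" for g h
  proof -
    \<comment> \<open>Elements of \<open>BijGroup\<close> are extensional functions, so equality has
      to be checked outside the set of classes too.\<close>
    have "qa (g \<star> h) = compose (G // E) (qa g) (qa h)"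
    proof
      fix X show "qa (g \<star> h) X = compose (G // E) (qa g) (qa h) X"
        using qa_mult[OF gh, of X] by (cases "X \<in> G // E") (simp_all add: compose_def quotient_action_def)
    qed
    then show ?thesis using qa_Bij gh by (simp add: mult_M BijGroup_def)
  qed
qed

lemma continuous_qa: "g \<in> GM \<Longrightarrow> continuous_map L L (qa g)"
proof (rule continuous_compose_quotient_map[OF quotient_map_L])
  assume g: "g \<in> GM"
  have "continuous_map T L (\<lambda>a. E `` {g \<star> a})"
    using continuous_map_compose[OF continuous_left[OF g] continuous_class] by (simp add: o_def)
  then show "continuous_map T L (qa g \<circ> (\<lambda>a. E `` {a}))"
    by (rule continuous_map_eq) (simp add: qa_class[OF g])
qed

lemma flow_L: "flow (pts C \<Gamma> M) L qa"
  unfolding flow_def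
proof (intro conjI ballI)
  fix g assume g: "g \<in> GM"
  have "homeomorphic_maps L L (qa g) (qa (inv\<^bsub>Gstar C \<Gamma>\<^esub> g))"
    unfolding homeomorphic_maps_def using continuous_qa g qa_inv[OF g] inv_GM[OF g]
    by (auto simp: topspace_L)
  then show "homeomorphic_map L L (qa g)" by (rule homeomorphic_maps_imp_map)
qed (use compact_L Hausdorff_L group_action_qa in \<open>auto simp: topspace_L\<close>)

text \<open>The orbit of the class of e is the image of G(M), which is dense in
  \<open>T\<close>.\<close>

lemma ambit_L: "ambit (pts C \<Gamma> M) L qa (E `` {e})"
  unfolding ambit_def
proof (intro conjI flow_L)
  show "E `` {e} \<in> topspace L" using class_in e_G by (simp add: topspace_L)
  have "qa g (E `` {e}) = E `` {g}" if "g \<in> GM" for g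
    using qa_class[OF that e_G] that by (simp add: GM_subset)
  then have "orbit (pts C \<Gamma> M) qa (E `` {e}) = (\<lambda>a. E `` {a}) ` GM"
    by (simp add: orbit_def Setcompr_eq_image cong: image_cong)
  then have "(\<lambda>a. E `` {a}) ` G \<subseteq> L closure_of (orbit (pts C \<Gamma> M) qa (E `` {e}))"
    using continuous_map_image_closure_subset[OF continuous_class, of GM] dense_GM by simp
  then show "L closure_of (orbit (pts C \<Gamma> M) qa (E `` {e})) = topspace L"
    using quotient_imp_surjective_map[OF quotient_map_L]
    by (intro antisym closure_of_subset_topspace) simp
qed

end

end

section \<open>Definability of the quotient flow\<close>

text \<open>
  Realizing \<open>p\<close> together with all \<open>\<Delta>\<close>-sets over \<open>M \<union> b\<close> that contain \<open>A\<close> yields a coheir: a \<open>\<Delta>\<close>-set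
  missing \<open>G(M)\<close> has a complement containing \<open>A\<close>. No extension to a complete type is needed.
\<close>

lemma in_closure_realized:
  assumes p: "p \<in> T closure_of A" and A: "A \<subseteq> GM" and b: "b \<in> G"
  obtains a where "(p, a) \<in> eqD" "coheir a b"
    "\<And>X. \<lbrakk>Delta_set (M \<union> set b) X; A \<subseteq> X\<rbrakk> \<Longrightarrow> a \<in> X"
proof -
  let ?B = "M \<union> set b"
  have pG: "p \<in> G" using p closure_of_subset_topspace[of T A] by auto
  define \<D> where "\<D> = {D. Delta_set ?B D \<and> A \<subseteq> D}"
  define \<N> where "\<N> = {B. Delta_set M B \<and> p \<in> B}"
  have "\<exists>a. (\<forall>D\<in>\<D>. a \<in> D) \<and> (\<forall>N\<in>\<N>. a \<in> N)"
  proof (rule saturated_Inter[OF kappa(3) dcl_small[OF finite_set]])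
    show "\<forall>D\<in>\<D>. definable C (dcl C ?B) n D" unfolding \<D>_def using Delta_set_definable by blast
    show "\<forall>N\<in>\<N>. definable C (dcl C ?B) n N"
      unfolding \<N>_def using Delta_set_definable Delta_set_mono by blast
    show "\<N> \<noteq> {}" unfolding \<N>_def using Delta_set_G pG by blast
    show "N \<inter> N' \<in> \<N>" if "N \<in> \<N>" "N' \<in> \<N>" for N N'
      using that Delta_set_Int unfolding \<N>_def by blast
    show "\<exists>a\<in>N. \<forall>D\<in>\<D>. a \<in> D" if "N \<in> \<N>" for N
    proof -
      have "openin T N" "p \<in> N" using that openin_Delta_set unfolding \<N>_def by auto
      then obtain a where "a \<in> A" "a \<in> N" using p unfolding in_closure_of by blast
      then show ?thesis unfolding \<D>_def by blast
    qed
  qed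
  then obtain a where a: "\<forall>D\<in>\<D>. a \<in> D" "\<forall>N\<in>\<N>. a \<in> N" by blast
  have aX: "a \<in> X" if "Delta_set ?B X" "A \<subseteq> X" for X
    using a(1) that unfolding \<D>_def by simp
  have aN: "a \<in> X" if "Delta_set M X" "p \<in> X" for X
    using a(2) that unfolding \<N>_def by simp
  have "a \<in> G" using aN[OF Delta_set_G] pG by simp
  show ?thesis
  proof (rule that)
    show "(p, a) \<in> eqD" using pG \<open>a \<in> G\<close> aN by (rule eqD_I)
    show "coheir a b"
      unfolding coheir_def
    proof (intro allI impI, rule ccontr)
      fix X assume X: "Delta_set ?B X \<and> a \<in> X" and no: "\<not> (\<exists>g\<in>GM. g \<in> X)"
      have "A \<subseteq> G - X" using A no GM_subset by blast
      then have "a \<in> G - X" using X by (intro aX Delta_set_compl) auto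
      then show False using X by blast
    qed
  qed (rule aX)
qed

text \<open>Here \<open>a\<close> is a limit of \<open>A\<close> with respect to \<Delta>-sets over
  M and b. If a b had a basic neighbourhood B disjoint from K, then {x : x b \<notin> B} would be
  such a set containing \<open>A\<close>, hence \<open>a\<close>.\<close>

lemma closed_translate:
  assumes K: "closedin T K" and A: "\<forall>g\<in>A. g \<star> b \<in> K" "A \<subseteq> GM" and ab: "a \<in> G" "b \<in> G"
    and a: "\<And>X. \<lbrakk>Delta_set (M \<union> set b) X; A \<subseteq> X\<rbrakk> \<Longrightarrow> a \<in> X"
  shows "a \<star> b \<in> K"
proof (rule ccontr)
  assume "a \<star> b \<notin> K"
  then obtain B where B: "Delta_set M B" "a \<star> b \<in> B" "B \<inter> K = {}"
    using closedin_T_sep[OF K, of "a \<star> b"] ab by auto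
  have "set b \<subseteq> dcl C (M \<union> set b)" using subset_dcl[of "M \<union> set b" C] by auto
  then have "Delta_set (M \<union> set b) {x \<in> G. x \<star> b \<in> G - B}"
    using ab B(1) by (intro Delta_set_right Delta_set_compl) (auto intro: Delta_set_mono)
  moreover have "A \<subseteq> {x \<in> G. x \<star> b \<in> G - B}"
    using A B(3) ab GM_subset by (auto intro: star_closed)
  ultimately have "a \<in> {x \<in> G. x \<star> b \<in> G - B}" by (rule a)
  then show False using B(2) by simp
qed

lemma Fbar_props:
  "equiv G Fbar" "eqD \<subseteq> Fbar" "closedin (prod_topology T T) Fbar" "F0 \<subseteq> Fbar"
  using Fbar_congruence eqD_subset_F0 unfolding congruences_def by auto

abbreviation LF where "LF \<equiv> logic_topology \<kappa> C \<Gamma> Fbar"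
abbreviation qF where "qF \<equiv> quotient_action C \<Gamma> Fbar"

lemmas topspace_LF = topspace_L[OF Fbar_props(1-3)]
lemmas quotient_map_LF = quotient_map_L[OF Fbar_props(1-3)]
lemmas continuous_LF = continuous_class[OF Fbar_props(1-3)]
lemmas Hausdorff_LF = Hausdorff_L[OF Fbar_props(1-3)]
lemmas Fbar_class_eq = class_eq_iff[OF Fbar_props(1-3)]

lemma qF_class: "\<lbrakk>g \<in> GM; a \<in> G\<rbrakk> \<Longrightarrow> qF g (Fbar `` {a}) = Fbar `` {g \<star> a}"
  using qa_class[OF Fbar_props(1-3)] Fbar_left by simp

lemma qF_closed: "\<lbrakk>g \<in> GM; X \<in> G // Fbar\<rbrakk> \<Longrightarrow> qF g X \<in> G // Fbar"
  using qa_closed[OF Fbar_props(1-3)] Fbar_left by simp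

lemma Delta_definable_LF: "Delta_definable_ambit C M \<Gamma> \<Delta> LF qF (Fbar `` {e})"
  unfolding Delta_definable_ambit_def Delta_definable_flow_def
proof (intro conjI ballI)
  show "ambit (pts C \<Gamma> M) LF qF (Fbar `` {e})"
    by (rule ambit_L[OF Fbar_props(1-3) Fbar_left])
  show "flow (pts C \<Gamma> M) LF qF"
    by (rule flow_L[OF Fbar_props(1-3) Fbar_left])
  fix X assume X: "X \<in> topspace LF"
  then obtain b where b: "b \<in> G" "X = Fbar `` {b}" unfolding topspace_LF by (auto elim: quotientE)
  show "Delta_definable_map C M \<Gamma> \<Delta> LF (\<lambda>g. qF g X)"
    unfolding Delta_definable_map_def
  proof (intro conjI allI impI)
    show "(\<lambda>g. qF g X) \<in> GM \<rightarrow> topspace LF" using X qF_closed by (auto simp: topspace_LF)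
    fix K N assume KN: "closedin LF K \<and> closedin LF N \<and> disjnt K N"
    define pre where "pre K = {a \<in> topspace T. Fbar `` {a} \<in> K}" for K
    define tr where "tr K = {g \<in> GM. g \<star> b \<in> pre K}" for K
    have pre: "closedin T (pre K)" "closedin T (pre N)"
      using KN closedin_continuous_map_preimage[OF continuous_LF] unfolding pre_def by blast+
    have tr: "tr K \<subseteq> GM" "tr N \<subseteq> GM" "\<forall>g\<in>tr K. g \<star> b \<in> pre K" "\<forall>g\<in>tr N. g \<star> b \<in> pre N"
      by (auto simp: tr_def)
    have "T closure_of tr K \<inter> T closure_of tr N = {}"
    proof (rule ccontr)
      assume "\<not> ?thesis"
      then obtain p where p: "p \<in> T closure_of tr K" "p \<in> T closure_of tr N" by blast
      obtain a where a: "(p, a) \<in> eqD" "coheir a b"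
        "\<And>X. \<lbrakk>Delta_set (M \<union> set b) X; tr K \<subseteq> X\<rbrakk> \<Longrightarrow> a \<in> X"
        using in_closure_realized[OF p(1) tr(1) b(1)] by blast
      obtain a1 where a1: "(p, a1) \<in> eqD" "coheir a1 b"
        "\<And>X. \<lbrakk>Delta_set (M \<union> set b) X; tr N \<subseteq> X\<rbrakk> \<Longrightarrow> a1 \<in> X"
        using in_closure_realized[OF p(2) tr(2) b(1)] by blast
      have G: "a \<in> G" "a1 \<in> G" "(a, a1) \<in> eqD" "(b, b) \<in> eqD"
        using a(1) a1(1) b(1) by (auto simp: eqD_iff)
      \<comment> \<open>The right factors coincide; only the two realizations of \<open>p\<close>
        differ.\<close>
      then have "(a \<star> b, a1 \<star> b) \<in> Fbar"
        using F0_I[OF G(3,4) a(2) a1(2)] Fbar_props(4) by blast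
      then have "Fbar `` {a \<star> b} = Fbar `` {a1 \<star> b}"
        using Fbar_class_eq G(1,2) b(1) by simp
      moreover have "a \<star> b \<in> pre K" "a1 \<star> b \<in> pre N"
        using closed_translate[OF pre(1) tr(3,1) G(1) b(1) a(3)]
          closed_translate[OF pre(2) tr(4,2) G(2) b(1) a1(3)] by blast+
      ultimately show False using KN by (auto simp: pre_def disjnt_def)
    qed
    \<comment> \<open>A single \<Delta>-set separates the disjoint closures, and its formula
      separates the two subsets of G(M).\<close>
    then obtain B where B: "Delta_set M B" "T closure_of tr K \<subseteq> B" "B \<inter> T closure_of tr N = {}"
      using closed_separation[of "T closure_of tr K" "T closure_of tr N"] by auto
    then obtain \<phi> where \<phi>: "\<phi> \<in> dfms M" "B = {x \<in> G. holds C \<phi> x}" unfolding Delta_set_def by blast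
    have sub: "tr K \<subseteq> T closure_of tr K" "tr N \<subseteq> T closure_of tr N"
      using tr(1,2) GM_subset by (auto intro!: closure_of_subset)
    have trI: "g \<in> tr S" if "g \<in> GM" "qF g X \<in> S" for g S
      using that b qF_class[OF that(1) b(1)] by (auto simp: tr_def pre_def GM_subset)
    show "\<exists>\<phi>\<in>dfms M. \<forall>g\<in>GM. (qF g X \<in> K \<longrightarrow> holds C \<phi> g) \<and> (qF g X \<in> N \<longrightarrow> \<not> holds C \<phi> g)"
    proof (intro bexI[OF _ \<phi>(1)] ballI conjI impI)
      fix g assume g: "g \<in> GM"
      show "holds C \<phi> g" if "qF g X \<in> K"
      proof -
        have "g \<in> B" using trI[OF g that] sub(1) B(2) by blast
        then show ?thesis unfolding \<phi>(2) by simp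
      qed
      show "\<not> holds C \<phi> g" if "qF g X \<in> N"
      proof -
        have "g \<notin> B" using trI[OF g that] sub(2) B(3) by blast
        then show ?thesis using GM_subset[OF g] unfolding \<phi>(2) by simp
      qed
    qed
  qed
qed

section \<open>\<open>\<Delta>\<close>-definable ambits as quotients of the group\<close>

text \<open>Definability of a map separates closed sets, whereas closures and continuity deal with
  open ones; closed neighbourhoods mediate between the two.\<close>

lemma regular_nbhd:
  assumes "compact_space Y" "Hausdorff_space Y" "openin Y U" "y \<in> U"
  obtains V K where "openin Y V" "closedin Y K" "y \<in> V" "V \<subseteq> K" "K \<subseteq> U"
proof -
  have "neighbourhood_base_of (closedin Y) Y"
    using compact_Hausdorff_imp_regular_space[OF assms(1,2)]
    by (simp add: neighbourhood_base_of_closedin)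
  from this[unfolded neighbourhood_base_of, rule_format, OF conjI[OF assms(3,4)]]
  show ?thesis using that by (elim exE conjE)
qed

context
  fixes Y :: "'y topology" and \<beta> and f :: "'c list \<Rightarrow> 'y"
  assumes Y: "Delta_definable_flow C M \<Gamma> \<Delta> Y \<beta>"
    and f: "continuous_map T Y f"
    and equivariant: "\<And>g x. \<lbrakk>g \<in> GM; x \<in> G\<rbrakk> \<Longrightarrow> f (g \<star> x) = \<beta> g (f x)"
begin

lemma compact_Hausdorff_Y: "compact_space Y" "Hausdorff_space Y"
  using Y unfolding Delta_definable_flow_def flow_def by auto

lemma f_in: "x \<in> G \<Longrightarrow> f x \<in> topspace Y"
  using f by (auto simp: continuous_map_def)

lemma f_open: "\<lbrakk>openin Y U; x \<in> G; f x \<in> U\<rbrakk> \<Longrightarrow> \<exists>B. Delta_set M B \<and> x \<in> B \<and> f ` B \<subseteq> U"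
proof -
  assume U: "openin Y U" "x \<in> G" "f x \<in> U"
  have "openin T {x \<in> topspace T. f x \<in> U}"
    using f U(1) by (rule openin_continuous_map_preimage)
  then obtain B where "Delta_set M B" "x \<in> B" "B \<subseteq> {x \<in> topspace T. f x \<in> U}"
    using U unfolding openin_T by auto
  then show ?thesis by blast
qed

text \<open>Topologically indistinguishable points have the same image in a Hausdorff space.\<close>

lemma f_eqD: "(a, b) \<in> eqD \<Longrightarrow> f a = f b"
proof (rule ccontr)
  assume ab: "(a, b) \<in> eqD" "f a \<noteq> f b"
  then have "a \<in> G" "b \<in> G" by (auto simp: eqD_iff)
  then obtain U V where UV: "openin Y U" "openin Y V" "f a \<in> U" "f b \<in> V" "disjnt U V"
    using compact_Hausdorff_Y(2) f_in ab(2) unfolding Hausdorff_space_def by metis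
  obtain B where B: "Delta_set M B" "a \<in> B" "f ` B \<subseteq> U" using f_open[OF UV(1) \<open>a \<in> G\<close> UV(3)] by blast
  then have "b \<in> B" using ab(1) by (auto simp: eqD_iff)
  then show False using B(3) UV(4,5) by (auto simp: disjnt_def)
qed

text \<open>The coheir property is applied to the intersection of \<open>D\<close> with the
  pullback, under right translation by \<open>b\<close>, of a neighbourhood of the product;
  equivariance turns f(g b) into g f(b).\<close>

lemma coheir_approx:
  assumes ab: "a \<in> G" "b \<in> G" "coheir a b" and D: "Delta_set M D" "a \<in> D"
    and V: "openin Y V" "f (a \<star> b) \<in> V"
  obtains g where "g \<in> GM" "g \<in> D" "\<beta> g (f b) \<in> V"
proof -
  obtain B where B: "Delta_set M B" "a \<star> b \<in> B" "f ` B \<subseteq> V"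
    using f_open[OF V(1) _ V(2)] ab by auto
  have "set b \<subseteq> dcl C (M \<union> set b)" using subset_dcl[of "M \<union> set b" C] by auto
  then have "Delta_set (M \<union> set b) (D \<inter> {x \<in> G. x \<star> b \<in> B})"
    using ab B(1) D(1) by (intro Delta_set_Int Delta_set_right) (auto intro: Delta_set_mono)
  moreover have "a \<in> D \<inter> {x \<in> G. x \<star> b \<in> B}" using ab B D by simp
  ultimately obtain g where g: "g \<in> GM" "g \<in> D" "g \<star> b \<in> B"
    using ab(3) unfolding coheir_def by blast
  then have "\<beta> g (f b) \<in> V" using B(3) equivariant[OF g(1) ab(2)] by (metis image_subset_iff)
  then show ?thesis using g that by blast
qed

lemma f_F0:
  assumes "(x, y) \<in> F0" shows "f x = f y"
proof (rule ccontr)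
  assume neq: "f x \<noteq> f y"
  obtain a b a1 b1 where ab: "x = a \<star> b" "y = a1 \<star> b1" "(a, a1) \<in> eqD" "(b, b1) \<in> eqD"
    "coheir a b" "coheir a1 b1" using assms by (rule F0_E)
  have G: "a \<in> G" "b \<in> G" "a1 \<in> G" "b1 \<in> G" using ab(3,4) by (auto simp: eqD_iff)
  have fb: "f b1 = f b" using f_eqD[OF ab(4)] by simp
  obtain U0 V0 where UV0: "openin Y U0" "openin Y V0" "f x \<in> U0" "f y \<in> V0" "disjnt U0 V0"
    using compact_Hausdorff_Y(2) f_in[of x] f_in[of y] neq ab(1,2) G unfolding Hausdorff_space_def
    by (metis star_closed)
  obtain U K where U: "openin Y U" "closedin Y K" "f x \<in> U" "U \<subseteq> K" "K \<subseteq> U0"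
    using regular_nbhd[OF compact_Hausdorff_Y UV0(1,3)] by blast
  obtain V N where V: "openin Y V" "closedin Y N" "f y \<in> V" "V \<subseteq> N" "N \<subseteq> V0"
    using regular_nbhd[OF compact_Hausdorff_Y UV0(2,4)] by blast
  have "disjnt K N" using U(5) V(5) UV0(5) unfolding disjnt_def by blast
  then obtain \<phi> where \<phi>: "\<phi> \<in> dfms M"
    "\<forall>g\<in>GM. (\<beta> g (f b) \<in> K \<longrightarrow> holds C \<phi> g) \<and> (\<beta> g (f b) \<in> N \<longrightarrow> \<not> holds C \<phi> g)"
    using Y f_in[OF G(2)] U(2) V(2) unfolding Delta_definable_flow_def Delta_definable_map_def
    by blast
  define D where "D = {x \<in> G. holds C \<phi> x}"
  have D: "Delta_set M D" unfolding D_def Delta_set_def using \<phi>(1) by blast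
  \<comment> \<open>\<open>a\<close> and \<open>a1\<close> lie on the same side of \<open>D\<close>
    by equality of types, and \<open>f b1 = f b\<close> makes both approximations run along the same
    orbit map. On either side of \<open>D\<close> one of them contradicts the choice of
    \<phi>.\<close>
  show False
  proof (cases "a \<in> D")
    case True
    then have "a1 \<in> D" using D ab(3) by (auto simp: eqD_iff)
    then obtain g where "g \<in> GM" "g \<in> D" "\<beta> g (f b1) \<in> V"
      using coheir_approx[OF G(3,4) ab(6) D _ V(1)] V(3) ab(2) by blast
    then show False using \<phi>(2) V(4) fb by (auto simp: D_def)
  next
    case False
    then have "a \<in> G - D" using G(1) by blast
    then obtain g where "g \<in> GM" "g \<in> G - D" "\<beta> g (f b) \<in> U"
      using coheir_approx[OF G(1,2) ab(5) Delta_set_compl[OF D] _ U(1)] U(3) ab(1) by blast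
    then show False using \<phi>(2) U(4) by (auto simp: D_def)
  qed
qed

text \<open>The kernel of \<open>f\<close> is closed because Y is Hausdorff, and it contains F_0 by
  \<open>f_F0\<close>; minimality of \<open>Fbar\<close> applies.\<close>

lemma Fbar_subset_kernel: "Fbar \<subseteq> {(a, b). a \<in> G \<and> b \<in> G \<and> f a = f b}"
proof (rule Fbar_least)
  let ?E = "{(a, b). a \<in> G \<and> b \<in> G \<and> f a = f b}"
  have "equiv G ?E" by (rule equivI) (auto simp: refl_on_def sym_def trans_def)
  moreover have "closedin (prod_topology T T) ?E"
  proof -
    have "closedin (prod_topology T T) {p \<in> topspace (prod_topology T T). (f \<circ> fst) p = (f \<circ> snd) p}"
      by (rule closedin_continuous_maps_eq[OF compact_Hausdorff_Y(2)])
        (rule continuous_map_compose[OF continuous_map_fst f] continuous_map_compose[OF continuous_map_snd f])+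
    also have "{p \<in> topspace (prod_topology T T). (f \<circ> fst) p = (f \<circ> snd) p} = ?E" by auto
    finally show ?thesis .
  qed
  moreover have "F0 \<subseteq> ?E" using f_F0 F0_subset by auto
  ultimately show "?E \<in> congruences" by (simp add: congruences_def)
qed

end

text \<open>The value at \<open>x\<close> is the unique limit of \<open>g y\<^sub>0\<close> as \<open>g \<in> G(M)\<close> tends to the \<open>\<Delta>\<close>-type of \<open>x\<close>.\<close>

lemma ambit_extension:
  fixes Y :: "'y topology"
  assumes Y: "Delta_definable_ambit C M \<Gamma> \<Delta> Y \<beta> y0"
  obtains f where "continuous_map T Y f" "\<And>g x. \<lbrakk>g \<in> GM; x \<in> G\<rbrakk> \<Longrightarrow> f (g \<star> x) = \<beta> g (f x)" "f e = y0"
proof -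
  have cH: "compact_space Y" "Hausdorff_space Y" and y0: "y0 \<in> topspace Y"
    and action: "group_action (pts C \<Gamma> M) (topspace Y) \<beta>"
    and cont: "\<And>g. g \<in> GM \<Longrightarrow> continuous_map Y Y (\<beta> g)"
    using Y homeomorphic_imp_continuous_map
    unfolding Delta_definable_ambit_def ambit_def flow_def by blast+
  define f0 where "f0 g = \<beta> g y0" for g
  have def: "Delta_definable_map C M \<Gamma> \<Delta> Y f0"
    using Y y0 unfolding Delta_definable_ambit_def Delta_definable_flow_def f0_def by blast
  then have f0: "f0 g \<in> topspace Y" if "g \<in> GM" for g
    using that unfolding Delta_definable_map_def by blast
  \<comment> \<open>The cluster points of the orbit map along the neighbourhoods of
    \<open>x\<close>. Compactness makes this set nonempty; definability of the orbit map will turn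
    clustering into convergence.\<close>
  define lims where "lims x = \<Inter>{Y closure_of (f0 ` (B \<inter> GM)) | B. Delta_set M B \<and> x \<in> B}" for x
  have lims_sub: "y \<in> Y closure_of (f0 ` (B \<inter> GM))" if "y \<in> lims x" "Delta_set M B" "x \<in> B" for x y B
    using that unfolding lims_def by blast
  have lims_ne: "lims x \<noteq> {}" if x: "x \<in> G" for x
    unfolding lims_def
  proof (rule cH(1)[unfolded compact_space_fip, rule_format], intro conjI ballI allI impI)
    fix K assume "K \<in> {Y closure_of (f0 ` (B \<inter> GM)) | B. Delta_set M B \<and> x \<in> B}"
    then show "closedin Y K" by auto
  next
    fix \<F> assume \<F>: "finite \<F> \<and> \<F> \<subseteq> {Y closure_of (f0 ` (B \<inter> GM)) | B. Delta_set M B \<and> x \<in> B}"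
    have "\<exists>B. Delta_set M B \<and> x \<in> B \<and> f0 ` (B \<inter> GM) \<subseteq> \<Inter>\<F>"
      using conjunct1[OF \<F>] conjunct2[OF \<F>]
    proof (induction \<F> rule: finite_induct)
      case empty
      then show ?case using Delta_set_G[of M] x by auto
    next
      case (insert K \<F>)
      then obtain B where B: "Delta_set M B" "x \<in> B" "f0 ` (B \<inter> GM) \<subseteq> \<Inter>\<F>" by auto
      obtain B' where B': "Delta_set M B'" "x \<in> B'" "K = Y closure_of (f0 ` (B' \<inter> GM))"
        using insert.prems by auto
      have "f0 ` (B' \<inter> GM) \<subseteq> K" unfolding B'(3) using f0 by (intro closure_of_subset) auto
      then show ?case
        using B B' Delta_set_Int[OF B(1) B'(1)] by (intro exI[of _ "B \<inter> B'"]) auto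
    qed
    then obtain B where B: "Delta_set M B" "x \<in> B" "f0 ` (B \<inter> GM) \<subseteq> \<Inter>\<F>" by blast
    then obtain g where "g \<in> GM" "g \<in> B" using Delta_set_meets_GM by blast
    then show "\<Inter>\<F> \<noteq> {}" using B(3) by blast
  qed
  \<comment> \<open>Definability is applied to \<open>K2\<close> and the complement of
    \<open>V1\<close>. The resulting \<Delta>-set contains \<open>x\<close>, since otherwise
    \<open>y\<close> would be a cluster point of values outside \<open>K2\<close>, although
    \<open>V2 \<subseteq> K2\<close> is a neighbourhood of it. Values on this \<Delta>-set stay in
    \<open>V1\<close>, hence in \<open>K1\<close>.\<close>
  have key: "\<exists>B K. Delta_set M B \<and> x \<in> B \<and> closedin Y K \<and> K \<subseteq> U \<and> f0 ` (B \<inter> GM) \<subseteq> K"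
    if x: "x \<in> G" and y: "y \<in> lims x" "y \<in> U" and U: "openin Y U" for x y U
  proof -
    obtain V1 K1 where 1: "openin Y V1" "closedin Y K1" "y \<in> V1" "V1 \<subseteq> K1" "K1 \<subseteq> U"
      using regular_nbhd[OF cH U y(2)] by blast
    obtain V2 K2 where 2: "openin Y V2" "closedin Y K2" "y \<in> V2" "V2 \<subseteq> K2" "K2 \<subseteq> V1"
      using regular_nbhd[OF cH 1(1,3)] by blast
    have "closedin Y (topspace Y - V1)" "disjnt K2 (topspace Y - V1)"
      using 1(1) 2(5) by (auto simp: disjnt_def)
    then obtain \<phi> where \<phi>: "\<phi> \<in> dfms M"
      "\<forall>g\<in>GM. (f0 g \<in> K2 \<longrightarrow> holds C \<phi> g) \<and> (f0 g \<in> topspace Y - V1 \<longrightarrow> \<not> holds C \<phi> g)"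
      using def 2(2) unfolding Delta_definable_map_def by meson
    define B where "B = {x \<in> G. holds C \<phi> x}"
    have B: "Delta_set M B" unfolding B_def Delta_set_def using \<phi>(1) by blast
    have "x \<in> B"
    proof (rule ccontr)
      assume "x \<notin> B"
      then have "y \<in> Y closure_of (f0 ` ((G - B) \<inter> GM))"
        using lims_sub[OF y(1) Delta_set_compl[OF B]] x by blast
      then obtain g where "g \<in> G - B" "g \<in> GM" "f0 g \<in> V2"
        using 2(1,3) unfolding in_closure_of by blast
      then show False using \<phi>(2) 2(4) by (auto simp: B_def)
    qed
    moreover have "f0 ` (B \<inter> GM) \<subseteq> K1" using \<phi>(2) f0 1(4) by (auto simp: B_def)
    ultimately show ?thesis using B 1(2,5) by blast
  qed
  \<comment> \<open>Any choice serves: by \<open>key\<close> the orbit map stays, near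
    \<open>x\<close>, inside any prescribed neighbourhood of the chosen point.\<close>
  define f where "f x = (SOME y. y \<in> lims x)" for x
  have f: "f x \<in> lims x" if "x \<in> G" for x
    using lims_ne[OF that] unfolding f_def by (auto intro: someI)
  have f_cl: "f x \<in> Y closure_of (f0 ` (B \<inter> GM))" if "Delta_set M B" "x \<in> B" for x B
    using lims_sub[OF f that] that Delta_set_subset by blast
  have f_top: "f x \<in> topspace Y" if "x \<in> G" for x
    using f_cl[OF Delta_set_G that] closure_of_subset_topspace[of Y] by blast
  have cont_f: "continuous_map T Y f"
    unfolding continuous_map_def
  proof (intro conjI allI impI)
    fix U assume U: "openin Y U"
    show "openin T {x \<in> topspace T. f x \<in> U}"
      unfolding openin_T
    proof (intro conjI ballI)
      fix x assume "x \<in> {x \<in> topspace T. f x \<in> U}"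
      then obtain B K where B: "Delta_set M B" "x \<in> B" "closedin Y K" "K \<subseteq> U" "f0 ` (B \<inter> GM) \<subseteq> K"
        using key[OF _ f _ U, of x] by auto
      have "f z \<in> U" if "z \<in> B" for z
        using f_cl[OF B(1) that] closure_of_minimal[OF B(5,3)] B(4) by blast
      then show "\<exists>B. Delta_set M B \<and> x \<in> B \<and> B \<subseteq> {x \<in> topspace T. f x \<in> U}"
        using B(1,2) Delta_set_subset[OF B(1)] by (intro exI[of _ B]) auto
    qed auto
  qed (use f_top in auto)
  have f_GM: "f g = f0 g" if g: "g \<in> GM" for g
  proof (rule ccontr)
    assume ne: "f g \<noteq> f0 g"
    have U: "openin Y (topspace Y - {f0 g})"
      using closedin_Hausdorff_singleton[OF cH(2) f0[OF g]] by blast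
    obtain B K where "Delta_set M B" "g \<in> B" "closedin Y K" "K \<subseteq> topspace Y - {f0 g}" "f0 ` (B \<inter> GM) \<subseteq> K"
      using key[OF _ f _ U, of g] ne f_top[OF GM_subset[OF g]] GM_subset[OF g] by auto
    then show False using g by blast
  qed
  show ?thesis
  proof (rule that[OF cont_f])
    show "f (g \<star> x) = \<beta> g (f x)" if g: "g \<in> GM" and x: "x \<in> G" for g x
    \<comment> \<open>Both sides are continuous in \<open>x\<close> and agree on the dense set G(M),
      where \<open>f\<close> is the orbit map.\<close>
    proof (rule forall_in_closure_of_eq[of x T GM Y])
      show "x \<in> T closure_of GM" using dense_GM x by simp
      show "Hausdorff_space Y" by (rule cH)
      show "continuous_map T Y (\<lambda>x. f (g \<star> x))"
        using continuous_map_compose[OF continuous_left[OF g] cont_f] by (simp add: o_def)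
      show "continuous_map T Y (\<lambda>x. \<beta> g (f x))"
        using continuous_map_compose[OF cont_f cont[OF g]] by (simp add: o_def)
      fix h assume h: "h \<in> GM"
      have "\<beta> (g \<otimes>\<^bsub>pts C \<Gamma> M\<^esub> h) y0 = \<beta> g (\<beta> h y0)"
        by (rule group_action.composition_rule[OF action y0 g h])
      then show "f (g \<star> h) = \<beta> g (f h)"
        using f_GM star_GM g h mult_M by (simp add: f0_def)
    qed
    have "\<beta> \<one>\<^bsub>pts C \<Gamma> M\<^esub> y0 = y0"
      using group_action.id_eq_one[OF action] y0 by (metis restrict_apply')
    then show "f e = y0" using f_GM[OF e_GM] by (simp add: f0_def one_M)
  qed
qed

section \<open>The universal ambit\<close>

lemma universal_LF:
  "universal_Delta_ambit TYPE('y) C M \<Gamma> \<Delta> LF qF (Fbar `` {e})"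
  unfolding universal_Delta_ambit_def
proof (intro conjI allI impI Delta_definable_LF)
  fix Y :: "'y topology" and \<beta> y0
  assume Y: "Delta_definable_ambit C M \<Gamma> \<Delta> Y \<beta> y0"
  obtain f where f: "continuous_map T Y f" "\<And>g x. \<lbrakk>g \<in> GM; x \<in> G\<rbrakk> \<Longrightarrow> f (g \<star> x) = \<beta> g (f x)" "f e = y0"
    using ambit_extension[OF Y] by blast
  have flow: "Delta_definable_flow C M \<Gamma> \<Delta> Y \<beta>" using Y unfolding Delta_definable_ambit_def by blast
  have ker: "f a = f b" if "(a, b) \<in> Fbar" for a b
    using Fbar_subset_kernel[OF flow f(1,2)] that by blast
  \<comment> \<open>The choice of representative is immaterial, as \<open>f\<close> is constant on
    the classes of \<open>Fbar\<close>.\<close>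
  define h where "h X = f (SOME a. a \<in> X)" for X
  have h: "h (Fbar `` {a}) = f a" if a: "a \<in> G" for a
  proof -
    have "a \<in> Fbar `` {a}" using Fbar_props(1) a by (simp add: equiv_def refl_on_def)
    then have "(SOME b. b \<in> Fbar `` {a}) \<in> Fbar `` {a}" by (rule someI)
    then show ?thesis using ker unfolding h_def by simp
  qed
  have cont: "continuous_map LF Y h"
  proof (rule continuous_compose_quotient_map[OF quotient_map_LF])
    show "continuous_map T Y (h \<circ> (\<lambda>a. Fbar `` {a}))"
      by (rule continuous_map_eq[OF f(1)]) (simp add: h)
  qed
  have image: "h ` topspace LF = f ` G"
    unfolding quotient_imp_surjective_map[OF quotient_map_LF, symmetric] image_image
    by (rule image_cong) (simp_all add: h)
  have "h ` topspace LF = topspace Y"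
  proof
    show "h ` topspace LF \<subseteq> topspace Y" using continuous_map_image_subset_topspace[OF cont] .
    \<comment> \<open>Surjectivity: the image is compact, hence closed, and it contains the dense
      orbit of \<open>y0\<close>.\<close>
    have "compactin Y (f ` G)"
      using image_compactin[OF compact_T[unfolded compact_space_def] f(1)] by simp
    then have "closedin Y (f ` G)"
      using Y compactin_imp_closedin unfolding Delta_definable_ambit_def ambit_def flow_def by blast
    moreover have "orbit (pts C \<Gamma> M) \<beta> y0 \<subseteq> f ` G"
    proof
      fix y assume "y \<in> orbit (pts C \<Gamma> M) \<beta> y0"
      then obtain g where "g \<in> GM" "y = \<beta> g y0" unfolding orbit_def by blast
      then have "y = f (g \<star> e)" "g \<star> e \<in> G" using f(2)[of g e] f(3) e_G GM_subset by auto
      then show "y \<in> f ` G" by blast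
    qed
    ultimately have "Y closure_of (orbit (pts C \<Gamma> M) \<beta> y0) \<subseteq> f ` G"
      by (intro closure_of_minimal)
    then show "topspace Y \<subseteq> h ` topspace LF"
      using Y unfolding image Delta_definable_ambit_def ambit_def by simp
  qed
  moreover have "ambit_hom (pts C \<Gamma> M) LF qF (Fbar `` {e}) Y \<beta> y0 h"
    unfolding ambit_hom_def
  proof (intro conjI cont ballI)
    show "h (Fbar `` {e}) = y0" using h[OF e_G] f(3) by simp
    fix g X assume g: "g \<in> GM" and "X \<in> topspace LF"
    then obtain a where a: "a \<in> G" "X = Fbar `` {a}" unfolding topspace_LF by (auto elim: quotientE)
    then show "h (qF g X) = \<beta> g (h X)"
      using qF_class[OF g a(1)] h f(2)[OF g a(1)] GM_subset[OF g] by simp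
  qed
  ultimately show "\<exists>h. ambit_hom (pts C \<Gamma> M) LF qF (Fbar `` {e}) Y \<beta> y0 h \<and> h ` topspace LF = topspace Y"
    by blast
qed

text \<open>\<open>E'_Delta\<close> is the kernel of the composite of \<open>h\<close> with the map
  to \<Delta>-types. This kernel contains \<open>Fbar\<close> by minimality; conversely,
  universality gives a map from U back to the quotient by \<open>Fbar\<close>, through which the
  quotient map factors.\<close>

lemma Fbar_eq_E':
  fixes U :: "'u topology"
  assumes U: "universal_Delta_ambit TYPE('c list set) C M \<Gamma> \<Delta> U \<upsilon> u0"
    and h: "ambit_hom (pts C \<Gamma> M)
      (stone_space C M \<Gamma> \<Delta>) (stone_action C M \<Gamma> \<Delta>) (tpD C \<Gamma> \<Delta> e M) U \<upsilon> u0 h"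
  shows "Fbar = E'_Delta C M \<Gamma> \<Delta> h"
proof
  let ?f = "\<lambda>a. h (tpD C \<Gamma> \<Delta> a M)"
  have cont: "continuous_map T U ?f"
    using continuous_map_compose[OF continuous_tpD] h unfolding ambit_hom_def by (fastforce simp: o_def)
  have equivariant: "?f (g \<star> x) = \<upsilon> g (?f x)" if "g \<in> GM" "x \<in> G" for g x
  proof -
    have "tpD C \<Gamma> \<Delta> x M \<in> topspace (stone_space C M \<Gamma> \<Delta>)"
      using continuous_map_image_subset_topspace[OF continuous_tpD] that(2) by auto
    then show ?thesis
      using h that(1) stone_action_tpD[OF that] unfolding ambit_hom_def by metis
  qed
  have fe: "?f e = u0" using h unfolding ambit_hom_def by blast
  have "Delta_definable_flow C M \<Gamma> \<Delta> U \<upsilon>"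
    using U unfolding universal_Delta_ambit_def Delta_definable_ambit_def by blast
  from Fbar_subset_kernel[OF this cont equivariant]
  show "Fbar \<subseteq> E'_Delta C M \<Gamma> \<Delta> h" unfolding E'_Delta_def by simp
  \<comment> \<open>The points of the quotient are sets of tuples, so they have the type
    \<open>'c list set\<close> at which universality of U is assumed.\<close>
  obtain k where k: "ambit_hom (pts C \<Gamma> M) U \<upsilon> u0 LF qF (Fbar `` {e}) k"
    using U Delta_definable_LF unfolding universal_Delta_ambit_def by blast
  \<comment> \<open>Base points and equivariance give equality on G(M); density and the Hausdorff
    property extend it to the whole group.\<close>
  have kf: "k (?f a) = Fbar `` {a}" if a: "a \<in> G" for a
  proof (rule forall_in_closure_of_eq[of a T GM LF, OF _ Hausdorff_LF _ continuous_LF])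
    show "a \<in> T closure_of GM" using dense_GM a by simp
    show "continuous_map T LF (\<lambda>a. k (?f a))"
      using continuous_map_compose[OF cont] k unfolding ambit_hom_def by (fastforce simp: o_def)
    fix g assume g: "g \<in> GM"
    have "?f g = \<upsilon> g u0" using equivariant[OF g e_G] fe GM_subset[OF g] by simp
    moreover have "u0 \<in> topspace U"
      using fe continuous_map_image_subset_topspace[OF cont] e_G by auto
    ultimately have "k (?f g) = qF g (Fbar `` {e})"
      using k g unfolding ambit_hom_def by metis
    then show "k (?f g) = Fbar `` {g}" using qF_class[OF g e_G] GM_subset[OF g] by simp
  qed
  show "E'_Delta C M \<Gamma> \<Delta> h \<subseteq> Fbar"
  proof clarify
    fix a b assume "(a, b) \<in> E'_Delta C M \<Gamma> \<Delta> h"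
    then have ab: "a \<in> G" "b \<in> G" "?f a = ?f b" unfolding E'_Delta_def by auto
    then have "Fbar `` {a} = Fbar `` {b}" using kf by metis
    then show "(a, b) \<in> Fbar" using Fbar_class_eq ab by blast
  qed
qed

section \<open>Boundedness and invariance of the closure of F\<close>

lemma Fbar_bounded: "|G // Fbar| <o \<kappa>"
proof -
  \<comment> \<open>A class is determined by the \<Delta>-type of a representative, since
    \<open>eqD \<subseteq> Fbar\<close>. Such types are subsets of \<open>fms_over C M\<close>,
    whose power set is small by the definition of a monster model.\<close>
  define tp where "tp X = tpD C \<Gamma> \<Delta> (SOME a. a \<in> X) M" for X
  have rep: "(SOME a. a \<in> X) \<in> G \<and> X = Fbar `` {SOME a. a \<in> X}" if X: "X \<in> G // Fbar" for X
  proof -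
    obtain a where a: "a \<in> G" "X = Fbar `` {a}" using X by (rule quotientE)
    then have "a \<in> X" using Fbar_props(1) by (simp add: equiv_def refl_on_def)
    then have b: "(SOME a. a \<in> X) \<in> X" by (rule someI)
    define b where "b = (SOME a. a \<in> X)"
    have "(a, b) \<in> Fbar" using b a(2) unfolding b_def by simp
    then have "Fbar `` {a} = Fbar `` {b}" by (rule equiv_class_eq[OF Fbar_props(1)])
    moreover have "b \<in> G"
      using \<open>(a, b) \<in> Fbar\<close> equiv_type[OF Fbar_props(1)] by blast
    ultimately have "b \<in> G \<and> X = Fbar `` {b}" using a(2) by simp
    then show ?thesis unfolding b_def .
  qed
  have "inj_on tp (G // Fbar)"
  proof (rule inj_onI)
    fix X X' assume X: "X \<in> G // Fbar" "X' \<in> G // Fbar" "tp X = tp X'"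
    define a b where "a = (SOME a. a \<in> X)" "b = (SOME a. a \<in> X')"
    note ab = this
    have r: "a \<in> G" "X = Fbar `` {a}" "b \<in> G" "X' = Fbar `` {b}"
      using rep[OF X(1)] rep[OF X(2)] unfolding ab by auto
    have "(a, b) \<in> eqD"
      using r X(3) unfolding eqD_def tp_def ab by simp
    then have "(a, b) \<in> Fbar" using Fbar_props(2) by blast
    then show "X = X'" using r Fbar_class_eq[of a b] by simp
  qed
  moreover have "tp ` (G // Fbar) \<subseteq> Pow (fms_over C M)"
    using Delta_fms_over[of _ M] unfolding tp_def tpD_def by auto
  ultimately have "|G // Fbar| \<le>o |Pow (fms_over C M)|" using card_of_ordLeq by blast
  then show ?thesis using kappa(2) by (rule ordLeq_ordLess_trans)
qed

lemma automorphism_eqD: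
  assumes \<sigma>: "automorphism C \<sigma>" "\<forall>m\<in>M. \<sigma> m = m" and a: "a \<in> G"
  shows "(a, map \<sigma> a) \<in> eqD"
proof -
  have *: "holds C \<phi> (map \<sigma> a) = holds C \<phi> a" if "\<phi> \<in> fms_over C M" "fv \<phi> \<subseteq> {..<n}" for \<phi>
  proof -
    have "holds C \<phi> (map \<sigma> a) = sat C UNIV (\<lambda>i. \<sigma> (a ! i)) \<phi>"
      using that(2) length_G[OF a] by (intro sat_cong) auto
    also have "\<dots> = holds C \<phi> a"
      using that(1) \<sigma> by (intro sat_automorphism) (auto simp: fms_over_def)
    finally show ?thesis .
  qed
  have "map \<sigma> a \<in> G"
    using *[of "dom_fm \<Gamma>"] a Delta_fms_over[OF dom_fm_Delta[of M]] by (simp add: G_eq)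
  moreover have "tpD C \<Gamma> \<Delta> a M = tpD C \<Gamma> \<Delta> (map \<sigma> a) M"
    using * Delta_fms_over[of _ M] unfolding tpD_def by auto
  ultimately show ?thesis using a by (simp add: eqD_def)
qed

text \<open>An automorphism over M preserves \<Delta>-types over M, so it moves every element within
  its class.\<close>

lemma Fbar_invariant: "M_invariant C M Fbar"
  unfolding M_invariant_def
proof clarify
  fix \<sigma> a b assume \<sigma>: "automorphism C \<sigma>" "\<forall>m\<in>M. \<sigma> m = m" and ab: "(a, b) \<in> Fbar"
  have "a \<in> G" "b \<in> G" using ab Fbar_props(1) by (auto simp: equiv_def)
  then have "(a, map \<sigma> a) \<in> Fbar" "(b, map \<sigma> b) \<in> Fbar"
    using automorphism_eqD[OF \<sigma>] Fbar_props(2) by auto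
  then show "(map \<sigma> a, map \<sigma> b) \<in> Fbar"
    using ab Fbar_props(1) by (meson equiv_def symD transD)
qed

end

theorem theorem3p8:
  fixes \<kappa> :: "'k rel"
    and C :: "('f, 'r, 'c) fo_structure"
    and M :: "'c set"
    and \<Gamma> :: "('f, 'r, 'c) dgroup"
    and \<Delta> :: "('f, 'r, 'c) fm set"
  assumes "monster_model \<kappa> C M"
    and "definable_group C M \<Gamma>"
    and "admissible_Delta C \<Gamma> \<Delta>"
  shows "(\<forall>(U :: 'u topology) \<upsilon> u0 h.
            universal_Delta_ambit TYPE('c list set) C M \<Gamma> \<Delta> U \<upsilon> u0 \<and>
            ambit_hom (pts C \<Gamma> M)
              (stone_space C M \<Gamma> \<Delta>) (stone_action C M \<Gamma> \<Delta>) (tpD C \<Gamma> \<Delta> \<one>\<^bsub>Gstar C \<Gamma>\<^esub> M)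
              U \<upsilon> u0 h \<longrightarrow>
            Fbar_Delta C M \<Gamma> \<Delta> = E'_Delta C M \<Gamma> \<Delta> h) \<and>
         |carrier (Gstar C \<Gamma>) // Fbar_Delta C M \<Gamma> \<Delta>| <o \<kappa> \<and>
         M_invariant C M (Fbar_Delta C M \<Gamma> \<Delta>) \<and>
         universal_Delta_ambit TYPE('x) C M \<Gamma> \<Delta>
           (logic_topology \<kappa> C \<Gamma> (Fbar_Delta C M \<Gamma> \<Delta>))
           (quotient_action C \<Gamma> (Fbar_Delta C M \<Gamma> \<Delta>))
           (Fbar_Delta C M \<Gamma> \<Delta> `` {\<one>\<^bsub>Gstar C \<Gamma>\<^esub>})"
proof -
  interpret monster_group \<kappa> C M \<Gamma> \<Delta>
    using assms by unfold_locales
  show ?thesis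
    by (intro conjI allI impI Fbar_bounded Fbar_invariant universal_LF) (elim conjE, rule Fbar_eq_E')
qed

end
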